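(* Let $n\ge5$ be odd, and let $\mathfrak g\cong\mathfrak{so}(2n,\mathbb C)$ be the Lie algebra of complex $2n\times 2n$ matrices $Z$ with $Zq+qZ^T=0$, where $q$ is the anti-diagonal matrix with all anti-diagonal entries $1$. Let $\sigma$ be the permutation of $\{1,\dots,2n\}$ with $$1\mapsto n,\quad n\mapsto 2n,\quad 2n\mapsto n+1,\quad n+1\mapsto 1,\qquad j\mapsto n+j,\quad n+j\mapsto j\quad(2\le j\le n-1),$$ and let $\lambda_n$ be the automorphism of $\mathfrak g$ induced by $E_{jk}\mapsto E_{\sigma(j)\sigma(k)}$. It has order $4$; write $\mathfrak g=\mathfrak g_0\oplus\mathfrak g_1\oplus\mathfrak g_2\oplus\mathfrak g_3$ with $\lambda_n|_{\mathfrak g_k}=i^k$. Let $$\tilde{\mathfrak g}_0=\{\operatorname{diag}(0,X,0,0,X,0): X\in\mathrm{Mat}_{n-2}(\mathbb C),\ X=-\tilde X\},\qquad \tilde X=JX^TJ.$$ Then $\tilde{\mathfrak g}_0\subset\mathfrak g_0$, $\tilde{\mathfrak g}_0\cong\mathfrak{so}(n-2,\mathbb C)$ (type $B_{(n-3)/2}$), and: (1) as a $\tilde{\mathfrak g}_0$-module, $\mathfrak g_0$ is the direct sum of $\tilde{\mathfrak g}_0$, two copies of the vector representation of $\mathfrak{so}(n-2)$ (of dimension $n-2$), one trivial one-dimensional representation, and one further copy of the adjoint representation (of dimension $\frac12(n-2)(n-3)$); (2) $\mathfrak g_0\cong\mathfrak{so}(n-1,\mathbb C)\oplus\mathfrak{so}(n-1,\mathbb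 C)\oplus\mathbb C$, of dimension $n^2-3n+3$; (3) $\dim\mathfrak g_1=\dim\mathfrak g_3=2n-2$ and $\dim\mathfrak g_2=n^2-2n+1$.
   Context: $E_{jk}$ are the matrix units of order $2n$; $J$ is the anti-diagonal matrix of order $n-2$ with all anti-diagonal entries $1$. In $\operatorname{diag}(0,X,0,0,X,0)$ the zeros are $1\times1$ blocks. *)

theory Defs
  imports "Jordan_Normal_Form.VS_Connect" "HOL-Combinatorics.Permutations"
begin

section \<open>Lie algebras and their modules\<close>

text \<open>Lie algebras are module records of HOL-Algebra with an additional bracket; a subalgebra,
  like a subspace in the library, is the record with its carrier replaced.\<close>

record ('a, 'b) lie = "('a, 'b) module" +
  lie_bracket :: "'b \<Rightarrow> 'b \<Rightarrow> 'b"

locale lie_algebra = vectorspace K L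
  for K and L :: "('a, 'b, 'd) lie_scheme" (structure) +
  assumes bracket_closed: "x \<in> carrier L \<Longrightarrow> y \<in> carrier L \<Longrightarrow> lie_bracket L x y \<in> carrier L"
    and bracket_add_left: "x \<in> carrier L \<Longrightarrow> y \<in> carrier L \<Longrightarrow> z \<in> carrier L \<Longrightarrow>
      lie_bracket L (x \<oplus> y) z = lie_bracket L x z \<oplus> lie_bracket L y z"
    and bracket_add_right: "x \<in> carrier L \<Longrightarrow> y \<in> carrier L \<Longrightarrow> z \<in> carrier L \<Longrightarrow>
      lie_bracket L x (y \<oplus> z) = lie_bracket L x y \<oplus> lie_bracket L x z"
    and bracket_smult_left: "a \<in> carrier K \<Longrightarrow> x \<in> carrier L \<Longrightarrow> y \<in> carrier L \<Longrightarrow>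
      lie_bracket L (a \<odot> x) y = a \<odot> lie_bracket L x y"
    and bracket_smult_right: "a \<in> carrier K \<Longrightarrow> x \<in> carrier L \<Longrightarrow> y \<in> carrier L \<Longrightarrow>
      lie_bracket L x (a \<odot> y) = a \<odot> lie_bracket L x y"
    and bracket_alternating: "x \<in> carrier L \<Longrightarrow> lie_bracket L x x = \<zero>"
    and jacobi: "x \<in> carrier L \<Longrightarrow> y \<in> carrier L \<Longrightarrow> z \<in> carrier L \<Longrightarrow>
      lie_bracket L x (lie_bracket L y z) \<oplus> lie_bracket L y (lie_bracket L z x)
        \<oplus> lie_bracket L z (lie_bracket L x y) = \<zero>"

definition lie_iso ::
  "('a, 'c) ring_scheme \<Rightarrow> ('a, 'b1, 'd1) lie_scheme \<Rightarrow> ('a, 'b2, 'd2) lie_scheme \<Rightarrow> ('b1 \<Rightarrow> 'b2) set"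
  where "lie_iso K L M = {f \<in> LinearCombinations.module_hom K L M. bij_betw f (carrier L) (carrier M) \<and>
    (\<forall>x\<in>carrier L. \<forall>y\<in>carrier L. f (lie_bracket L x y) = lie_bracket M (f x) (f y))}"

definition lie_isomorphic ::
  "('a, 'c) ring_scheme \<Rightarrow> ('a, 'b1, 'd1) lie_scheme \<Rightarrow> ('a, 'b2, 'd2) lie_scheme \<Rightarrow> bool"
  where "lie_isomorphic K L M \<longleftrightarrow> lie_algebra K L \<and> lie_algebra K M \<and> lie_iso K L M \<noteq> {}"

definition lie_direct_sum ::
  "('a, 'b, 'd) lie_scheme \<Rightarrow> ('a, 'c, 'e) lie_scheme \<Rightarrow> ('a, 'b \<times> 'c) lie"
  where "lie_direct_sum L M = module.extend (direct_sum L M)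
    (lie.fields (\<lambda>x y. (lie_bracket L (fst x) (fst y), lie_bracket M (snd x) (snd y))))"

locale lie_module = lie_algebra K L + V: vectorspace K V
  for K and L :: "('a, 'b, 'd) lie_scheme" (structure)
    and V :: "('a, 'c, 'e) module_scheme" and act :: "'b \<Rightarrow> 'c \<Rightarrow> 'c" +
  assumes act_closed: "x \<in> carrier L \<Longrightarrow> v \<in> carrier V \<Longrightarrow> act x v \<in> carrier V"
    and act_add_left: "x \<in> carrier L \<Longrightarrow> y \<in> carrier L \<Longrightarrow> v \<in> carrier V \<Longrightarrow>
      act (x \<oplus> y) v = act x v \<oplus>\<^bsub>V\<^esub> act y v"
    and act_add_right: "x \<in> carrier L \<Longrightarrow> v \<in> carrier V \<Longrightarrow> w \<in> carrier V \<Longrightarrow>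
      act x (v \<oplus>\<^bsub>V\<^esub> w) = act x v \<oplus>\<^bsub>V\<^esub> act x w"
    and act_smult_left: "a \<in> carrier K \<Longrightarrow> x \<in> carrier L \<Longrightarrow> v \<in> carrier V \<Longrightarrow>
      act (a \<odot> x) v = a \<odot>\<^bsub>V\<^esub> act x v"
    and act_smult_right: "a \<in> carrier K \<Longrightarrow> x \<in> carrier L \<Longrightarrow> v \<in> carrier V \<Longrightarrow>
      act x (a \<odot>\<^bsub>V\<^esub> v) = a \<odot>\<^bsub>V\<^esub> act x v"
    and act_bracket: "x \<in> carrier L \<Longrightarrow> y \<in> carrier L \<Longrightarrow> v \<in> carrier V \<Longrightarrow>
      act (lie_bracket L x y) v = act x (act y v) \<ominus>\<^bsub>V\<^esub> act y (act x v)"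

definition lie_module_isomorphic ::
  "('a, 'c) ring_scheme \<Rightarrow> ('a, 'b, 'd) lie_scheme \<Rightarrow>
   ('a, 'v, 'e) module_scheme \<Rightarrow> ('b \<Rightarrow> 'v \<Rightarrow> 'v) \<Rightarrow>
   ('a, 'w, 'f) module_scheme \<Rightarrow> ('b \<Rightarrow> 'w \<Rightarrow> 'w) \<Rightarrow> bool"
  where "lie_module_isomorphic K L V actV W actW \<longleftrightarrow>
    lie_module K L V actV \<and> lie_module K L W actW \<and>
    (\<exists>f \<in> LinearCombinations.module_hom K V W. bij_betw f (carrier V) (carrier W) \<and>
      (\<forall>x\<in>carrier L. \<forall>v\<in>carrier V. f (actV x v) = actW x (f v)))"

definition internal_direct_sum ::
  "('a, 'c) ring_scheme \<Rightarrow> ('a, 'b, 'd) module_scheme \<Rightarrow> 'i set \<Rightarrow> ('i \<Rightarrow> 'b set) \<Rightarrow> bool"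
  where "internal_direct_sum K V I W \<longleftrightarrow> finite I \<and> (\<forall>i\<in>I. subspace K (W i) V) \<and>
    (\<forall>v\<in>carrier V. \<exists>!w. w \<in> (\<Pi>\<^sub>E i\<in>I. W i) \<and> v = (\<Oplus>\<^bsub>V\<^esub> i\<in>I. w i))"

text \<open>The library's dimension is meaningful only for finite-dimensional spaces.\<close>

definition has_dim :: "('a, 'c) ring_scheme \<Rightarrow> ('a, 'b, 'd) module_scheme \<Rightarrow> nat \<Rightarrow> bool"
  where "has_dim K V d \<longleftrightarrow> vectorspace K V \<and> vectorspace.fin_dim K V \<and> vectorspace.dim K V = d"

definition has_order_on :: "('b \<Rightarrow> 'b) \<Rightarrow> 'b set \<Rightarrow> nat \<Rightarrow> bool"
  where "has_order_on f A m \<longleftrightarrow> 0 < m \<and> (\<forall>x\<in>A. (f ^^ m) x = x) \<and>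
    (\<forall>k. 0 < k \<and> k < m \<longrightarrow> (\<exists>x\<in>A. (f ^^ k) x \<noteq> x))"

section \<open>Complex matrix Lie algebras\<close>

abbreviation CC :: "complex ring" where "CC \<equiv> class_ring"

definition gl :: "nat \<Rightarrow> (complex, complex mat) lie"
  where "gl N = module.extend (module_mat TYPE(complex) N N) (lie.fields (\<lambda>A B. A * B - B * A))"

lemma gl_simps:
  "carrier (gl N) = carrier_mat N N" "zero (gl N) = 0\<^sub>m N N" "add (gl N) = (+)"
  "smult (gl N) = (\<cdot>\<^sub>m)" "lie_bracket (gl N) = (\<lambda>A B. A * B - B * A)"
  by (auto simp: gl_def module_mat_def module.defs lie.defs)

lemma abelian_group_gl: "abelian_group (gl N)"
  by (rule abelian_groupI)
    (auto simp: gl_simps add_uminus_minus_mat intro!: bexI[of _ "- _"] comm_add_mat)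

definition so_form :: "nat \<Rightarrow> complex mat \<Rightarrow> (complex, complex mat) lie"
  where "so_form N q = (gl N)\<lparr>carrier :=
    {Z \<in> carrier_mat N N. Z * q + q * transpose_mat Z = 0\<^sub>m N N}\<rparr>"

text \<open>The standard orthogonal Lie algebra, i.e. the skew-symmetric matrices.\<close>

definition so :: "nat \<Rightarrow> (complex, complex mat) lie"
  where "so N = so_form N (1\<^sub>m N)"

definition antidiag :: "nat \<Rightarrow> complex mat"
  where "antidiag N = mat N N (\<lambda>(i, j). if i + j + 1 = N then 1 else 0)"

definition abelian_C :: "(complex, complex) lie"
  where "abelian_C = \<lparr>carrier = UNIV, mult = (*), one = 1, zero = 0, add = (+), smult = (*),
    lie_bracket = (\<lambda>x y. 0)\<rparr>"

definition type_B :: "nat \<Rightarrow> (complex, 'b, 'd) lie_scheme \<Rightarrow> bool"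
  where "type_B l L \<longleftrightarrow> 1 \<le> l \<and> lie_isomorphic CC L (so (2 * l + 1))"

section \<open>The automorphism and its grading\<close>

text \<open>Row and column labels in \<open>\<sigma>\<close> and \<open>E_unit\<close> run from 1, whereas matrix entries in the
  library are addressed from 0.\<close>

definition \<sigma> :: "nat \<Rightarrow> nat \<Rightarrow> nat"
  where "\<sigma> n j =
    (if j = 1 then n
     else if j = n then 2 * n
     else if j = 2 * n then n + 1
     else if j = n + 1 then 1
     else if 2 \<le> j \<and> j \<le> n - 1 then n + j
     else if n + 2 \<le> j \<and> j \<le> 2 * n - 1 then j - n
     else j)"

definition E_unit :: "nat \<Rightarrow> nat \<Rightarrow> nat \<Rightarrow> complex mat"
  where "E_unit N j k = mat N N (\<lambda>(a, b). if a + 1 = j \<and> b + 1 = k then 1 else 0)"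

text \<open>The linear extension of \<open>E_unit (2n) j k \<mapsto> E_unit (2n) (\<sigma> j) (\<sigma> k)\<close>.\<close>

definition lam :: "nat \<Rightarrow> complex mat \<Rightarrow> complex mat"
  where "lam n Z = (\<Oplus>\<^bsub>gl (2 * n)\<^esub> p \<in> {1..2 * n} \<times> {1..2 * n}.
    Z $$ (fst p - 1, snd p - 1) \<cdot>\<^sub>m E_unit (2 * n) (\<sigma> n (fst p)) (\<sigma> n (snd p)))"

lemma lam_E_unit:
  assumes "1 \<le> j" "j \<le> 2 * n" "1 \<le> k" "k \<le> 2 * n"
  shows "lam n (E_unit (2 * n) j k) = E_unit (2 * n) (\<sigma> n j) (\<sigma> n k)"
proof -
  interpret abelian_group "gl (2 * n)" by (rule abelian_group_gl)
  have "lam n (E_unit (2 * n) j k) = (\<Oplus>\<^bsub>gl (2 * n)\<^esub> p \<in> {1..2 * n} \<times> {1..2 * n}.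
    if (j, k) = p then E_unit (2 * n) (\<sigma> n (fst p)) (\<sigma> n (snd p)) else \<zero>\<^bsub>gl (2 * n)\<^esub>)"
    unfolding lam_def
    by (rule finsum_cong') (auto simp: gl_simps E_unit_def intro!: eq_matI)
  also have "\<dots> = E_unit (2 * n) (\<sigma> n j) (\<sigma> n k)"
    by (subst finsum_singleton[of "(j, k)" _ "\<lambda>p. E_unit (2 * n) (\<sigma> n (fst p)) (\<sigma> n (snd p))"])
      (use assms in \<open>auto simp: gl_simps E_unit_def\<close>)
  finally show ?thesis .
qed

definition \<gg> :: "nat \<Rightarrow> (complex, complex mat) lie"
  where "\<gg> n = so_form (2 * n) (antidiag (2 * n))"

definition grade :: "nat \<Rightarrow> nat \<Rightarrow> complex mat set"
  where "grade n k = {Z \<in> carrier (\<gg> n). lam n Z = \<i> ^ k \<cdot>\<^sub>m Z}"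

definition \<gg>_grade :: "nat \<Rightarrow> nat \<Rightarrow> (complex, complex mat) lie"
  where "\<gg>_grade n k = (\<gg> n)\<lparr>carrier := grade n k\<rparr>"

definition tilde :: "nat \<Rightarrow> complex mat \<Rightarrow> complex mat"
  where "tilde n X = antidiag (n - 2) * transpose_mat X * antidiag (n - 2)"

definition diag_emb :: "complex mat \<Rightarrow> complex mat"
  where "diag_emb X =
    diag_block_mat [0\<^sub>m 1 1, X, 0\<^sub>m 1 1, 0\<^sub>m 1 1, X, 0\<^sub>m 1 1]"

definition \<gg>_tilde0 :: "nat \<Rightarrow> (complex, complex mat) lie"
  where "\<gg>_tilde0 n = (\<gg> n)\<lparr>carrier :=
    {diag_emb X | X. X \<in> carrier_mat (n - 2) (n - 2) \<and> X = - tilde n X}\<rparr>"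

text \<open>The block \<open>X\<close> of \<open>diag_emb X\<close>; it identifies \<open>\<gg>_tilde0 n\<close> with
  \<open>so_form (n - 2) (antidiag (n - 2))\<close>, and the vector representation is the natural action
  of the latter on column vectors.\<close>

definition mid_block :: "nat \<Rightarrow> complex mat \<Rightarrow> complex mat"
  where "mid_block n Z = mat (n - 2) (n - 2) (\<lambda>(a, b). Z $$ (a + 1, b + 1))"

definition vector_act :: "nat \<Rightarrow> complex mat \<Rightarrow> complex vec \<Rightarrow> complex vec"
  where "vector_act n Z v = mid_block n Z *\<^sub>v v"

end

theory Submission
  imports Defs
begin

text \<open>
  The automorphism is conjugation by a permutation matrix of order 4 that preserves the form
  \<open>q\<close>. Its eigenspaces for \<open>1\<close> and \<open>-1\<close> have dimension \<open>n - 1\<close> and are nondegenerate and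
  orthogonal to each other; those for \<open>\<i>\<close> and \<open>-\<i>\<close> are isotropic lines that are paired by \<open>q\<close>. In a
  suitable basis of eigenvectors the automorphism multiplies the matrix entry \<open>(i, j)\<close> by the
  quotient of the eigenvalues of the two basis vectors, and the form is again given by an
  involution of the basis. Hence every grade consists of the skew matrices with a given support:
  \<open>\<gg>\<^sub>0\<close> is the sum of the orthogonal algebras of the first two eigenspaces and of the endomorphisms
  of the hyperbolic plane that scale its two isotropic lines by opposite factors. The basis is
  chosen such that \<open>diag(0, X, 0, 0, X, 0)\<close> acts as \<open>diag(0, X)\<close> on each of the two big eigenspaces, so that
  the decomposition of \<open>\<gg>\<^sub>0\<close> as a module can be read off from the blocks.
\<close>

section \<open>Lie algebras and modules over arbitrary fields\<close>

text \<open>Diagonalising the automorphism alone does not suffice: in an arbitrary eigenbasis the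
  condition \<open>Z * q + q * Z^T = 0\<close> no longer relates just two entries at a time. The
  eigenvectors are therefore scaled so that their Gram matrix is again the permutation matrix of an
  involution \<pi>. The form is bilinear, so on a 2-cycle the sum and the difference of the unit
  vectors pair with their mirror images with opposite signs; the factor \<i> in the vectors for -1
  repairs the sign, and \<open>csqrt (1 / 2)\<close> and the halves normalise the value to 1. Such
  skew matrices form a second exterior power, the entry \<open>(i, \<pi> k)\<close> being the
  coefficient of the pair \<open>i < k\<close>. The automorphism scales it by the product of the two
  eigenvalues, so every dimension is a count of pairs with a given product. For (1): the orthogonal
  algebra of an (n - 1)-dimensional space is that of a nondegenerate hyperplane plus a copy of the
  hyperplane, which is the vector representation. This leaves two copies of so(n - 2), in which
  \<open>\<gg>_tilde0\<close> is the diagonal; the second copy is a complement of it and carries the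
  adjoint representation.\<close>

abbreviation "lin_hom \<equiv> LinearCombinations.module_hom"

lemma module_hom_comp:
  assumes "f \<in> lin_hom K L M" "g \<in> lin_hom K M N"
  shows "g \<circ> f \<in> lin_hom K L N"
proof -
  have "f x \<in> carrier M" if "x \<in> carrier L" for x
    using LinearCombinations.module_hom_closed[OF assms(1)] that by blast
  then show ?thesis
    using assms by (simp add: LinearCombinations.module_hom_def Pi_iff)
qed

lemma lie_isoI:
  assumes "f \<in> lin_hom K L M" "bij_betw f (carrier L) (carrier M)"
    "\<And>x y. x \<in> carrier L \<Longrightarrow> y \<in> carrier L \<Longrightarrow> f (lie_bracket L x y) = lie_bracket M (f x) (f y)"
  shows "f \<in> lie_iso K L M"
  using assms by (auto simp: lie_iso_def)

lemma lie_iso_comp: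
  assumes "f \<in> lie_iso K L M" "g \<in> lie_iso K M N"
  shows "g \<circ> f \<in> lie_iso K L N"
proof -
  have "\<And>x. x \<in> carrier L \<Longrightarrow> f x \<in> carrier M"
    using assms(1) by (auto simp: lie_iso_def bij_betw_def)
  then show ?thesis
    using assms by (auto simp: lie_iso_def LinearCombinations.module_hom_def intro: bij_betw_trans)
qed

text \<open>Injectivity of \<open>f\<close> reduces each identity for \<open>g\<close> to its image
  under \<open>f\<close>, where it is the homomorphism property; so a right inverse with values in
  \<open>L\<close> is enough. In this way \<open>diag_emb\<close> inherits its properties from
  \<open>mid_block\<close>.\<close>

lemma lie_iso_inverse:
  assumes L: "lie_algebra K L" and f: "f \<in> lie_iso K L M"
    and g: "\<And>y. y \<in> carrier M \<Longrightarrow> g y \<in> carrier L \<and> f (g y) = y"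
  shows "g \<in> lie_iso K M L"
proof -
  interpret L: lie_algebra K L by fact
  have inj: "inj_on f (carrier L)" and surj: "f ` carrier L = carrier M"
    and hom: "f \<in> lin_hom K L M"
    and br: "\<And>x y. x \<in> carrier L \<Longrightarrow> y \<in> carrier L \<Longrightarrow> f (lie_bracket L x y) = lie_bracket M (f x) (f y)"
    using f by (auto simp: lie_iso_def bij_betw_def)
  have gI: "g y = x" if "x \<in> carrier L" "f x = y" for x y
  proof -
    have "y \<in> carrier M" using that surj by blast
    then show ?thesis using g[of y] that inj by (auto dest: inj_onD)
  qed
  have "g (x \<oplus>\<^bsub>M\<^esub> y) = g x \<oplus>\<^bsub>L\<^esub> g y" if "x \<in> carrier M" "y \<in> carrier M" for x y
    using g[OF that(1)] g[OF that(2)] LinearCombinations.module_hom_add[OF hom, of "g x" "g y"]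
    by (intro gI) simp_all
  moreover have "g (r \<odot>\<^bsub>M\<^esub> x) = r \<odot>\<^bsub>L\<^esub> g x" if "r \<in> carrier K" "x \<in> carrier M" for r x
    using g[OF that(2)] that(1) LinearCombinations.module_hom_smult[OF hom, of r "g x"]
    by (intro gI) simp_all
  moreover have "g (lie_bracket M x y) = lie_bracket L (g x) (g y)" if "x \<in> carrier M" "y \<in> carrier M" for x y
    using g[OF that(1)] g[OF that(2)] br[of "g x" "g y"] L.bracket_closed by (intro gI) simp_all
  moreover have "bij_betw g (carrier M) (carrier L)"
  proof (rule bij_betwI[where g = f])
    show "g \<in> carrier M \<rightarrow> carrier L" using g by blast
    show "f \<in> carrier L \<rightarrow> carrier M" using surj by blast
    show "f (g x) = x" if "x \<in> carrier M" for x using g[OF that] by simp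
    show "g (f y) = y" if "y \<in> carrier L" for y using gI[OF that] by simp
  qed
  moreover have "g \<in> carrier M \<rightarrow> carrier L" using g by blast
  ultimately show ?thesis by (simp add: lie_iso_def LinearCombinations.module_hom_def)
qed

lemma lie_isomorphicI:
  assumes "lie_algebra K L" "lie_algebra K M" "f \<in> lie_iso K L M"
  shows "lie_isomorphic K L M"
  using assms by (auto simp: lie_isomorphic_def)

text \<open>The axioms of the source are transported along the isomorphism, so that for the target only
  the vector space axioms remain to be checked.\<close>

lemma lie_module_isomorphicI:
  assumes V: "lie_module K L V act" and W: "vectorspace K W"
    and f: "f \<in> lin_hom K V W" and bij: "bij_betw f (carrier V) (carrier W)"
    and eq: "\<And>x v. x \<in> carrier L \<Longrightarrow> v \<in> carrier V \<Longrightarrow> f (act x v) = act' x (f v)"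
  shows "lie_module_isomorphic K L V act W act'"
proof -
  interpret V: lie_module K L V act by fact
  interpret W: vectorspace K W by fact
  interpret f: linear_map K V W f
    using f by unfold_locales
  have ex: "\<exists>v\<in>carrier V. f v = w" if "w \<in> carrier W" for w
    using bij that unfolding bij_betw_def by (metis imageE)
  have "lie_module K L W act'"
  proof (unfold_locales, goal_cases)
    case (1 x w)
    then show ?case using ex[of w] eq V.act_closed f.f_im by metis
  next
    case (2 x y w)
    then obtain v where "v \<in> carrier V" "f v = w" using ex by blast
    then show ?case using 2
      by (metis V.act_add_left V.act_closed V.module.M.add.m_closed V.M.add.m_closed eq f.f_add)
  next
    case (3 x w w')
    then obtain v v' where "v \<in> carrier V" "f v = w" "v' \<in> carrier V" "f v' = w'" using ex by meson
    then show ?case using 3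
      by (metis V.act_add_right V.act_closed V.V.module.M.add.m_closed eq f.f_add)
  next
    case (4 a x w)
    then obtain v where "v \<in> carrier V" "f v = w" using ex by blast
    then show ?case using 4
      by (metis V.act_smult_left V.act_closed V.smult_closed eq f.f_smult)
  next
    case (5 a x w)
    then obtain v where "v \<in> carrier V" "f v = w" using ex by blast
    then show ?case using 5
      by (metis V.act_smult_right V.act_closed V.V.smult_closed eq f.f_smult)
  next
    case (6 x y w)
    then obtain v where v: "v \<in> carrier V" "f v = w" using ex by blast
    then have c: "act x v \<in> carrier V" "act y v \<in> carrier V" "act x (act y v) \<in> carrier V"
      "act y (act x v) \<in> carrier V" "lie_bracket L x y \<in> carrier L"
      using 6 V.act_closed V.bracket_closed by auto
    have "act' (lie_bracket L x y) w = f (act x (act y v) \<ominus>\<^bsub>V\<^esub> act y (act x v))"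
      using eq[OF c(5) v(1)] v 6 V.act_bracket by simp
    also have "\<dots> = f (act x (act y v)) \<ominus>\<^bsub>W\<^esub> f (act y (act x v))"
      using c f.f_minus by simp
    finally show ?case using c v 6 eq by metis
  qed
  then show ?thesis
    unfolding lie_module_isomorphic_def using V f bij eq by blast
qed

text \<open>Finite dimension passes from the source of a surjective linear map to its target, so the
  argument runs through the inverse \<open>g\<close>, which starts at the coordinate space.\<close>

lemma has_dim_vec:
  fixes V :: "(complex, 'b, 'd) module_scheme"
  assumes V: "vectorspace CC V"
    and f: "f \<in> lin_hom CC V (module_vec TYPE(complex) d)"
    and bij: "bij_betw f (carrier V) (carrier_vec d)"
  shows "has_dim CC V d"
proof -
  interpret V: vectorspace CC V by fact
  interpret W: vec_space "TYPE(complex)" d .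
  interpret f: linear_map CC V "module_vec TYPE(complex) d" f
    using f V vec_vs by (auto simp: linear_map_def mod_hom_def mod_hom_axioms_def vectorspace_def)
  define g where "g = inv_into (carrier V) f"
  have g: "g v \<in> carrier V" "f (g v) = v" if "v \<in> carrier_vec d" for v
    using bij that unfolding g_def
    by (auto simp: bij_betw_def inv_into_into f_inv_into_f)
  have gf: "g (f x) = x" if "x \<in> carrier V" for x
    using bij that unfolding g_def by (auto simp: bij_betw_def)
  have bg: "bij_betw g (carrier_vec d) (carrier V)"
    unfolding g_def by (rule bij_betw_inv_into[OF bij])
  have "g (u + v) = g u \<oplus>\<^bsub>V\<^esub> g v" if "u \<in> carrier_vec d" "v \<in> carrier_vec d" for u v
  proof -
    have "f (g u \<oplus>\<^bsub>V\<^esub> g v) = u + v"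
      using g that f.f_add[of "g u" "g v"] by (simp add: module_vec_simps)
    then show ?thesis using gf g that by (metis V.M.add.m_closed)
  qed
  moreover have "g (c \<cdot>\<^sub>v u) = c \<odot>\<^bsub>V\<^esub> g u" if "u \<in> carrier_vec d" for u c
  proof -
    have "f (c \<odot>\<^bsub>V\<^esub> g u) = c \<cdot>\<^sub>v u"
      using g that f.f_smult[of c "g u"] by (simp add: module_vec_simps)
    then show ?thesis using gf g that by (metis V.smult_closed UNIV_I partial_object.select_convs(1))
  qed
  ultimately have "g \<in> lin_hom CC (module_vec TYPE(complex) d) V"
    using g by (auto simp: LinearCombinations.module_hom_def module_vec_simps)
  then interpret g: linear_map CC "module_vec TYPE(complex) d" V g
    using V vec_vs by (auto simp: linear_map_def mod_hom_def mod_hom_axioms_def vectorspace_def)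
  have "V.fin_dim" "W.dim = V.dim"
    using g.surj_fin_dim g.dim_eq bg by (auto simp: bij_betw_def module_vec_simps)
  then show ?thesis
    using V by (simp add: has_dim_def W.dim_is_n)
qed

section \<open>Direct sums of Lie algebras and the one-dimensional abelian algebra\<close>

lemma lie_direct_sum_simps:
  "carrier (lie_direct_sum L M) = carrier L \<times> carrier M"
  "zero (lie_direct_sum L M) = (\<zero>\<^bsub>L\<^esub>, \<zero>\<^bsub>M\<^esub>)"
  "add (lie_direct_sum L M) = (\<lambda>v w. (fst v \<oplus>\<^bsub>L\<^esub> fst w, snd v \<oplus>\<^bsub>M\<^esub> snd w))"
  "smult (lie_direct_sum L M) = (\<lambda>c v. (c \<odot>\<^bsub>L\<^esub> fst v, c \<odot>\<^bsub>M\<^esub> snd v))"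
  "lie_bracket (lie_direct_sum L M) =
    (\<lambda>x y. (lie_bracket L (fst x) (fst y), lie_bracket M (snd x) (snd y)))"
  by (auto simp: lie_direct_sum_def direct_sum_def module.defs lie.defs)

lemma lie_algebra_direct_sum:
  assumes "lie_algebra K L" "lie_algebra K M"
  shows "lie_algebra K (lie_direct_sum L M)"
proof -
  interpret L: lie_algebra K L by fact
  interpret M: lie_algebra K M by fact
  have "vectorspace K (lie_direct_sum L M)"
  proof (rule vs_criteria, goal_cases)
    case 4
    then show ?case
      by (auto simp: lie_direct_sum_simps intro!: bexI[of _ "\<ominus>\<^bsub>L\<^esub> _"] bexI[of _ "\<ominus>\<^bsub>M\<^esub> _"]
        L.M.r_neg M.M.r_neg)
  qed (auto simp: lie_direct_sum_simps L.field_axioms L.M.a_ac M.M.a_ac L.smult_assoc1 M.smult_assoc1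
      L.smult_l_distr M.smult_l_distr L.smult_r_distr M.smult_r_distr)
  then show ?thesis
    by (intro lie_algebra.intro lie_algebra_axioms.intro)
      (auto simp: lie_direct_sum_simps L.bracket_closed M.bracket_closed
        L.bracket_add_left M.bracket_add_left L.bracket_add_right M.bracket_add_right
        L.bracket_smult_left M.bracket_smult_left L.bracket_smult_right M.bracket_smult_right
        L.bracket_alternating M.bracket_alternating L.jacobi M.jacobi)
qed

lemma lie_iso_direct_sum:
  assumes "f \<in> lie_iso K L L'" "g \<in> lie_iso K M M'"
  shows "map_prod f g \<in> lie_iso K (lie_direct_sum L M) (lie_direct_sum L' M')"
  using assms unfolding lie_iso_def LinearCombinations.module_hom_def lie_direct_sum_simps
  by (auto simp: bij_betw_map_prod)

lemma lie_iso_id: "id \<in> lie_iso K L L"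
  by (auto simp: lie_iso_def LinearCombinations.module_hom_def)

lemma lie_algebra_abelian_C: "lie_algebra CC abelian_C"
proof -
  have "vectorspace CC abelian_C"
    by (rule vs_criteria) (auto simp: abelian_C_def class_field algebra_simps
        intro: exI[of _ "- _"] add.right_inverse)
  then show ?thesis
    by (intro lie_algebra.intro lie_algebra_axioms.intro) (auto simp: abelian_C_def)
qed

section \<open>Matrix Lie algebras\<close>

abbreviation gl_on :: "nat \<Rightarrow> complex mat set \<Rightarrow> (complex, complex mat) lie"
  where "gl_on N V \<equiv> gl N\<lparr>carrier := V\<rparr>"

lemma gl_vectorspace: "vectorspace CC (gl N)"
  by (rule vs_criteria)
    (auto simp: gl_simps class_field add_uminus_minus_mat add_smult_distrib_left_mat
      add_smult_distrib_right_mat intro: comm_add_mat intro!: bexI[of _ "- _"])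

lemma gl_lie_algebra: "lie_algebra CC (gl N)"
proof (intro lie_algebra.intro lie_algebra_axioms.intro gl_vectorspace, goal_cases)
  case (2 x y z)
  then show ?case
    by (simp add: gl_simps add_mult_distrib_mat[of _ N N] mult_add_distrib_mat[of _ N N]) (auto intro!: eq_matI)
next
  case (3 x y z)
  then show ?case
    by (simp add: gl_simps add_mult_distrib_mat[of _ N N] mult_add_distrib_mat[of _ N N]) (auto intro!: eq_matI)
next
  case (4 a x y)
  then show ?case
    by (simp add: gl_simps) (auto intro!: eq_matI simp: algebra_simps)
next
  case (5 a x y)
  then show ?case
    by (simp add: gl_simps) (auto intro!: eq_matI simp: algebra_simps)
next
  case (7 x y z)
  then have c: "x \<in> carrier_mat N N" "y \<in> carrier_mat N N" "z \<in> carrier_mat N N"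
    by (auto simp: gl_simps)
  have a: "a * (b * c - c * b) - (b * c - c * b) * a = a * b * c - a * c * b - (b * c * a - c * b * a)"
    if "a \<in> carrier_mat N N" "b \<in> carrier_mat N N" "c \<in> carrier_mat N N" for a b c :: "complex mat"
    using that by (simp add: mult_minus_distrib_mat[of _ N N _ N] minus_mult_distrib_mat[of _ N N _ _ N] assoc_mult_mat[of _ N N _ N _ N])
  have e: "(a * b * c) $$ (i, j) = (a * (b * c)) $$ (i, j)"
    if "a \<in> carrier_mat N N" "b \<in> carrier_mat N N" "c \<in> carrier_mat N N" for a b c :: "complex mat" and i j
    using that by (simp add: assoc_mult_mat[of _ N N _ N _ N])
  show ?case
    unfolding gl_simps a[OF c] a[OF c(2) c(3) c(1)] a[OF c(3) c(1) c(2)]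
    using c by (intro eq_matI) (auto simp del: index_mult_mat(1))
qed (auto simp: gl_simps intro!: eq_matI)

section \<open>Subspaces, subalgebras and submodules of the space of all matrices\<close>

lemma gl_submoduleI:
  assumes "C \<subseteq> carrier_mat N N" "0\<^sub>m N N \<in> C"
    "\<And>A B. A \<in> C \<Longrightarrow> B \<in> C \<Longrightarrow> A + B \<in> C" "\<And>c A. A \<in> C \<Longrightarrow> c \<cdot>\<^sub>m A \<in> C"
  shows "submodule CC C (gl N)"
  using assms gl_vectorspace
  by (intro submodule.intro) (auto simp: gl_simps vectorspace_def)

lemma gl_submoduleD:
  assumes "submodule CC C (gl N)"
  shows "C \<subseteq> carrier_mat N N" "0\<^sub>m N N \<in> C"
    "\<And>A B. A \<in> C \<Longrightarrow> B \<in> C \<Longrightarrow> A + B \<in> C" "\<And>c A. A \<in> C \<Longrightarrow> c \<cdot>\<^sub>m A \<in> C"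
    "\<And>A B. A \<in> C \<Longrightarrow> B \<in> C \<Longrightarrow> A - B \<in> C"
proof -
  show *: "C \<subseteq> carrier_mat N N" "0\<^sub>m N N \<in> C"
    "\<And>A B. A \<in> C \<Longrightarrow> B \<in> C \<Longrightarrow> A + B \<in> C" "\<And>c A. A \<in> C \<Longrightarrow> c \<cdot>\<^sub>m A \<in> C"
    using assms by (auto simp: submodule_def gl_simps)
  fix A B assume AB: "A \<in> C" "B \<in> C"
  then have "A + (-1) \<cdot>\<^sub>m B \<in> C" using * by blast
  also have "A + (-1) \<cdot>\<^sub>m B = A - B" using AB *(1) by (intro eq_matI) auto
  finally show "A - B \<in> C" .
qed

lemma gl_sub_vectorspace:
  assumes "submodule CC C (gl N)"
  shows "vectorspace CC (gl_on N C)"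
  using vectorspace.subspace_is_vs[OF gl_vectorspace] assms gl_vectorspace
  by (auto simp: subspace_def)

lemma gl_subspace:
  assumes "submodule CC C (gl N)" "submodule CC W (gl N)" "W \<subseteq> C"
  shows "subspace CC W (gl_on N C)"
  using assms gl_sub_vectorspace[OF assms(1)]
  by (auto simp: subspace_def submodule_def vectorspace_def)

lemma gl_subspaceD:
  assumes C: "submodule CC C (gl N)" and W: "subspace CC W (gl_on N C)"
  shows "submodule CC W (gl N)" "W \<subseteq> C"
proof -
  have S: "submodule CC W (gl_on N C)" using W by (simp add: subspace_def)
  show "W \<subseteq> C" using submodule.subset[OF S] by simp
  then show "submodule CC W (gl N)"
    using gl_submoduleD(1)[OF C] submodule.m_closed[OF S] submodule.zero_closed[OF S] submodule.smult_closed[OF S]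
    by (intro gl_submoduleI) (auto simp: gl_simps)
qed

lemma gl_sub_lie_algebra:
  assumes C: "submodule CC C (gl N)" and br: "\<And>A B. A \<in> C \<Longrightarrow> B \<in> C \<Longrightarrow> A * B - B * A \<in> C"
  shows "lie_algebra CC (gl_on N C)"
proof -
  interpret lie_algebra CC "gl N" by (rule gl_lie_algebra)
  have C': "x \<in> C \<Longrightarrow> x \<in> carrier (gl N)" for x
    using gl_submoduleD(1)[OF C] by (auto simp: gl_simps)
  show ?thesis
    by (intro lie_algebra.intro lie_algebra_axioms.intro gl_sub_vectorspace[OF C])
      (auto simp: br[unfolded gl_simps(5)[symmetric]] C' bracket_add_left bracket_add_right bracket_smult_left bracket_smult_right
        bracket_alternating jacobi, auto simp: gl_simps br)
qed

lemma gl_sub_lie_module: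
  assumes C: "submodule CC C (gl N)" and br: "\<And>A B. A \<in> C \<Longrightarrow> B \<in> C \<Longrightarrow> A * B - B * A \<in> C"
    and V: "submodule CC V (gl N)" and act: "\<And>A B. A \<in> C \<Longrightarrow> B \<in> V \<Longrightarrow> A * B - B * A \<in> V"
  shows "lie_module CC (gl_on N C) (gl_on N V) (lie_bracket (gl N))"
proof -
  interpret gl: lie_algebra CC "gl N" by (rule gl_lie_algebra)
  interpret V: vectorspace CC "gl_on N V" by (rule gl_sub_vectorspace[OF V])
  have C': "x \<in> C \<Longrightarrow> x \<in> carrier (gl N)" for x
    using gl_submoduleD(1)[OF C] by (auto simp: gl_simps)
  have V': "x \<in> V \<Longrightarrow> x \<in> carrier (gl N)" for x
    using gl_submoduleD(1)[OF V] by (auto simp: gl_simps)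
  \<comment> \<open>Subtraction in the record goes through the additive inverse within the carrier
    \<open>V\<close>. It agrees with matrix subtraction because both solve \<open>x + b = a\<close>
    inside \<open>V\<close>.\<close>
  have minus: "a \<ominus>\<^bsub>gl_on N V\<^esub> b = a - b" if "a \<in> V" "b \<in> V" for a b
  proof -
    have "a - b \<in> V" using gl_submoduleD(5)[OF V] that by blast
    moreover have "(a - b) \<oplus>\<^bsub>gl_on N V\<^esub> b = a"
      using V'[OF that(1)] V'[OF that(2)] by (simp add: gl_simps) (intro eq_matI; auto)
    ultimately show ?thesis
      using that V.M.add.inv_solve_right[of "a - b" a b] by (simp add: a_minus_def)
  qed
  show ?thesis
  proof (intro lie_module.intro lie_module_axioms.intro gl_sub_lie_algebra V.vectorspace_axioms C br, goal_cases)
    case (8 x y v)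
    then have c: "x \<in> carrier_mat N N" "y \<in> carrier_mat N N" "v \<in> carrier_mat N N"
      using C' V' by (auto simp: gl_simps)
    have *: "lie_bracket (gl N) x (lie_bracket (gl N) y v) \<in> V" "lie_bracket (gl N) y (lie_bracket (gl N) x v) \<in> V"
      using 8 by (auto simp: gl_simps act)
    have e: "(a * b * c) $$ (i, j) = (a * (b * c)) $$ (i, j)"
      if "a \<in> carrier_mat N N" "b \<in> carrier_mat N N" "c \<in> carrier_mat N N" for a b c :: "complex mat" and i j
      using that by (simp add: assoc_mult_mat[of _ N N _ N _ N])
    show ?case
      unfolding minus[OF *] using c
      by (simp add: gl_simps mult_minus_distrib_mat[of _ N N _ N] minus_mult_distrib_mat[of _ N N _ _ N] assoc_mult_mat[of _ N N _ N _ N])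
        (intro eq_matI, auto simp del: index_mult_mat(1))
  qed (auto simp: C' V' gl.bracket_add_left gl.bracket_add_right gl.bracket_smult_left gl.bracket_smult_right, auto simp: gl_simps br act)
qed

lemma gl_sub_hom_iff:
  "f \<in> lin_hom CC (gl_on N C) (gl_on M D) \<longleftrightarrow>
    (\<forall>A\<in>C. f A \<in> D) \<and> (\<forall>A\<in>C. \<forall>B\<in>C. f (A + B) = f A + f B) \<and> (\<forall>c. \<forall>A\<in>C. f (c \<cdot>\<^sub>m A) = c \<cdot>\<^sub>m f A)"
  by (auto simp: LinearCombinations.module_hom_def gl_simps)

section \<open>Internal direct sums of matrix spaces\<close>

lemma gl_sub_finsum_index:
  assumes V: "submodule CC V (gl N)" and "finite I" "\<And>i. i \<in> I \<Longrightarrow> w i \<in> V" "a < N" "b < N"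
  shows "(\<Oplus>\<^bsub>gl_on N V\<^esub> i\<in>I. w i) $$ (a, b) = (\<Sum>i\<in>I. w i $$ (a, b))"
proof -
  interpret V: vectorspace CC "gl_on N V" by (rule gl_sub_vectorspace[OF V])
  show ?thesis
    using assms(2,3)
  proof (induction I)
    case empty
    then show ?case using assms by (simp add: gl_simps)
  next
    case (insert x F)
    then have "(\<Oplus>\<^bsub>gl_on N V\<^esub> i\<in>F. w i) \<in> V"
      using V.M.finsum_closed[of w F] by (auto simp: Pi_def)
    then have "(\<Oplus>\<^bsub>gl_on N V\<^esub> i\<in>F. w i) \<in> carrier_mat N N"
      using gl_submoduleD(1)[OF V] by blast
    moreover have "w x \<in> carrier_mat N N" using gl_submoduleD(1)[OF V] insert by blast
    moreover have "(\<Oplus>\<^bsub>gl_on N V\<^esub> i\<in>insert x F. w i) = w x + (\<Oplus>\<^bsub>gl_on N V\<^esub> i\<in>F. w i)"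
      using insert V.M.finsum_insert[of F x w] by (auto simp: Pi_def gl_simps)
    ultimately show ?case
      using insert assms by simp
  qed
qed

text \<open>The maps \<open>p i\<close> are a complete system of projections. That they add up to
  the identity gives existence of the decomposition; that \<open>p j\<close> fixes
  \<open>W j\<close> and kills the other summands gives uniqueness.\<close>

lemma gl_sub_internal_direct_sumI:
  assumes V: "submodule CC V (gl N)" and I: "finite I"
    and W: "\<And>i. i \<in> I \<Longrightarrow> submodule CC (W i) (gl N)" "\<And>i. i \<in> I \<Longrightarrow> W i \<subseteq> V"
    and p: "\<And>i v. i \<in> I \<Longrightarrow> v \<in> V \<Longrightarrow> p i v \<in> W i"
    and add: "\<And>i v w. i \<in> I \<Longrightarrow> v \<in> V \<Longrightarrow> w \<in> V \<Longrightarrow> p i (v + w) = p i v + p i w"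
    and pW: "\<And>i v. i \<in> I \<Longrightarrow> v \<in> W i \<Longrightarrow> p i v = v"
      "\<And>i j v. i \<in> I \<Longrightarrow> j \<in> I \<Longrightarrow> i \<noteq> j \<Longrightarrow> v \<in> W i \<Longrightarrow> p j v = 0\<^sub>m N N"
    and sum: "\<And>v a b. v \<in> V \<Longrightarrow> a < N \<Longrightarrow> b < N \<Longrightarrow> (\<Sum>i\<in>I. p i v $$ (a, b)) = v $$ (a, b)"
  shows "internal_direct_sum CC (gl_on N V) I W"
proof -
  interpret V: vectorspace CC "gl_on N V" by (rule gl_sub_vectorspace[OF V])
  note VD = gl_submoduleD[OF V]
  note WD = gl_submoduleD[OF W(1)]
  have fc: "(\<Oplus>\<^bsub>gl_on N V\<^esub> i\<in>J. w i) \<in> V" if "\<And>i. i \<in> J \<Longrightarrow> w i \<in> V" for w J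
    using that V.M.finsum_closed[of w J] by (auto simp: Pi_def)
  have p0: "p j (0\<^sub>m N N) = 0\<^sub>m N N" if "j \<in> I" for j
    using pW(1)[OF that WD(2)[OF that]] .
  have psum: "p j (\<Oplus>\<^bsub>gl_on N V\<^esub> i\<in>J. w i) = (if j \<in> J then w j else 0\<^sub>m N N)"
    if "J \<subseteq> I" "j \<in> I" "\<And>i. i \<in> J \<Longrightarrow> w i \<in> W i" for J j w
  proof -
    have "finite J" using that I finite_subset by blast
    then show ?thesis using that
    proof (induction J)
      case empty
      then show ?case by (simp add: gl_simps p0)
    next
      case (insert x F)
      have *: "w i \<in> V" if "i \<in> insert x F" for i using insert that W(2) by blast
      have c: "w x \<in> carrier_mat N N" using * VD(1) by blast
      have "(\<Oplus>\<^bsub>gl_on N V\<^esub> i\<in>insert x F. w i) = w x + (\<Oplus>\<^bsub>gl_on N V\<^esub> i\<in>F. w i)"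
        using insert(1,2) * V.M.finsum_insert[of F x w] by (auto simp: Pi_def gl_simps)
      then have "p j (\<Oplus>\<^bsub>gl_on N V\<^esub> i\<in>insert x F. w i) = p j (w x) + (if j \<in> F then w j else 0\<^sub>m N N)"
        using insert add[of j "w x" "\<Oplus>\<^bsub>gl_on N V\<^esub> i\<in>F. w i"] * fc[of F w] by auto
      also have "\<dots> = (if j \<in> insert x F then w j else 0\<^sub>m N N)"
      proof (cases "j = x")
        case True
        then show ?thesis using insert pW(1)[of x "w x"] c by simp
      next
        case False
        then have "p j (w x) = 0\<^sub>m N N" using insert pW(2)[of x j "w x"] by simp
        moreover have "w j \<in> carrier_mat N N" if "j \<in> F" using that * VD(1) by blast
        ultimately show ?thesis using False by simp
      qed
      finally show ?case .
    qed
  qed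
  have "\<exists>!w. w \<in> (\<Pi>\<^sub>E i\<in>I. W i) \<and> v = (\<Oplus>\<^bsub>gl_on N V\<^esub> i\<in>I. w i)" if v: "v \<in> V" for v
  proof (rule ex1I[of _ "\<lambda>i\<in>I. p i v"], intro conjI)
    show "(\<lambda>i\<in>I. p i v) \<in> (\<Pi>\<^sub>E i\<in>I. W i)" using p v by auto
    have mem: "(\<Oplus>\<^bsub>gl_on N V\<^esub> i\<in>I. (\<lambda>i\<in>I. p i v) i) \<in> V"
      using p v W(2) by (intro fc) auto
    show "v = (\<Oplus>\<^bsub>gl_on N V\<^esub> i\<in>I. (\<lambda>i\<in>I. p i v) i)"
    proof (rule eq_matI)
      fix a b assume "a < dim_row (\<Oplus>\<^bsub>gl_on N V\<^esub> i\<in>I. (\<lambda>i\<in>I. p i v) i)"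
        "b < dim_col (\<Oplus>\<^bsub>gl_on N V\<^esub> i\<in>I. (\<lambda>i\<in>I. p i v) i)"
      then have ab: "a < N" "b < N" using subsetD[OF VD(1) mem] by auto
      have "(\<Oplus>\<^bsub>gl_on N V\<^esub> i\<in>I. (\<lambda>i\<in>I. p i v) i) $$ (a, b) = (\<Sum>i\<in>I. (\<lambda>i\<in>I. p i v) i $$ (a, b))"
        by (rule gl_sub_finsum_index[OF V I _ ab]) (use p v W(2) in auto)
      also have "\<dots> = v $$ (a, b)" using sum[OF v ab] by simp
      finally show "v $$ (a, b) = (\<Oplus>\<^bsub>gl_on N V\<^esub> i\<in>I. (\<lambda>i\<in>I. p i v) i) $$ (a, b)" by simp
    qed (use subsetD[OF VD(1) mem] subsetD[OF VD(1) v] in auto)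
  next
    fix w assume w: "w \<in> (\<Pi>\<^sub>E i\<in>I. W i) \<and> v = (\<Oplus>\<^bsub>gl_on N V\<^esub> i\<in>I. w i)"
    show "w = (\<lambda>i\<in>I. p i v)"
    proof
      fix j show "w j = (\<lambda>i\<in>I. p i v) j"
      proof (cases "j \<in> I")
        case True
        have "p j v = w j" using psum[of I j w] True w by (auto simp: PiE_def Pi_def)
        then show ?thesis using True by simp
      next
        case False
        then show ?thesis using w by (auto simp: PiE_def extensional_def)
      qed
    qed
  qed
  then show ?thesis
    unfolding internal_direct_sum_def using I gl_subspace[OF V W] by simp
qed

text \<open>The decomposition of \<open>f v\<close> is lifted component by component through the
  inverse of \<open>f\<close>, and injectivity of \<open>f\<close> returns uniqueness. Both direct
  sum claims can thus be verified in the eigenbasis.\<close>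

lemma gl_sub_internal_direct_sum_transport:
  assumes V: "submodule CC V (gl N)" and V': "submodule CC V' (gl M)"
    and f: "f \<in> lin_hom CC (gl_on N V) (gl_on M V')"
    and bij: "bij_betw f V V'"
    and W: "\<And>i. i \<in> I \<Longrightarrow> submodule CC (W i) (gl N)" "\<And>i. i \<in> I \<Longrightarrow> W i = {v \<in> V. f v \<in> W' i}"
    and ds: "internal_direct_sum CC (gl_on M V') I W'"
  shows "internal_direct_sum CC (gl_on N V) I W"
proof -
  interpret V: vectorspace CC "gl_on N V" by (rule gl_sub_vectorspace[OF V])
  interpret V': vectorspace CC "gl_on M V'" by (rule gl_sub_vectorspace[OF V'])
  interpret f: linear_map CC "gl_on N V" "gl_on M V'" f
    using f by unfold_locales
  have I: "finite I" using ds by (simp add: internal_direct_sum_def)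
  have W'V: "W' i \<subseteq> V'" if "i \<in> I" for i
    using ds that by (auto simp: internal_direct_sum_def subspace_def submodule_def)
  have fsum: "f (\<Oplus>\<^bsub>gl_on N V\<^esub> i\<in>J. w i) = (\<Oplus>\<^bsub>gl_on M V'\<^esub> i\<in>J. f (w i))"
    if "finite J" "\<And>i. i \<in> J \<Longrightarrow> w i \<in> V" for J w
    using that
  proof (induction J)
    case (insert x F)
    then have "w x \<in> V" "(\<Oplus>\<^bsub>gl_on N V\<^esub> i\<in>F. w i) \<in> V"
      using V.M.finsum_closed[of w F] by (auto simp: Pi_def)
    then show ?case
      using insert V.M.finsum_insert[of F x w] V'.M.finsum_insert[of F x "\<lambda>i. f (w i)"]
        f.f_add[of "w x" "\<Oplus>\<^bsub>gl_on N V\<^esub> i\<in>F. w i"] f.f_im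
      by (auto simp: Pi_def)
  qed (use f.f0_is_0 in simp)
  have "\<exists>!w. w \<in> (\<Pi>\<^sub>E i\<in>I. W i) \<and> v = (\<Oplus>\<^bsub>gl_on N V\<^esub> i\<in>I. w i)" if v: "v \<in> V" for v
  proof -
    have "f v \<in> V'" using v f.f_im by auto
    then have ex1: "\<exists>!w. w \<in> (\<Pi>\<^sub>E i\<in>I. W' i) \<and> f v = (\<Oplus>\<^bsub>gl_on M V'\<^esub> i\<in>I. w i)"
      using ds by (auto simp: internal_direct_sum_def)
    then obtain u where u: "u \<in> (\<Pi>\<^sub>E i\<in>I. W' i)" "f v = (\<Oplus>\<^bsub>gl_on M V'\<^esub> i\<in>I. u i)" by blast
    define w where "w = (\<lambda>i\<in>I. inv_into V f (u i))"
    have w: "w i \<in> V" "f (w i) = u i" if "i \<in> I" for i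
    proof -
      have "u i \<in> V'" using u(1) that W'V[OF that] by (auto simp: PiE_def Pi_def)
      then show "w i \<in> V" "f (w i) = u i"
        using that bij by (auto simp: w_def bij_betw_def inv_into_into f_inv_into_f)
    qed
    have key: "w' \<in> (\<Pi>\<^sub>E i\<in>I. W i) \<Longrightarrow> (\<lambda>i\<in>I. f (w' i)) \<in> (\<Pi>\<^sub>E i\<in>I. W' i)" for w'
      using W(2) by (auto simp: PiE_def Pi_def)
    have fs: "f (\<Oplus>\<^bsub>gl_on N V\<^esub> i\<in>I. w' i) = (\<Oplus>\<^bsub>gl_on M V'\<^esub> i\<in>I. (\<lambda>i\<in>I. f (w' i)) i)"
      if "w' \<in> (\<Pi>\<^sub>E i\<in>I. W i)" for w'
    proof -
      have w': "w' i \<in> V" if "i \<in> I" for i using that \<open>w' \<in> _\<close> W(2) by (auto simp: PiE_def Pi_def)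
      have "f (\<Oplus>\<^bsub>gl_on N V\<^esub> i\<in>I. w' i) = (\<Oplus>\<^bsub>gl_on M V'\<^esub> i\<in>I. f (w' i))"
        using fsum[of I w', OF I] w' by auto
      also have "\<dots> = (\<Oplus>\<^bsub>gl_on M V'\<^esub> i\<in>I. (\<lambda>i\<in>I. f (w' i)) i)"
        using w' f.f_im by (intro V'.M.finsum_cong') auto
      finally show ?thesis .
    qed
    have wW: "w \<in> (\<Pi>\<^sub>E i\<in>I. W i)"
      using w u(1) W(2) by (auto simp: PiE_def Pi_def w_def)
    have fw: "(\<lambda>i\<in>I. f (w i)) = u"
      using w u(1) by (auto simp: fun_eq_iff PiE_def extensional_def)
    show ?thesis
    proof (rule ex1I[of _ w], intro conjI wW)
      have "(\<Oplus>\<^bsub>gl_on N V\<^esub> i\<in>I. w i) \<in> V"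
        using w V.M.finsum_closed[of w I] by (auto simp: Pi_def)
      moreover have "f (\<Oplus>\<^bsub>gl_on N V\<^esub> i\<in>I. w i) = f v"
        unfolding fs[OF wW] fw u(2) ..
      ultimately show "v = (\<Oplus>\<^bsub>gl_on N V\<^esub> i\<in>I. w i)"
        using bij v by (metis bij_betw_def inj_onD)
    next
      fix w' assume w': "w' \<in> (\<Pi>\<^sub>E i\<in>I. W i) \<and> v = (\<Oplus>\<^bsub>gl_on N V\<^esub> i\<in>I. w' i)"
      then have "(\<lambda>i\<in>I. f (w' i)) = u"
        using ex1 u key fs by metis
      then have "f (w' i) = f (w i)" if "i \<in> I" for i using fw that by (metis restrict_apply')
      then have "w' i = w i" if "i \<in> I" for i
        using that w'  w W(2) bij by (auto simp: bij_betw_def inj_on_def PiE_def Pi_def)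
      then show "w' = w" using w' wW by (metis PiE_ext)
    qed
  qed
  moreover have "W i \<subseteq> V" if "i \<in> I" for i using W(2)[OF that] by blast
  ultimately show ?thesis
    unfolding internal_direct_sum_def using I gl_subspace[OF V W(1)] by simp
qed

section \<open>Orthogonal Lie algebras\<close>

lemma so_form_eq:
  "so_form N q = gl_on N {Z \<in> carrier_mat N N. Z * q + q * transpose_mat Z = 0\<^sub>m N N}"
  by (simp add: so_form_def)

lemma add_eq_zero_mat_iff:
  fixes A B :: "'a :: ab_group_add mat"
  assumes "A \<in> carrier_mat n m" "B \<in> carrier_mat n m"
  shows "A + B = 0\<^sub>m n m \<longleftrightarrow> A = - B"
proof -
  have "A + B = 0\<^sub>m n m \<longleftrightarrow> (\<forall>i<n. \<forall>j<m. A $$ (i, j) + B $$ (i, j) = 0)"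
    using assms by (auto simp: mat_eq_iff)
  also have "\<dots> \<longleftrightarrow> A = - B"
    using assms by (auto simp: mat_eq_iff eq_neg_iff_add_eq_0)
  finally show ?thesis .
qed

lemma transpose_smult_mat: "transpose_mat (c \<cdot>\<^sub>m A) = c \<cdot>\<^sub>m transpose_mat A"
  by (intro eq_matI) auto

lemma so_form_submodule:
  assumes "q \<in> carrier_mat N N"
  shows "submodule CC (carrier (so_form N q)) (gl N)"
proof (rule gl_submoduleI, goal_cases)
  case (3 A B)
  then have c: "A \<in> carrier_mat N N" "B \<in> carrier_mat N N"
    and z: "A * q + q * transpose_mat A = 0\<^sub>m N N" "B * q + q * transpose_mat B = 0\<^sub>m N N"
    by (auto simp: so_form_def)
  have "(A + B) * q + q * transpose_mat (A + B) = (A * q + q * transpose_mat A) + (B * q + q * transpose_mat B)"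
    using assms c
    by (simp add: transpose_add[of _ N N] add_mult_distrib_mat[of _ N N _ _ N] mult_add_distrib_mat[of _ N N _ N])
      (intro eq_matI; auto simp del: index_mult_mat(1))
  then show ?case using c by (simp add: so_form_def z)
next
  case (4 c A)
  then have A: "A \<in> carrier_mat N N" and z: "A * q + q * transpose_mat A = 0\<^sub>m N N"
    by (auto simp: so_form_def)
  have "(c \<cdot>\<^sub>m A) * q + q * transpose_mat (c \<cdot>\<^sub>m A) = c \<cdot>\<^sub>m (A * q + q * transpose_mat A)"
    using assms A
    by (simp add: transpose_smult_mat mult_smult_distrib[of _ N N _ N] mult_smult_assoc_mat[of _ N N _ N]
        add_smult_distrib_left_mat[of _ N N])
  then show ?case using A by (simp add: so_form_def z)
qed (use assms in \<open>auto simp: so_form_def\<close>)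

text \<open>Membership means \<open>A * q = - (q * A^T)\<close>. Moving \<open>q\<close> past two
  factors costs two signs, so \<open>A * B * q = q * A^T * B^T\<close>, while
  \<open>q * (A * B)^T\<close> has the transposes in the other order. The commutator therefore
  acquires exactly one sign.\<close>

lemma so_form_bracket:
  assumes q: "q \<in> carrier_mat N N" and A: "A \<in> carrier (so_form N q)" and B: "B \<in> carrier (so_form N q)"
  shows "A * B - B * A \<in> carrier (so_form N q)"
proof -
  have c: "A \<in> carrier_mat N N" "B \<in> carrier_mat N N" "transpose_mat A \<in> carrier_mat N N" "transpose_mat B \<in> carrier_mat N N"
    using A B by (auto simp: so_form_def)
  have Aq: "A * q = - (q * transpose_mat A)" and Bq: "B * q = - (q * transpose_mat B)"
    using A B q c by (auto simp: so_form_def add_eq_zero_mat_iff[of _ N N])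
  have *: "X * Y * q = q * (transpose_mat X * transpose_mat Y)"
    if "X \<in> carrier_mat N N" "Y \<in> carrier_mat N N" "X * q = - (q * transpose_mat X)" "Y * q = - (q * transpose_mat Y)" for X Y
  proof -
    have "X * Y * q = X * (- (q * transpose_mat Y))"
      using that q by (simp add: assoc_mult_mat[of _ N N _ N _ N])
    also have "\<dots> = - (X * q * transpose_mat Y)"
      using that(1,2) q by (simp add: assoc_mult_mat[of _ N N _ N _ N])
    also have "\<dots> = q * transpose_mat X * transpose_mat Y"
      using that(1,2) q by (simp add: that(3))
    finally show ?thesis using that q by (simp add: assoc_mult_mat[of _ N N _ N _ N])
  qed
  have "(A * B - B * A) * q = - (q * transpose_mat (A * B - B * A))"
    using c q by (simp add: minus_mult_distrib_mat[of _ N N _ _ N] *[OF c(1,2) Aq Bq] *[OF c(2,1) Bq Aq]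
        transpose_minus[of _ N N] transpose_mult[of _ N N _ N] mult_minus_distrib_mat[of _ N N _ N])
      (intro eq_matI; auto simp del: index_mult_mat(1))
  moreover have "A * B - B * A \<in> carrier_mat N N"
    using c by (intro minus_carrier_mat mult_carrier_mat)
  ultimately show ?thesis
    using c q by (simp add: so_form_def add_eq_zero_mat_iff[of _ N N])
qed

lemma so_form_lie_algebra:
  assumes "q \<in> carrier_mat N N"
  shows "lie_algebra CC (so_form N q)"
  using gl_sub_lie_algebra[OF so_form_submodule[OF assms] so_form_bracket[OF assms]]
  by (simp add: so_form_def)

section \<open>Change of basis\<close>

lemma conj_mult:
  fixes S T :: "complex mat"
  assumes "S \<in> carrier_mat N N" "T \<in> carrier_mat N N" "T * S = 1\<^sub>m N"
    "X \<in> carrier_mat N N" "Y \<in> carrier_mat N N"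
  shows "S * X * T * (S * Y * T) = S * (X * Y) * T"
proof -
  have "S * X * T * (S * Y * T) = S * X * (T * S) * (Y * T)"
    using assms(1,2,4,5) by (simp add: assoc_mult_mat[of _ N N _ N _ N])
  then show ?thesis
    using assms by (simp add: assoc_mult_mat[of _ N N _ N _ N])
qed

lemma conj_conj:
  fixes S T :: "complex mat"
  assumes "S \<in> carrier_mat N N" "T \<in> carrier_mat N N" "T * S = 1\<^sub>m N" "X \<in> carrier_mat N N"
  shows "T * (S * X * T) * S = X"
proof -
  have "T * (S * X * T) * S = (T * S) * X * (T * S)"
    using assms(1,2,4) by (simp add: assoc_mult_mat[of _ N N _ N _ N])
  then show ?thesis
    using assms by (simp)
qed

text \<open>The factor \<open>T * S\<close> cancels inside, so the defining expression for
  \<open>S * Z * T\<close> and \<open>q'\<close> equals \<open>S * (Z * q + q * Z^T) * S^T\<close>.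
  This is why the form changes by the congruence \<open>S * q * S^T\<close> and not by one with the
  inverse of \<open>S\<close>.\<close>

lemma conj_so_form:
  assumes S: "S \<in> carrier_mat N N" and T: "T \<in> carrier_mat N N" and q: "q \<in> carrier_mat N N"
    and TS: "T * S = 1\<^sub>m N" and q': "S * q * transpose_mat S = q'"
    and Z: "Z \<in> carrier (so_form N q)"
  shows "S * Z * T \<in> carrier (so_form N q')"
proof -
  have c: "Z \<in> carrier_mat N N" "transpose_mat Z \<in> carrier_mat N N" "transpose_mat S \<in> carrier_mat N N"
    "transpose_mat T \<in> carrier_mat N N"
    and z: "Z * q + q * transpose_mat Z = 0\<^sub>m N N"
    using Z S T by (auto simp: so_form_def)
  have ts: "transpose_mat S * transpose_mat T = 1\<^sub>m N"
    using TS S T by (metis transpose_mult transpose_one)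
  have "S * Z * T * q' = S * Z * (T * S) * q * transpose_mat S"
    using S T q c by (simp add: q'[symmetric] assoc_mult_mat[of _ N N _ N _ N])
  also have "\<dots> = S * (Z * q) * transpose_mat S"
    using S T q c by (simp add: TS assoc_mult_mat[of _ N N _ N _ N])
  finally have 1: "S * Z * T * q' = S * (Z * q) * transpose_mat S" .
  have "q' * transpose_mat (S * Z * T) = S * q * (transpose_mat S * transpose_mat T) * transpose_mat Z * transpose_mat S"
    using S T q c by (simp add: q'[symmetric] transpose_mult[of _ N N _ N] assoc_mult_mat[of _ N N _ N _ N])
  also have "\<dots> = S * (q * transpose_mat Z) * transpose_mat S"
    using S T q c by (simp add: ts assoc_mult_mat[of _ N N _ N _ N])
  finally have "S * Z * T * q' + q' * transpose_mat (S * Z * T) = S * (Z * q + q * transpose_mat Z) * transpose_mat S"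
    using 1 S T q c by (simp add: add_mult_distrib_mat[of _ N N _ _ N] mult_add_distrib_mat[of _ N N _ N])
  also have "\<dots> = 0\<^sub>m N N" using S c by (simp add: z)
  finally show ?thesis using S T c by (simp add: so_form_def)
qed

lemma conj_lie_iso:
  assumes S: "S \<in> carrier_mat N N" and T: "T \<in> carrier_mat N N" and q: "q \<in> carrier_mat N N"
    and ST: "S * T = 1\<^sub>m N" and TS: "T * S = 1\<^sub>m N" and q': "S * q * transpose_mat S = q'"
  shows "(\<lambda>Z. S * Z * T) \<in> lie_iso CC (so_form N q) (so_form N q')"
proof (rule lie_isoI)
  have c: "Z \<in> carrier (so_form N p) \<Longrightarrow> Z \<in> carrier_mat N N" for Z p
    by (simp add: so_form_def)
  have q'c: "q' \<in> carrier_mat N N" using q S q' by auto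
  have st: "transpose_mat S * transpose_mat T = 1\<^sub>m N"
    using TS S T by (metis transpose_mult transpose_one)
  \<comment> \<open>The congruence by \<open>T\<close> leads back to the original form, so
    \<open>conj_so_form\<close> also places the inverse conjugation.\<close>
  have "T * q' * transpose_mat T = (T * S) * q * (transpose_mat S * transpose_mat T)"
    using S T q by (simp add: q'[symmetric] assoc_mult_mat[of _ N N _ N _ N])
  then have q: "T * q' * transpose_mat T = q"
    using q by (simp add: TS st)
  show "(\<lambda>Z. S * Z * T) \<in> lin_hom CC (so_form N q) (so_form N q')"
    unfolding so_form_def gl_sub_hom_iff
  proof (intro conjI ballI allI, goal_cases)
    case (1 A)
    then show ?case using conj_so_form[OF S T \<open>q \<in> carrier_mat N N\<close> TS q', of A] by (simp add: so_form_def)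
  next
    case (2 A B)
    then show ?case using S T by (simp add: add_mult_distrib_mat[of _ N N _ _ N] mult_add_distrib_mat[of _ N N _ N])
  next
    case (3 a A)
    then show ?case using S T by (simp add: mult_smult_distrib[of _ N N _ N] mult_smult_assoc_mat[of _ N N _ N])
  qed
  show "bij_betw (\<lambda>Z. S * Z * T) (carrier (so_form N q)) (carrier (so_form N q'))"
  proof (rule bij_betwI[where g = "\<lambda>Z. T * Z * S"])
    show "(\<lambda>Z. S * Z * T) \<in> carrier (so_form N q) \<rightarrow> carrier (so_form N q')"
      using conj_so_form[OF S T \<open>q \<in> carrier_mat N N\<close> TS q'] by blast
    show "(\<lambda>Z. T * Z * S) \<in> carrier (so_form N q') \<rightarrow> carrier (so_form N q)"
      using conj_so_form[OF T S q'c ST q] by blast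
  qed (use conj_conj[OF S T TS] conj_conj[OF T S ST] c in auto)
  fix x y assume "x \<in> carrier (so_form N q)" "y \<in> carrier (so_form N q)"
  then have xy: "x \<in> carrier_mat N N" "y \<in> carrier_mat N N" by (auto intro: c)
  then have "S * (x * y - y * x) * T = S * (x * y) * T - S * (y * x) * T"
    using S T by (simp add: minus_mult_distrib_mat[of _ N N _ _ N] mult_minus_distrib_mat[of _ N N _ N])
  also have "\<dots> = S * x * T * (S * y * T) - S * y * T * (S * x * T)"
    unfolding conj_mult[OF S T TS xy] conj_mult[OF S T TS xy(2,1)] ..
  finally show "S * lie_bracket (so_form N q) x y * T = lie_bracket (so_form N q') (S * x * T) (S * y * T)"
    by (simp add: so_form_def gl_simps)
qed

text \<open>With \<open>\<alpha> = (1 - \<i>) / 2\<close> and \<open>\<beta> = (1 + \<i>) / 2\<close> one has \<open>\<alpha>\<^sup>2 + \<beta>\<^sup>2 = 0\<close> and \<open>2 \<alpha> \<beta> = 1\<close>, so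
  \<open>S = \<alpha> 1 + \<beta> q\<close> satisfies \<open>S q S\<^sup>T = (\<alpha>\<^sup>2 + \<beta>\<^sup>2) q + 2 \<alpha> \<beta> 1 = 1\<close>.\<close>

lemma so_form_iso_so:
  assumes q: "q \<in> carrier_mat N N" and sym: "transpose_mat q = q" and inv: "q * q = 1\<^sub>m N"
  shows "lie_isomorphic CC (so_form N q) (so N)"
proof -
  define \<alpha> \<beta> :: complex where "\<alpha> = (1 - \<i>) / 2" and "\<beta> = (1 + \<i>) / 2"
  have ab: "\<alpha> * \<alpha> + \<beta> * \<beta> = 0" "\<alpha> * \<beta> + \<beta> * \<alpha> = 1"
    by (simp_all add: \<alpha>_def \<beta>_def field_simps)
  define S where "S = \<alpha> \<cdot>\<^sub>m 1\<^sub>m N + \<beta> \<cdot>\<^sub>m q"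
  have S: "S \<in> carrier_mat N N" using q by (simp add: S_def)
  have St: "transpose_mat S = S"
    using q sym by (simp add: S_def transpose_add[of _ N N] transpose_smult_mat)
  have qS: "q * S = \<alpha> \<cdot>\<^sub>m q + \<beta> \<cdot>\<^sub>m 1\<^sub>m N"
    using q by (simp add: S_def mult_add_distrib_mat[of _ N N _ N] mult_smult_distrib[of _ N N _ N] inv)
  have Sq: "S * q = \<alpha> \<cdot>\<^sub>m q + \<beta> \<cdot>\<^sub>m 1\<^sub>m N"
    using q by (simp add: S_def add_mult_distrib_mat[of _ N N _ _ N] mult_smult_assoc_mat[of _ N N _ N] inv)
  have "S * (q * S) = \<alpha> \<cdot>\<^sub>m (S * q) + \<beta> \<cdot>\<^sub>m S"
    unfolding qS using q S
    by (simp add: mult_add_distrib_mat[of _ N N _ N] mult_smult_distrib[of _ N N _ N])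
  also have "\<dots> = (\<alpha> * \<alpha> + \<beta> * \<beta>) \<cdot>\<^sub>m q + (\<alpha> * \<beta> + \<beta> * \<alpha>) \<cdot>\<^sub>m 1\<^sub>m N"
    unfolding Sq unfolding S_def using q by (intro eq_matI) (auto simp: algebra_simps)
  also have "\<dots> = 1\<^sub>m N" unfolding ab using q by (intro eq_matI) auto
  finally have 1: "S * (q * S) = 1\<^sub>m N" .
  have 2: "q * S * S = 1\<^sub>m N"
    using mat_mult_left_right_inverse[OF S _ 1] q S by simp
  have 3: "S * q * transpose_mat S = 1\<^sub>m N"
    using 1 q S by (simp add: St assoc_mult_mat[of _ N N _ N _ N])
  show ?thesis
    unfolding so_def
    by (rule lie_isomorphicI[OF so_form_lie_algebra[OF q] so_form_lie_algebra conj_lie_iso[OF S _ q 1 2 3]])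
      (use q S in auto)
qed

section \<open>Forms given by permutation matrices\<close>

definition perm_mat :: "nat \<Rightarrow> (nat \<Rightarrow> nat) \<Rightarrow> complex mat"
  where "perm_mat N \<pi> = mat N N (\<lambda>(i, j). if j = \<pi> i then 1 else 0)"

lemma perm_mat_carrier [simp]: "perm_mat N \<pi> \<in> carrier_mat N N"
  "dim_row (perm_mat N \<pi>) = N" "dim_col (perm_mat N \<pi>) = N"
  by (auto simp: perm_mat_def)

lemma index_perm_mat_mult:
  assumes "A \<in> carrier_mat N M" "i < N" "j < M" "\<pi> i < N"
  shows "(perm_mat N \<pi> * A) $$ (i, j) = A $$ (\<pi> i, j)"
  using assms by (simp add: perm_mat_def scalar_prod_def if_distrib[of "\<lambda>x. x * _"] cong: if_cong)

lemma index_mult_perm_mat_transpose: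
  assumes "A \<in> carrier_mat M N" "i < M" "j < N" "\<pi> j < N"
  shows "(A * transpose_mat (perm_mat N \<pi>)) $$ (i, j) = A $$ (i, \<pi> j)"
  using assms by (simp add: perm_mat_def scalar_prod_def if_distrib[of "\<lambda>x. _ * x"] cong: if_cong)

text \<open>Restricted to indices below \<open>N\<close>, so that maps with truncated subtraction
  such as the reversal \<open>N - 1 - i\<close> qualify.\<close>

definition involution_below :: "nat \<Rightarrow> (nat \<Rightarrow> nat) \<Rightarrow> bool"
  where "involution_below N \<pi> \<longleftrightarrow> (\<forall>i<N. \<pi> i < N \<and> \<pi> (\<pi> i) = i)"

lemma involution_belowD:
  assumes "involution_below N \<pi>" "i < N"
  shows "\<pi> i < N" "\<pi> (\<pi> i) = i"
  using assms by (auto simp: involution_below_def)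

lemma perm_mat_transpose:
  assumes "involution_below N \<pi>"
  shows "transpose_mat (perm_mat N \<pi>) = perm_mat N \<pi>"
  using assms by (intro eq_matI) (auto simp: perm_mat_def involution_below_def)

lemma perm_mat_square:
  assumes "involution_below N \<pi>"
  shows "perm_mat N \<pi> * perm_mat N \<pi> = 1\<^sub>m N"
proof (rule eq_matI)
  fix i j assume "i < dim_row (1\<^sub>m N :: complex mat)" "j < dim_col (1\<^sub>m N :: complex mat)"
  then have ij: "i < N" "j < N" by auto
  show "(perm_mat N \<pi> * perm_mat N \<pi>) $$ (i, j) = 1\<^sub>m N $$ (i, j)"
    using ij involution_belowD[OF assms ij(1)] index_perm_mat_mult[of "perm_mat N \<pi>" N N i j \<pi>]
    by (auto simp: perm_mat_def)
qed auto

lemma index_mult_perm_mat: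
  assumes "involution_below N \<pi>" "A \<in> carrier_mat M N" "i < M" "j < N"
  shows "(A * perm_mat N \<pi>) $$ (i, j) = A $$ (i, \<pi> j)"
  using index_mult_perm_mat_transpose[of A M N i j \<pi>] assms involution_belowD[OF assms(1)]
  by (simp add: perm_mat_transpose)

text \<open>The sign relation is the equation of \<open>so_form\<close> for the form
  \<open>perm_mat N \<pi>\<close>, written entrywise; see \<open>so_form_perm_mat_carrier\<close>.
  For the reversal it is skewness with respect to the antidiagonal.\<close>

definition skew_on :: "nat \<Rightarrow> (nat \<Rightarrow> nat) \<Rightarrow> (nat \<times> nat) set \<Rightarrow> complex mat set"
  where "skew_on N \<pi> R = {Z \<in> carrier_mat N N. \<forall>i<N. \<forall>j<N.
    Z $$ (i, j) = - Z $$ (\<pi> j, \<pi> i) \<and> ((i, j) \<notin> R \<longrightarrow> Z $$ (i, j) = 0)}"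

lemma skew_onD:
  assumes "Z \<in> skew_on N \<pi> R"
  shows "Z \<in> carrier_mat N N" "\<And>i j. i < N \<Longrightarrow> j < N \<Longrightarrow> Z $$ (i, j) = - Z $$ (\<pi> j, \<pi> i)"
    "\<And>i j. i < N \<Longrightarrow> j < N \<Longrightarrow> (i, j) \<notin> R \<Longrightarrow> Z $$ (i, j) = 0"
  using assms unfolding skew_on_def by blast+

lemma skew_on_submodule:
  assumes "involution_below N \<pi>"
  shows "submodule CC (skew_on N \<pi> R) (gl N)"
proof (rule gl_submoduleI, goal_cases)
  case (3 A B)
  have "(A + B) $$ (i, j) = - (A + B) $$ (\<pi> j, \<pi> i)" if "i < N" "j < N" for i j
    using that involution_belowD[OF assms] skew_onD(1)[OF 3(1)] skew_onD(1)[OF 3(2)]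
      skew_onD(2)[OF 3(1) that] skew_onD(2)[OF 3(2) that] by simp
  then show ?case using skew_onD(1,3)[OF 3(1)] skew_onD(1,3)[OF 3(2)] by (auto simp: skew_on_def)
next
  case (4 c A)
  have "(c \<cdot>\<^sub>m A) $$ (i, j) = - (c \<cdot>\<^sub>m A) $$ (\<pi> j, \<pi> i)" if "i < N" "j < N" for i j
    using that involution_belowD[OF assms] skew_onD(1)[OF 4] skew_onD(2)[OF 4 that] by simp
  then show ?case using skew_onD(1,3)[OF 4] by (auto simp: skew_on_def)
qed (use assms in \<open>auto simp: skew_on_def involution_below_def\<close>)

lemma so_form_perm_mat_carrier:
  assumes \<pi>: "involution_below N \<pi>"
  shows "carrier (so_form N (perm_mat N \<pi>)) = skew_on N \<pi> UNIV"
proof -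
  have "Z * perm_mat N \<pi> + perm_mat N \<pi> * transpose_mat Z = 0\<^sub>m N N \<longleftrightarrow>
      (\<forall>i<N. \<forall>j<N. Z $$ (i, j) = - Z $$ (\<pi> j, \<pi> i))" if Z: "Z \<in> carrier_mat N N" for Z
  proof -
    have "Z * perm_mat N \<pi> + perm_mat N \<pi> * transpose_mat Z = 0\<^sub>m N N \<longleftrightarrow>
      (\<forall>i<N. \<forall>j<N. Z $$ (i, \<pi> j) = - Z $$ (j, \<pi> i))"
      using Z involution_belowD[OF \<pi>]
      by (auto simp: mat_eq_iff index_mult_perm_mat[OF \<pi> Z] index_perm_mat_mult[of _ N N] eq_neg_iff_add_eq_0
          simp del: index_mult_mat(1))
    \<comment> \<open>Substitution of \<open>\<pi> j\<close> for \<open>j\<close>, which runs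
      through the same indices.\<close>
    also have "\<dots> \<longleftrightarrow> (\<forall>i<N. \<forall>j<N. Z $$ (i, j) = - Z $$ (\<pi> j, \<pi> i))"
      using involution_belowD[OF \<pi>] by metis
    finally show ?thesis .
  qed
  then show ?thesis by (simp add: so_form_def skew_on_def cong: conj_cong)
qed

text \<open>A skew matrix is determined by its entries on a set of representatives for the
  involution \<open>(i, j) \<mapsto> (\<pi> j, \<pi> i)\<close> of the support, which \<open>e\<close> enumerates.\<close>

lemma skew_on_coords:
  assumes \<pi>: "involution_below N \<pi>" and e: "bij_betw e {..<d} F"
    and F: "\<And>i j. (i, j) \<in> F \<Longrightarrow> i < N \<and> j < N \<and> (i, j) \<in> R \<and> (\<pi> j, \<pi> i) \<in> R \<and> (\<pi> j, \<pi> i) \<notin> F"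
    and R: "\<And>i j. i < N \<Longrightarrow> j < N \<Longrightarrow> (i, j) \<in> R \<Longrightarrow> i \<noteq> \<pi> j \<Longrightarrow> (i, j) \<in> F \<or> (\<pi> j, \<pi> i) \<in> F"
  shows "bij_betw (\<lambda>Z. vec d (\<lambda>k. Z $$ e k)) (skew_on N \<pi> R) (carrier_vec d)"
proof -
  define g where "g = inv_into {..<d} e"
  have eF: "e k \<in> F" if "k < d" for k using e that by (auto simp: bij_betw_def)
  have ge: "g (e k) = k" if "k < d" for k
    using e that by (simp add: g_def bij_betw_def)
  have eg: "e (g x) = x" "g x < d" if "x \<in> F" for x
    using that e f_inv_into_f[of x e "{..<d}"] inv_into_into[of x e "{..<d}"]
    by (auto simp: g_def bij_betw_def)
  define h where "h v = mat N N (\<lambda>(i, j). if (i, j) \<in> F then v $ g (i, j)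
    else if (\<pi> j, \<pi> i) \<in> F then - v $ g (\<pi> j, \<pi> i) else 0)" for v :: "complex vec"
  have hs: "h v \<in> skew_on N \<pi> R" for v
  proof -
    have "h v $$ (i, j) = - h v $$ (\<pi> j, \<pi> i)" if "i < N" "j < N" for i j
      using that involution_belowD[OF \<pi>] F[of i j] by (auto simp: h_def)
    moreover have "h v $$ (i, j) = 0" if "i < N" "j < N" "(i, j) \<notin> R" for i j
      using that involution_belowD[OF \<pi>] F[of i j] F[of "\<pi> j" "\<pi> i"] by (auto simp: h_def)
    ultimately show ?thesis unfolding skew_on_def by (auto simp: h_def)
  qed
  show ?thesis
  proof (rule bij_betwI[where g = h])
    show "h \<in> carrier_vec d \<rightarrow> skew_on N \<pi> R" using hs by blast
    fix v :: "complex vec" assume v: "v \<in> carrier_vec d"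
    show "vec d (\<lambda>k. h v $$ e k) = v"
    proof (rule eq_vecI)
      fix k assume "k < dim_vec v"
      then have k: "k < d" using v by simp
      obtain i j where ij: "e k = (i, j)" by force
      then show "vec d (\<lambda>k. h v $$ e k) $ k = v $ k"
        using k eF[OF k] ge[OF k] F[of i j] by (simp add: h_def)
    qed (use v in auto)
  next
    fix Z assume Z: "Z \<in> skew_on N \<pi> R"
    show "h (vec d (\<lambda>k. Z $$ e k)) = Z"
    proof (rule eq_matI)
      fix i j assume "i < dim_row Z" "j < dim_col Z"
      then have ij: "i < N" "j < N" using skew_onD(1)[OF Z] by auto
      \<comment> \<open>These positions are the fixed points of
        \<open>(i, j) \<mapsto> (\<pi> j, \<pi> i)\<close>: the entry equals its own negative. Hence
        \<open>F\<close> has to represent only the positions that are moved.\<close>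
      have "Z $$ (i, j) = 0" if "i = \<pi> j"
        using skew_onD(2)[OF Z ij] that involution_belowD[OF \<pi> ij(2)] by (auto simp: complex_eq_iff)
      then have "Z $$ (i, j) = 0" if "(i, j) \<notin> F" "(\<pi> j, \<pi> i) \<notin> F"
        using that R[OF ij] skew_onD(3)[OF Z ij] by blast
      then show "h (vec d (\<lambda>k. Z $$ e k)) $$ (i, j) = Z $$ (i, j)"
        using ij eg skew_onD(2)[OF Z ij] by (auto simp: h_def)
    qed (use skew_onD(1)[OF Z] in \<open>auto simp: h_def\<close>)
  qed auto
qed

lemma skew_on_coords_hom:
  assumes e: "\<And>k. k < d \<Longrightarrow> fst (e k) < N \<and> snd (e k) < N"
  shows "(\<lambda>Z. vec d (\<lambda>k. Z $$ e k)) \<in> lin_hom CC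
    (gl_on N (skew_on N \<pi> R)) (module_vec TYPE(complex) d)"
proof -
  have *: "e k = (i, j) \<Longrightarrow> k < d \<Longrightarrow> i < N \<and> j < N" for k i j using e[of k] by simp
  show ?thesis
    unfolding LinearCombinations.module_hom_def gl_simps module_vec_simps
  proof (simp, intro conjI allI impI eq_vecI, goal_cases)
    case (1 A B k)
    then show ?case using skew_onD(1)[of A N \<pi> R] skew_onD(1)[of B N \<pi> R] *[of k]
      by (cases "e k") (auto simp: gl_simps)
  next
    case (3 r A k)
    then show ?case using skew_onD(1)[of A N \<pi> R] *[of k] by (cases "e k") (auto simp: gl_simps)
  qed auto
qed

lemma card_pairs_less:
  assumes "finite (S :: nat set)"
  shows "card {(i, j). i \<in> S \<and> j \<in> S \<and> i < j} = card S * (card S - 1) div 2"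
proof -
  let ?P = "{(i, j). i \<in> S \<and> j \<in> S \<and> i < j}"
  let ?Q = "{(i, j). i \<in> S \<and> j \<in> S \<and> j < i}"
  let ?D = "(\<lambda>x. (x, x)) ` S"
  have fin: "finite ?P" "finite ?Q" "finite (?D)"
    using assms by (auto intro: finite_subset[of _ "S \<times> S"])
  have "?Q = prod.swap ` ?P" by (auto simp: image_iff)
  then have cQ: "card ?Q = card ?P" by (simp add: card_image)
  have "S \<times> S = (?P \<union> ?Q) \<union> ?D" by (auto)
  then have "card S * card S = card ((?P \<union> ?Q) \<union> ?D)"
    by (metis card_cartesian_product)
  also have "\<dots> = card (?P \<union> ?Q) + card (?D)"
    using fin by (intro card_Un_disjoint) auto
  also have "card (?P \<union> ?Q) = card ?P + card ?Q"
    using fin by (intro card_Un_disjoint) auto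
  also have "card ?D = card S" by (simp add: card_image inj_on_def)
  finally have "card S * card S = 2 * card ?P + card S" using cQ by simp
  then have "card S * (card S - 1) = 2 * card ?P" by (simp add: diff_mult_distrib2)
  then show ?thesis by simp
qed

text \<open>Substituting \<open>k = \<pi> j\<close> turns the entries \<open>(i, j)\<close> into the entries \<open>(i, k)\<close> of an ordinary
  skew-symmetric matrix, of which those with \<open>i < k\<close> are independent.\<close>

lemma skew_on_has_coords:
  assumes \<pi>: "involution_below N \<pi>"
    and R: "\<And>i j. i < N \<Longrightarrow> j < N \<Longrightarrow> (i, j) \<in> R \<Longrightarrow> (\<pi> j, \<pi> i) \<in> R"
    and d: "card {(i, k). i < k \<and> k < N \<and> (i, \<pi> k) \<in> R} = d"
  obtains f where "f \<in> lin_hom CC (gl_on N (skew_on N \<pi> R)) (module_vec TYPE(complex) d)"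
    "bij_betw f (skew_on N \<pi> R) (carrier_vec d)"
proof -
  let ?P = "{(i, k). i < k \<and> k < N \<and> (i, \<pi> k) \<in> R}"
  have "finite ?P" by (rule finite_subset[of _ "{..<N} \<times> {..<N}"]) auto
  then obtain e where e: "bij_betw e {..<d} ?P"
    using ex_bij_betw_nat_finite[of ?P] d by (auto simp: lessThan_atLeast0)
  define e' where "e' = (\<lambda>(i, k). (i, \<pi> k)) \<circ> e"
  have inj: "inj_on (\<lambda>(i, k). (i, \<pi> k)) ?P"
    using involution_belowD(2)[OF \<pi>] by (intro inj_onI) (clarsimp, metis)
  define F where "F = (\<lambda>(i, k). (i, \<pi> k)) ` ?P"
  have e': "bij_betw e' {..<d} F"
    unfolding e'_def F_def using e inj by (intro bij_betw_trans[OF e]) (auto simp: bij_betw_def)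
  have F: "(i, j) \<in> F \<longleftrightarrow> i < \<pi> j \<and> j < N \<and> i < N \<and> (i, j) \<in> R" for i j
  proof
    assume "(i, j) \<in> F"
    then show "i < \<pi> j \<and> j < N \<and> i < N \<and> (i, j) \<in> R"
      using involution_belowD[OF \<pi>] by (auto simp: F_def)
  next
    assume "i < \<pi> j \<and> j < N \<and> i < N \<and> (i, j) \<in> R"
    then have "(i, \<pi> j) \<in> ?P" "(i, j) = (i, \<pi> (\<pi> j))"
      using involution_belowD[OF \<pi>] by auto
    then show "(i, j) \<in> F" unfolding F_def by force
  qed
  have e'F: "e' k \<in> F" if "k < d" for k using e' that by (auto simp: bij_betw_def)
  show thesis
  proof (rule that)
    show "bij_betw (\<lambda>Z. vec d (\<lambda>k. Z $$ e' k)) (skew_on N \<pi> R) (carrier_vec d)"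
    proof (rule skew_on_coords[OF \<pi> e'], goal_cases)
      case (1 i j)
      then show ?case using R[of i j] involution_belowD[OF \<pi>] by (auto simp: F)
    next
      case (2 i j)
      then show ?case using R[of i j] involution_belowD[OF \<pi>] by (auto simp: F)
    qed
    have "fst (e' k) < N \<and> snd (e' k) < N" if "k < d" for k
      using e'F[OF that] F by (cases "e' k") simp
    then show "(\<lambda>Z. vec d (\<lambda>k. Z $$ e' k)) \<in> lin_hom CC
        (gl_on N (skew_on N \<pi> R)) (module_vec TYPE(complex) d)"
      by (rule skew_on_coords_hom)
  qed
qed

section \<open>An eigenbasis of the permutation\<close>

\<comment> \<open>Otherwise the simplifier rewrites the index \<open>m + 2\<close>, and the rules below no longer match.\<close>
declare add_2_eq_Suc [simp del] add_2_eq_Suc' [simp del]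

text \<open>From here on \<open>n = m + 2\<close>, and \<open>\<sigma>\<^sub>0\<close> is \<open>\<sigma>\<close> on indices that start from 0.\<close>

definition \<sigma>\<^sub>0 :: "nat \<Rightarrow> nat \<Rightarrow> nat"
  where "\<sigma>\<^sub>0 m a = (if a = 0 then m + 1 else if a = m + 1 then 2 * m + 3 else if a = 2 * m + 3 then m + 2
    else if a = m + 2 then 0 else if a \<le> m then a + m + 2 else a - (m + 2))"

text \<open>The ranges on which \<open>eigen_sum\<close> is a single formula. They differ from those
  of \<open>\<sigma>\<^sub>0_cases\<close>: the second range of length \<open>m\<close> starts at
  \<open>m + 2\<close> for basis vectors, but at \<open>m + 3\<close> for the original
  coordinates.\<close>

lemma index_cases [consumes 1, case_names 0 1 2 3 4 5]:
  assumes "i < 2 * m + 4"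
  obtains "i = 0" | k where "k < m" "i = Suc k" | "i = Suc m" | k where "k < m" "i = m + 2 + k"
    | "i = 2 * m + 2" | "i = 2 * m + 3"
proof -
  consider "i = 0" | "1 \<le> i \<and> i \<le> m" | "i = Suc m" | "m + 2 \<le> i \<and> i < 2 * m + 2" | "i = 2 * m + 2" | "i = 2 * m + 3"
  proof -
    assume a: "i = 0 \<Longrightarrow> thesis" "1 \<le> i \<and> i \<le> m \<Longrightarrow> thesis" "i = Suc m \<Longrightarrow> thesis"
      "m + 2 \<le> i \<and> i < 2 * m + 2 \<Longrightarrow> thesis" "i = 2 * m + 2 \<Longrightarrow> thesis" "i = 2 * m + 3 \<Longrightarrow> thesis"
    have "i \<le> m \<or> i = Suc m \<or> m + 2 \<le> i" by arith
    moreover have "m + 2 \<le> i \<Longrightarrow> i < 2 * m + 2 \<or> i = 2 * m + 2 \<or> i = 2 * m + 3" using assms by arith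
    moreover have "i = 0 \<or> 1 \<le> i" by arith
    ultimately show thesis using a by blast
  qed
  then show thesis
  proof cases
    case 2
    then have "i - 1 < m" "i = Suc (i - 1)" by auto
    then show ?thesis using that(2) by blast
  next
    case 4
    then have "i - (m + 2) < m" "i = m + 2 + (i - (m + 2))" by auto
    then show ?thesis using that(4) by blast
  qed (use that in blast)+
qed

lemma \<sigma>_conv:
  assumes "a < 2 * m + 4"
  shows "\<sigma> (m + 2) (Suc a) = Suc (\<sigma>\<^sub>0 m a)"
  using assms by (simp add: \<sigma>_def \<sigma>\<^sub>0_def) linarith?

lemma \<sigma>\<^sub>0_cases:
  assumes "a < 2 * m + 4"
  obtains "a = 0" "\<sigma>\<^sub>0 m a = m + 1" | k where "k < m" "a = Suc k" "\<sigma>\<^sub>0 m a = m + 3 + k"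
    | "a = m + 1" "\<sigma>\<^sub>0 m a = 2 * m + 3" | "a = m + 2" "\<sigma>\<^sub>0 m a = 0"
    | k where "k < m" "a = m + 3 + k" "\<sigma>\<^sub>0 m a = Suc k" | "a = 2 * m + 3" "\<sigma>\<^sub>0 m a = m + 2"
proof -
  show thesis
    using assms
  proof (cases rule: index_cases)
    case (3 k)
    then show ?thesis using that(4) that(5)[of "k - 1"] by (cases k) (auto simp: \<sigma>\<^sub>0_def)
  next
    case 4
    then show ?thesis using that(4) that(5)[of "m - 1"] by (cases m) (auto simp: \<sigma>\<^sub>0_def)
  qed (use that in \<open>simp_all add: \<sigma>\<^sub>0_def\<close>)
qed

lemma \<sigma>\<^sub>0_less:
  assumes "a < 2 * m + 4"
  shows "\<sigma>\<^sub>0 m a < 2 * m + 4"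
  using assms by (cases rule: \<sigma>\<^sub>0_cases) simp_all

lemma \<sigma>\<^sub>0_simps:
  "\<sigma>\<^sub>0 m 0 = Suc m" "k < m \<Longrightarrow> \<sigma>\<^sub>0 m (Suc k) = m + 3 + k" "\<sigma>\<^sub>0 m (Suc m) = 2 * m + 3"
  "\<sigma>\<^sub>0 m (m + 2) = 0" "k < m \<Longrightarrow> \<sigma>\<^sub>0 m (m + 3 + k) = Suc k" "\<sigma>\<^sub>0 m (2 * m + 3) = m + 2"
  by (simp_all add: \<sigma>\<^sub>0_def)

text \<open>The permutation consists of one 4-cycle and \<open>m\<close> transpositions, so its
  third iterate is a left inverse.\<close>

lemma \<sigma>\<^sub>0_inj: "inj_on (\<sigma>\<^sub>0 m) {..<2 * m + 4}"
proof (rule inj_on_inverseI)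
  fix a assume "a \<in> {..<2 * m + 4}"
  then have "a < 2 * m + 4" by simp
  then show "\<sigma>\<^sub>0 m (\<sigma>\<^sub>0 m (\<sigma>\<^sub>0 m (\<sigma>\<^sub>0 m a))) = a"
    by (cases rule: \<sigma>\<^sub>0_cases) (simp_all add: \<sigma>\<^sub>0_simps[simplified])
qed

text \<open>The reversal is the permutation behind \<open>q\<close>; commuting with it makes the
  permutation matrix an isometry of \<open>q\<close>.\<close>

lemma \<sigma>\<^sub>0_rev:
  assumes "a < 2 * m + 4"
  shows "\<sigma>\<^sub>0 m (2 * m + 3 - a) = 2 * m + 3 - \<sigma>\<^sub>0 m a"
  using assms
proof (cases rule: \<sigma>\<^sub>0_cases)
  case (2 k)
  then have "2 * m + 3 - a = m + 3 + (m - Suc k)" "m - Suc k < m" by auto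
  then show ?thesis using 2 by (simp only: \<sigma>\<^sub>0_simps)
next
  case (5 k)
  then have "2 * m + 3 - a = Suc (m - Suc k)" "m - Suc k < m" by auto
  then show ?thesis using 5 by (simp only: \<sigma>\<^sub>0_simps)
qed (simp_all add: \<sigma>\<^sub>0_def)

lemma \<sigma>_permutes: "\<sigma> (m + 2) permutes {1..2 * (m + 2)}"
proof (rule bij_imp_permutes)
  have N: "{1..2 * (m + 2)} = Suc ` {..<2 * m + 4}"
    by (auto simp: image_Suc_lessThan)
  have "inj_on (\<sigma> (m + 2)) {1..2 * (m + 2)}"
    unfolding N
  proof (rule inj_onI, safe)
    fix a b assume "a < 2 * m + 4" "b < 2 * m + 4" "\<sigma> (m + 2) (Suc a) = \<sigma> (m + 2) (Suc b)"
    then show "a = b" using inj_onD[OF \<sigma>\<^sub>0_inj[of m], of a b] by (simp add: \<sigma>_conv)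
  qed
  moreover have "\<sigma> (m + 2) ` {1..2 * (m + 2)} \<subseteq> {1..2 * (m + 2)}"
    unfolding N using \<sigma>_conv[of _ m] \<sigma>\<^sub>0_less[of _ m] by auto
  ultimately show "bij_betw (\<sigma> (m + 2)) {1..2 * (m + 2)} {1..2 * (m + 2)}"
    by (simp add: bij_betw_def endo_inj_surj)
  fix x assume "x \<notin> {1..2 * (m + 2)}"
  then show "\<sigma> (m + 2) x = x" by (simp add: \<sigma>_def) linarith?
qed

section \<open>The automorphism as conjugation by a permutation matrix\<close>

lemma antidiag_conv: "antidiag N = perm_mat N (\<lambda>i. N - 1 - i)"
  by (intro eq_matI) (auto simp: antidiag_def perm_mat_def)

lemma involution_rev: "involution_below N (\<lambda>i. N - 1 - i)"
  by (auto simp: involution_below_def)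

lemma antidiag_facts [simp]:
  "antidiag N \<in> carrier_mat N N" "transpose_mat (antidiag N) = antidiag N" "antidiag N * antidiag N = 1\<^sub>m N"
  using perm_mat_transpose[OF involution_rev[of N]] perm_mat_square[OF involution_rev[of N]]
  unfolding antidiag_conv[symmetric] by (auto simp: antidiag_def)

text \<open>The matrix \<open>perm_mat\<close> has its ones at
  \<open>(a, \<sigma>\<^sub>0 m a)\<close>. Its transpose is thus the operator that takes the unit
  vector of index \<open>a\<close> to that of index \<open>\<sigma>\<^sub>0 m a\<close>, and
  conjugation by this operator moves matrix units as \<open>lam\<close> does.\<close>

lemma lam_eq:
  assumes Z: "Z \<in> carrier_mat (2 * m + 4) (2 * m + 4)"
  shows "lam (m + 2) Z = transpose_mat (perm_mat (2 * m + 4) (\<sigma>\<^sub>0 m)) * Z * perm_mat (2 * m + 4) (\<sigma>\<^sub>0 m)"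
    (is "_ = transpose_mat ?P * Z * ?P")
proof -
  let ?N = "2 * m + 4"
  let ?I = "{1..?N}"
  have N: "2 * (m + 2) = ?N" by simp
  let ?w = "\<lambda>p. Z $$ (fst p - 1, snd p - 1) \<cdot>\<^sub>m E_unit ?N (\<sigma> (m + 2) (fst p)) (\<sigma> (m + 2) (snd p))"
  have S: "submodule CC (carrier_mat ?N ?N) (gl ?N)" by (rule gl_submoduleI) auto
  have gl: "gl_on ?N (carrier_mat ?N ?N) = gl ?N" by (simp add: gl_simps(1)[symmetric])
  interpret gl: vectorspace CC "gl ?N" by (rule gl_vectorspace)
  have w: "?w p \<in> carrier_mat ?N ?N" for p by (simp add: E_unit_def)
  have lc: "lam (m + 2) Z \<in> carrier_mat ?N ?N"
    unfolding lam_def N using gl.M.finsum_closed[of ?w "?I \<times> ?I"] w unfolding gl_simps by blast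
  show ?thesis
  proof (rule eq_matI)
    fix i j assume "i < dim_row (transpose_mat ?P * Z * ?P)" "j < dim_col (transpose_mat ?P * Z * ?P)"
    then have ij: "i < ?N" "j < ?N" by auto
    have "lam (m + 2) Z $$ (i, j) = (\<Sum>p\<in>?I \<times> ?I. ?w p $$ (i, j))"
      unfolding lam_def N
      using gl_sub_finsum_index[OF S, of "?I \<times> ?I" ?w i j] w ij by (simp add: gl)
    \<comment> \<open>Passage from labels that start at 1 to matrix indices that start at 0.\<close>
    also have "\<dots> = (\<Sum>(c, d)\<in>{0..<?N} \<times> {0..<?N}. ?w (Suc c, Suc d) $$ (i, j))"
      by (rule sum.reindex_bij_witness[of _ "map_prod Suc Suc" "map_prod (\<lambda>x. x - 1) (\<lambda>x. x - 1)"]) auto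
    also have "\<dots> = (\<Sum>(c, d)\<in>{0..<?N} \<times> {0..<?N}. ?P $$ (c, i) * Z $$ (c, d) * ?P $$ (d, j))"
      by (rule sum.cong) (use ij \<sigma>_conv[of _ m] in \<open>auto simp: E_unit_def perm_mat_def\<close>)
    also have "\<dots> = (\<Sum>d = 0..<?N. (\<Sum>c = 0..<?N. ?P $$ (c, i) * Z $$ (c, d)) * ?P $$ (d, j))"
      unfolding sum.cartesian_product[symmetric] sum_distrib_right by (rule sum.swap)
    also have "\<dots> = (transpose_mat ?P * Z * ?P) $$ (i, j)"
      using ij Z by (simp add: scalar_prod_def)
    finally show "lam (m + 2) Z $$ (i, j) = (transpose_mat ?P * Z * ?P) $$ (i, j)" .
  qed (use lc in auto)
qed

lemma perm_mat_\<sigma>\<^sub>0_orthogonal: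
  fixes m :: nat
  defines "P \<equiv> perm_mat (2 * m + 4) (\<sigma>\<^sub>0 m)"
  shows "P * transpose_mat P = 1\<^sub>m (2 * m + 4)" "transpose_mat P * P = 1\<^sub>m (2 * m + 4)"
proof -
  have P: "P \<in> carrier_mat (2 * m + 4) (2 * m + 4)" by (simp add: P_def)
  show *: "P * transpose_mat P = 1\<^sub>m (2 * m + 4)"
  proof (rule eq_matI)
    fix i j assume "i < dim_row (1\<^sub>m (2 * m + 4) :: complex mat)" "j < dim_col (1\<^sub>m (2 * m + 4) :: complex mat)"
    then have ij: "i < 2 * m + 4" "j < 2 * m + 4" by auto
    have "(P * transpose_mat P) $$ (i, j) = P $$ (i, \<sigma>\<^sub>0 m j)"
      unfolding P_def using ij \<sigma>\<^sub>0_less by (intro index_mult_perm_mat_transpose[where M = "2 * m + 4"]) auto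
    also have "\<dots> = (if \<sigma>\<^sub>0 m j = \<sigma>\<^sub>0 m i then 1 else 0)"
      using ij \<sigma>\<^sub>0_less[OF ij(2)] by (simp add: P_def perm_mat_def)
    also have "\<dots> = 1\<^sub>m (2 * m + 4) $$ (i, j)"
      using ij inj_onD[OF \<sigma>\<^sub>0_inj[of m], of i j] by auto
    finally show "(P * transpose_mat P) $$ (i, j) = 1\<^sub>m (2 * m + 4) $$ (i, j)" .
  qed (use P in auto)
  show "transpose_mat P * P = 1\<^sub>m (2 * m + 4)"
    using mat_mult_left_right_inverse[OF P _ *] P by simp
qed

text \<open>The conjugation is read backwards, so that no inverse of \<open>\<sigma>\<^sub>0\<close>
  has to be named.\<close>

lemma index_lam:
  assumes Z: "Z \<in> carrier_mat (2 * m + 4) (2 * m + 4)" and ij: "i < 2 * m + 4" "j < 2 * m + 4"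
  shows "lam (m + 2) Z $$ (\<sigma>\<^sub>0 m i, \<sigma>\<^sub>0 m j) = Z $$ (i, j)"
proof -
  let ?N = "2 * m + 4" and ?P = "perm_mat (2 * m + 4) (\<sigma>\<^sub>0 m)"
  have L: "lam (m + 2) Z \<in> carrier_mat ?N ?N" using lam_eq[OF Z] Z by auto
  have "?P * lam (m + 2) Z * transpose_mat ?P = Z"
    unfolding lam_eq[OF Z]
    by (rule conj_conj[OF _ _ _ Z]) (simp_all add: perm_mat_\<sigma>\<^sub>0_orthogonal)
  then have "Z $$ (i, j) = (?P * lam (m + 2) Z * transpose_mat ?P) $$ (i, j)" by simp
  also have "\<dots> = (?P * lam (m + 2) Z) $$ (i, \<sigma>\<^sub>0 m j)"
    using L ij \<sigma>\<^sub>0_less by (intro index_mult_perm_mat_transpose[where M = ?N]) auto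
  also have "\<dots> = lam (m + 2) Z $$ (\<sigma>\<^sub>0 m i, \<sigma>\<^sub>0 m j)"
    using L ij \<sigma>\<^sub>0_less by (intro index_perm_mat_mult[where M = ?N]) auto
  finally show ?thesis by simp
qed

lemma \<gg>_conv: "\<gg> (m + 2) = so_form (2 * m + 4) (antidiag (2 * m + 4))"
  by (simp add: \<gg>_def distrib_left)

lemma \<gg>_carrier_conv: "carrier (\<gg> (m + 2)) = skew_on (2 * m + 4) (\<lambda>i. 2 * m + 4 - 1 - i) UNIV"
  unfolding \<gg>_conv antidiag_conv by (rule so_form_perm_mat_carrier[OF involution_rev])

lemma lam_lie_iso: "lam (m + 2) \<in> lie_iso CC (\<gg> (m + 2)) (\<gg> (m + 2))"
proof -
  let ?N = "2 * m + 4" and ?P = "perm_mat (2 * m + 4) (\<sigma>\<^sub>0 m)"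
  have "?P * (antidiag ?N * transpose_mat ?P) = antidiag ?N"
  proof (rule eq_matI)
    fix i j assume "i < dim_row (antidiag ?N)" "j < dim_col (antidiag ?N)"
    then have ij: "i < ?N" "j < ?N" by (auto simp: antidiag_def)
    have "(?P * (antidiag ?N * transpose_mat ?P)) $$ (i, j) = (antidiag ?N * transpose_mat ?P) $$ (\<sigma>\<^sub>0 m i, j)"
      using ij \<sigma>\<^sub>0_less by (intro index_perm_mat_mult[where M = ?N] mult_carrier_mat[where n = ?N]) auto
    also have "\<dots> = antidiag ?N $$ (\<sigma>\<^sub>0 m i, \<sigma>\<^sub>0 m j)"
      using ij \<sigma>\<^sub>0_less by (intro index_mult_perm_mat_transpose[where M = ?N]) auto
    also have "\<dots> = (if \<sigma>\<^sub>0 m j = \<sigma>\<^sub>0 m (2 * m + 3 - i) then 1 else 0)"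
      using ij \<sigma>\<^sub>0_less[OF ij(1)] \<sigma>\<^sub>0_less[OF ij(2)] by (auto simp: \<sigma>\<^sub>0_rev antidiag_def)
    also have "\<dots> = (if j = 2 * m + 3 - i then 1 else 0)"
      using ij inj_onD[OF \<sigma>\<^sub>0_inj[of m], of j "2 * m + 3 - i"] by auto
    also have "\<dots> = antidiag ?N $$ (i, j)"
      using ij by (auto simp: antidiag_def)
    finally show "(?P * (antidiag ?N * transpose_mat ?P)) $$ (i, j) = antidiag ?N $$ (i, j)" .
  qed (auto simp: antidiag_def)
  then have 1: "?P * antidiag ?N * transpose_mat ?P = antidiag ?N"
    by (simp add: assoc_mult_mat[of _ ?N ?N _ ?N _ ?N])
  \<comment> \<open>In \<open>lam_eq\<close> the transpose stands on the left, so the isometry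
    identity is needed for the inverse matrix.\<close>
  have 2: "transpose_mat ?P * antidiag ?N * transpose_mat (transpose_mat ?P) = antidiag ?N"
    using conj_conj[of ?P ?N "transpose_mat ?P" "antidiag ?N"] by (simp add: perm_mat_\<sigma>\<^sub>0_orthogonal 1)
  have "(\<lambda>Z. transpose_mat ?P * Z * ?P) \<in> lie_iso CC (\<gg> (m + 2)) (\<gg> (m + 2))"
    unfolding \<gg>_conv by (rule conj_lie_iso[OF _ _ _ _ _ 2]) (simp_all add: perm_mat_\<sigma>\<^sub>0_orthogonal)
  moreover have "lam (m + 2) Z = transpose_mat ?P * Z * ?P" if "Z \<in> carrier (\<gg> (m + 2))" for Z
    using that skew_onD(1) unfolding \<gg>_carrier_conv by (intro lam_eq) blast
  \<comment> \<open>\<open>lam\<close> is replaced by the conjugation only at elements of the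
    carrier, hence sums, multiples and brackets must be known to stay in it.\<close>
  moreover have "Z \<in> carrier (\<gg> (m + 2)) \<Longrightarrow> W \<in> carrier (\<gg> (m + 2)) \<Longrightarrow> Z \<oplus>\<^bsub>\<gg> (m + 2)\<^esub> W \<in> carrier (\<gg> (m + 2))"
    "Z \<in> carrier (\<gg> (m + 2)) \<Longrightarrow> c \<odot>\<^bsub>\<gg> (m + 2)\<^esub> Z \<in> carrier (\<gg> (m + 2))"
    "Z \<in> carrier (\<gg> (m + 2)) \<Longrightarrow> W \<in> carrier (\<gg> (m + 2)) \<Longrightarrow> lie_bracket (\<gg> (m + 2)) Z W \<in> carrier (\<gg> (m + 2))" for Z W c
    using gl_submoduleD[OF so_form_submodule[of "antidiag ?N" ?N]] so_form_bracket[of "antidiag ?N" ?N Z W]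
    by (simp_all add: \<gg>_conv so_form_def gl_simps)
  ultimately show ?thesis
    by (auto simp: lie_iso_def LinearCombinations.module_hom_def cong: bij_betw_cong)
qed

section \<open>The eigenvectors and their Gram matrix\<close>

text \<open>Pairing of \<open>f\<close> with the \<open>j\<close>-th vector of a basis of eigenvectors: first \<open>m + 1\<close> vectors for the
  eigenvalue \<open>1\<close>, then as many for \<open>-1\<close>, and finally one each for \<open>\<i>\<close> and \<open>-\<i>\<close>. The scaling is such that the
  form pairs the \<open>j\<close>-th vector with the one of index \<open>eigen_dual m j\<close>, with value 1.\<close>

definition eigen_sum :: "nat \<Rightarrow> nat \<Rightarrow> (nat \<Rightarrow> complex) \<Rightarrow> complex"
  where "eigen_sum m j f =
    (if j = 0 then (f 0 + f (Suc m) + f (m + 2) + f (2 * m + 3)) / 2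
     else if j \<le> m then csqrt (1 / 2) * (f j + f (m + 2 + j))
     else if j = m + 1 then (f 0 - f (Suc m) - f (m + 2) + f (2 * m + 3)) / 2
     else if j \<le> 2 * m + 1 then \<i> * csqrt (1 / 2) * (f (j - (m + 1)) - f (j + 1))
     else if j = 2 * m + 2 then (\<i> * f 0 + f (Suc m) - f (m + 2) - \<i> * f (2 * m + 3)) / 2
     else (\<i> * f 0 - f (Suc m) + f (m + 2) - \<i> * f (2 * m + 3)) / 2)"

lemma eigen_sum_simps:
  "eigen_sum m 0 f = (f 0 + f (Suc m) + f (m + 2) + f (2 * m + 3)) / 2"
  "k < m \<Longrightarrow> eigen_sum m (Suc k) f = csqrt (1 / 2) * (f (Suc k) + f (m + 3 + k))"
  "eigen_sum m (Suc m) f = (f 0 - f (Suc m) - f (m + 2) + f (2 * m + 3)) / 2"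
  "k < m \<Longrightarrow> eigen_sum m (m + 2 + k) f = \<i> * csqrt (1 / 2) * (f (Suc k) - f (m + 3 + k))"
  "eigen_sum m (2 * m + 2) f = (\<i> * f 0 + f (Suc m) - f (m + 2) - \<i> * f (2 * m + 3)) / 2"
  "eigen_sum m (2 * m + 3) f = (\<i> * f 0 - f (Suc m) + f (m + 2) - \<i> * f (2 * m + 3)) / 2"
  by (auto simp: eigen_sum_def eval_nat_numeral)

text \<open>The functional \<open>eigen_sum\<close> is the primary object and the matrix is derived
  from it by Kronecker deltas. Computations then deal with two or four terms instead of sums over
  all indices; \<open>sum_eigen_mat\<close> is the bridge.\<close>

definition eigen_mat :: "nat \<Rightarrow> complex mat"
  where "eigen_mat m = mat (2 * m + 4) (2 * m + 4) (\<lambda>(a, j). eigen_sum m j (\<lambda>b. if a = b then 1 else 0))"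

lemma eigen_mat_carrier [simp]: "eigen_mat m \<in> carrier_mat (2 * m + 4) (2 * m + 4)"
  "dim_row (eigen_mat m) = 2 * m + 4" "dim_col (eigen_mat m) = 2 * m + 4"
  by (simp_all add: eigen_mat_def)

lemma eigen_sum_add: "eigen_sum m j (\<lambda>b. f b + g b) = eigen_sum m j f + eigen_sum m j g"
  by (simp add: eigen_sum_def algebra_simps add_divide_distrib diff_divide_distrib)

lemma eigen_sum_sum: "eigen_sum m j (\<lambda>b. \<Sum>a\<in>A. g a b) = (\<Sum>a\<in>A. eigen_sum m j (g a))"
proof (induction A rule: infinite_finite_induct)
  case (insert x F)
  then show ?case using eigen_sum_add[of m j "g x"] by simp
qed (simp_all add: eigen_sum_def)

lemma eigen_sum_mult_right: "eigen_sum m j (\<lambda>b. f b * c) = eigen_sum m j f * c"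
  by (simp add: eigen_sum_def algebra_simps)

lemma eigen_sum_cong:
  assumes "j < 2 * m + 4" "\<And>b. b < 2 * m + 4 \<Longrightarrow> f b = g b"
  shows "eigen_sum m j f = eigen_sum m j g"
  using assms by (simp add: eigen_sum_def)

lemma sum_eigen_mat:
  assumes "j < 2 * m + 4"
  shows "(\<Sum>a = 0..<2 * m + 4. eigen_mat m $$ (a, j) * f a) = eigen_sum m j f"
proof -
  have "(\<Sum>a = 0..<2 * m + 4. eigen_mat m $$ (a, j) * f a) =
    (\<Sum>a = 0..<2 * m + 4. eigen_sum m j (\<lambda>b. (if a = b then 1 else 0) * f a))"
    using assms by (intro sum.cong) (simp_all add: eigen_mat_def eigen_sum_mult_right)
  also have "\<dots> = eigen_sum m j (\<lambda>b. \<Sum>a = 0..<2 * m + 4. (if a = b then 1 else 0) * f a)"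
    by (rule eigen_sum_sum[symmetric])
  also have "\<dots> = eigen_sum m j f"
    using assms by (intro eigen_sum_cong) (simp_all add: if_distrib[of "\<lambda>x. x * _"] cong: if_cong)
  finally show ?thesis .
qed

text \<open>An isometry pairs an eigenvalue only with its inverse: 1 and -1 are paired with
  themselves, \<i> with -\<i>. Within the two ranges of length \<open>m\<close> the reversal of
  \<open>q\<close> survives, and the vectors 0 and \<open>m + 1\<close> that come from the 4-cycle
  are their own partners.\<close>

definition eigen_dual :: "nat \<Rightarrow> nat \<Rightarrow> nat"
  where "eigen_dual m i = (if i = 0 \<or> i = m + 1 then i else if i \<le> m then m + 1 - i
    else if i \<le> 2 * m + 1 then 3 * m + 3 - i else if i = 2 * m + 2 then 2 * m + 3 else 2 * m + 2)"

lemma eigen_dual_simps: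
  "eigen_dual m 0 = 0" "k < m \<Longrightarrow> eigen_dual m (Suc k) = Suc (m - Suc k)"
  "eigen_dual m (Suc m) = Suc m" "k < m \<Longrightarrow> eigen_dual m (m + 2 + k) = m + 2 + (m - Suc k)"
  "eigen_dual m (2 * m + 2) = 2 * m + 3" "eigen_dual m (2 * m + 3) = 2 * m + 2"
  by (auto simp: eigen_dual_def)

lemma involution_eigen_dual: "involution_below (2 * m + 4) (eigen_dual m)"
  by (auto simp: involution_below_def eigen_dual_def)

definition eigen_form :: "nat \<Rightarrow> complex mat"
  where "eigen_form m = perm_mat (2 * m + 4) (eigen_dual m)"

lemma rev_index_simps:
  "2 * m + 3 - 0 = 2 * m + 3" "k < m \<Longrightarrow> 2 * m + 3 - Suc k = m + 3 + (m - Suc k)" "2 * m + 3 - Suc m = m + 2"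
  "2 * m + 3 - (m + 2) = Suc m" "k < m \<Longrightarrow> 2 * m + 3 - (m + 3 + k) = Suc (m - Suc k)" "2 * m + 3 - (2 * m + 3) = (0 :: nat)"
  for m :: nat
  by auto

text \<open>Evaluates Kronecker deltas on the index patterns of
  \<open>\<sigma>\<^sub>0_cases\<close>. Used with \<open>simp only\<close>, these rules leave the
  patterns intact for \<open>eigen_sum_simps\<close>, which arithmetic normalisation would
  destroy.\<close>

lemma index_eq_simps:
  fixes m :: nat
  shows "l < m \<Longrightarrow> (0 = Suc l) = False"
  "(0 = Suc m) = False"
  "(0 = m + 2) = False"
  "l < m \<Longrightarrow> (0 = m + 3 + l) = False"
  "(0 = 2 * m + 3) = False"
  "k < m \<Longrightarrow> (Suc k = 0) = False"
  "k < m \<Longrightarrow> (Suc k = Suc m) = False"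
  "k < m \<Longrightarrow> (Suc k = m + 2) = False"
  "k < m \<Longrightarrow> l < m \<Longrightarrow> (Suc k = m + 3 + l) = False"
  "k < m \<Longrightarrow> (Suc k = 2 * m + 3) = False"
  "(Suc m = 0) = False"
  "l < m \<Longrightarrow> (Suc m = Suc l) = False"
  "(Suc m = m + 2) = False"
  "l < m \<Longrightarrow> (Suc m = m + 3 + l) = False"
  "(Suc m = 2 * m + 3) = False"
  "(m + 2 = 0) = False"
  "l < m \<Longrightarrow> (m + 2 = Suc l) = False"
  "(m + 2 = Suc m) = False"
  "l < m \<Longrightarrow> (m + 2 = m + 3 + l) = False"
  "(m + 2 = 2 * m + 3) = False"
  "k < m \<Longrightarrow> (m + 3 + k = 0) = False"
  "k < m \<Longrightarrow> l < m \<Longrightarrow> (m + 3 + k = Suc l) = False"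
  "k < m \<Longrightarrow> (m + 3 + k = Suc m) = False"
  "k < m \<Longrightarrow> (m + 3 + k = m + 2) = False"
  "k < m \<Longrightarrow> (m + 3 + k = 2 * m + 3) = False"
  "(2 * m + 3 = 0) = False"
  "l < m \<Longrightarrow> (2 * m + 3 = Suc l) = False"
  "(2 * m + 3 = Suc m) = False"
  "(2 * m + 3 = m + 2) = False"
  "l < m \<Longrightarrow> (2 * m + 3 = m + 3 + l) = False"
  "(0 = 0) = True"
  "(Suc k = Suc l) = (k = l)"
  "(Suc m = Suc m) = True"
  "(m + 2 = m + 2) = True"
  "(m + 3 + k = m + 3 + l) = (k = l)"
  "(2 * m + 3 = 2 * m + 3) = True"
  by auto

text \<open>The counterpart for the index patterns of \<open>index_cases\<close>.\<close>

lemma eigen_index_eq_simps: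
  fixes m :: nat
  shows "l < m \<Longrightarrow> (0 = Suc l) = False"
  "(0 = Suc m) = False"
  "l < m \<Longrightarrow> (0 = m + 2 + l) = False"
  "(0 = 2 * m + 2) = False"
  "(0 = 2 * m + 3) = False"
  "k < m \<Longrightarrow> (Suc k = 0) = False"
  "k < m \<Longrightarrow> (Suc k = Suc m) = False"
  "k < m \<Longrightarrow> l < m \<Longrightarrow> (Suc k = m + 2 + l) = False"
  "k < m \<Longrightarrow> (Suc k = 2 * m + 2) = False"
  "k < m \<Longrightarrow> (Suc k = 2 * m + 3) = False"
  "(Suc m = 0) = False"
  "l < m \<Longrightarrow> (Suc m = Suc l) = False"
  "l < m \<Longrightarrow> (Suc m = m + 2 + l) = False"
  "(Suc m = 2 * m + 2) = False"
  "(Suc m = 2 * m + 3) = False"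
  "k < m \<Longrightarrow> (m + 2 + k = 0) = False"
  "k < m \<Longrightarrow> l < m \<Longrightarrow> (m + 2 + k = Suc l) = False"
  "k < m \<Longrightarrow> (m + 2 + k = Suc m) = False"
  "k < m \<Longrightarrow> (m + 2 + k = 2 * m + 2) = False"
  "k < m \<Longrightarrow> (m + 2 + k = 2 * m + 3) = False"
  "(2 * m + 2 = 0) = False"
  "l < m \<Longrightarrow> (2 * m + 2 = Suc l) = False"
  "(2 * m + 2 = Suc m) = False"
  "l < m \<Longrightarrow> (2 * m + 2 = m + 2 + l) = False"
  "(2 * m + 2 = 2 * m + 3) = False"
  "(2 * m + 3 = 0) = False"
  "l < m \<Longrightarrow> (2 * m + 3 = Suc l) = False"
  "(2 * m + 3 = Suc m) = False"
  "l < m \<Longrightarrow> (2 * m + 3 = m + 2 + l) = False"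
  "(2 * m + 3 = 2 * m + 2) = False"
  "(0 = 0) = True"
  "(Suc k = Suc l) = (k = l)"
  "(Suc m = Suc m) = True"
  "(m + 2 + k = m + 2 + l) = (k = l)"
  "(2 * m + 2 = 2 * m + 2) = True"
  "(2 * m + 3 = 2 * m + 3) = True"
  by auto

lemma csqrt_half: "csqrt (1 / 2) * csqrt (1 / 2) = 1 / 2"
  by (metis power2_csqrt power2_eq_square)

text \<open>The left side is the value of \<open>q\<close> on the columns \<open>i\<close> and
  \<open>j\<close>. On the 4-cycle \<open>q\<close> pairs 0 with \<open>2 * m + 3\<close> and
  \<open>m + 1\<close> with \<open>m + 2\<close>: the vectors for 1 and -1 have square 4/4, those
  for \<i> and -\<i> have square 0 and mutual value 4/4. The vectors from the transpositions rest on
  \<open>s * s = 1 / 2\<close>, and for -1 on the square of \<i> as well.\<close>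

lemma eigen_gram:
  assumes i: "i < 2 * m + 4" and j: "j < 2 * m + 4"
  shows "eigen_sum m i (\<lambda>a. eigen_mat m $$ (2 * m + 3 - a, j)) = (if j = eigen_dual m i then 1 else 0)"
proof -
  define s where "s = csqrt (1 / 2)"
  have r: "s * s = 1 / 2" "s * (s * x) = x / 2" for x
    using csqrt_half by (simp_all add: s_def mult.assoc[symmetric])
  have "eigen_sum m i (\<lambda>a. eigen_sum m j (\<lambda>b. if 2 * m + 3 - a = b then 1 else 0)) = (if j = eigen_dual m i then 1 else 0)"
    using i
  proof (cases rule: index_cases)
    case 0
    show ?thesis unfolding 0 using j
      by (cases rule: index_cases) (simp_all only: eigen_sum_simps eigen_dual_simps rev_index_simps index_eq_simps eigen_index_eq_simps if_True if_False, simp_all)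
  next
    case (1 k)
    \<comment> \<open>The mirror image of \<open>k\<close> in its range. A name of its own hides the
      truncated subtraction and lets the rules for \<open>k < m\<close> apply to it.\<close>
    define p where "p = m - Suc k"
    have p: "p < m" using 1 by (simp add: p_def)
    show ?thesis unfolding 1(2) using j
      by (cases rule: index_cases) (use 1(1) p in \<open>simp_all only: eigen_sum_simps eigen_dual_simps rev_index_simps p_def[symmetric] s_def[symmetric] index_eq_simps eigen_index_eq_simps if_True if_False, simp_all add: algebra_simps r\<close>)
  next
    case 2
    show ?thesis unfolding 2 using j
      by (cases rule: index_cases) (simp_all only: eigen_sum_simps eigen_dual_simps rev_index_simps index_eq_simps eigen_index_eq_simps if_True if_False, simp_all)
  next
    case (3 k)
    define p where "p = m - Suc k"
    have p: "p < m" using 3 by (simp add: p_def)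
    show ?thesis unfolding 3(2) using j
      by (cases rule: index_cases) (use 3(1) p in \<open>simp_all only: eigen_sum_simps eigen_dual_simps rev_index_simps p_def[symmetric] s_def[symmetric] index_eq_simps eigen_index_eq_simps if_True if_False, simp_all add: algebra_simps r\<close>)
  next
    case 4
    show ?thesis unfolding 4 using j
      by (cases rule: index_cases) (simp_all only: eigen_sum_simps eigen_dual_simps rev_index_simps index_eq_simps eigen_index_eq_simps if_True if_False, simp_all)
  next
    case 5
    show ?thesis unfolding 5 using j
      by (cases rule: index_cases) (simp_all only: eigen_sum_simps eigen_dual_simps rev_index_simps index_eq_simps eigen_index_eq_simps if_True if_False, simp_all)
  qed
  moreover have "eigen_sum m i (\<lambda>a. eigen_mat m $$ (2 * m + 3 - a, j)) =
      eigen_sum m i (\<lambda>a. eigen_sum m j (\<lambda>b. if 2 * m + 3 - a = b then 1 else 0))"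
    using assms by (simp add: eigen_mat_def)
  ultimately show ?thesis by simp
qed

lemma index_mult_mat_sum:
  assumes "A \<in> carrier_mat n k" "B \<in> carrier_mat k l" "i < n" "j < l"
  shows "(A * B) $$ (i, j) = (\<Sum>a = 0..<k. A $$ (i, a) * B $$ (a, j))"
  using assms by (simp add: scalar_prod_def)

text \<open>With \<open>T\<close> for \<open>eigen_mat m\<close> and \<open>E\<close> for
  \<open>eigen_form m\<close>, the Gram identity \<open>T^T * q * T = E\<close> and
  \<open>E * E = 1\<close> exhibit \<open>E * T^T * q\<close> as a left inverse of
  \<open>T\<close>.\<close>

definition eigen_inv :: "nat \<Rightarrow> complex mat"
  where "eigen_inv m = eigen_form m * (transpose_mat (eigen_mat m) * antidiag (2 * m + 4))"

lemma eigen_form_carrier [simp]: "eigen_form m \<in> carrier_mat (2 * m + 4) (2 * m + 4)"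
  by (simp add: eigen_form_def)

lemma eigen_inv_carrier [simp]: "eigen_inv m \<in> carrier_mat (2 * m + 4) (2 * m + 4)"
  by (simp add: eigen_inv_def mult_carrier_mat[of _ _ "2 * m + 4"])

lemma index_antidiag_mult:
  assumes "A \<in> carrier_mat N M" "i < N" "j < M"
  shows "(antidiag N * A) $$ (i, j) = A $$ (N - 1 - i, j)"
  unfolding antidiag_conv using assms by (intro index_perm_mat_mult) auto

lemma index_mult_antidiag:
  assumes "A \<in> carrier_mat M N" "i < M" "j < N"
  shows "(A * antidiag N) $$ (i, j) = A $$ (i, N - 1 - j)"
  unfolding antidiag_conv using assms by (intro index_mult_perm_mat[OF involution_rev]) auto

lemma rev_conv: "2 * m + 4 - 1 - a = 2 * m + 3 - (a :: nat)"
  by arith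

lemma sum_rev_index: "(\<Sum>a = 0..<2 * m + 4. f (2 * m + 3 - a) (a :: nat)) = (\<Sum>a = 0..<2 * m + 4. f a (2 * m + 3 - a))"
  for f :: "nat \<Rightarrow> nat \<Rightarrow> complex"
proof (rule sum.reindex_bij_witness[of _ "\<lambda>a. 2 * m + 3 - a" "\<lambda>a. 2 * m + 3 - a"])
  fix a assume "a \<in> {0..<2 * m + 4}"
  then have "2 * m + 3 - (2 * m + 3 - a) = a" "2 * m + 3 - a \<in> {0..<2 * m + 4}" by auto
  then show "2 * m + 3 - (2 * m + 3 - a) = a" "2 * m + 3 - (2 * m + 3 - a) = a" "2 * m + 3 - a \<in> {0..<2 * m + 4}"
    "2 * m + 3 - a \<in> {0..<2 * m + 4}" "f (2 * m + 3 - a) (2 * m + 3 - (2 * m + 3 - a)) = f (2 * m + 3 - a) a"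
    by simp_all
qed

lemma eigen_gram_mat: "transpose_mat (eigen_mat m) * (antidiag (2 * m + 4) * eigen_mat m) = eigen_form m"
proof (rule eq_matI)
  fix i j assume "i < dim_row (eigen_form m)" "j < dim_col (eigen_form m)"
  then have ij: "i < 2 * m + 4" "j < 2 * m + 4" by (auto simp: eigen_form_def)
  have "(transpose_mat (eigen_mat m) * (antidiag (2 * m + 4) * eigen_mat m)) $$ (i, j) =
    (\<Sum>a = 0..<2 * m + 4. eigen_mat m $$ (a, i) * (antidiag (2 * m + 4) * eigen_mat m) $$ (a, j))"
    using ij by (simp add: scalar_prod_def antidiag_def)
  also have "\<dots> = (\<Sum>a = 0..<2 * m + 4. eigen_mat m $$ (a, i) * eigen_mat m $$ (2 * m + 3 - a, j))"
  proof (rule sum.cong[OF refl])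
    fix a assume "a \<in> {0..<2 * m + 4}"
    then show "eigen_mat m $$ (a, i) * (antidiag (2 * m + 4) * eigen_mat m) $$ (a, j) =
        eigen_mat m $$ (a, i) * eigen_mat m $$ (2 * m + 3 - a, j)"
      using ij index_antidiag_mult[OF eigen_mat_carrier(1), of a m j, unfolded rev_conv] by simp
  qed
  also have "\<dots> = eigen_form m $$ (i, j)"
    using ij by (simp add: sum_eigen_mat eigen_gram eigen_form_def perm_mat_def)
  finally show "(transpose_mat (eigen_mat m) * (antidiag (2 * m + 4) * eigen_mat m)) $$ (i, j) = eigen_form m $$ (i, j)" .
qed (auto simp: eigen_form_def)

lemma eigen_form_facts:
  "transpose_mat (eigen_form m) = eigen_form m" "eigen_form m * eigen_form m = 1\<^sub>m (2 * m + 4)"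
  unfolding eigen_form_def using perm_mat_transpose[OF involution_eigen_dual] perm_mat_square[OF involution_eigen_dual] by auto

lemma eigen_inv_mult: "eigen_inv m * eigen_mat m = 1\<^sub>m (2 * m + 4)"
  "eigen_mat m * eigen_inv m = 1\<^sub>m (2 * m + 4)"
proof -
  let ?N = "2 * m + 4"
  have "eigen_inv m * eigen_mat m = eigen_form m * (transpose_mat (eigen_mat m) * (antidiag ?N * eigen_mat m))"
    by (simp add: eigen_inv_def assoc_mult_mat[of _ ?N ?N _ ?N _ ?N] mult_carrier_mat[of _ _ ?N])
  then show *: "eigen_inv m * eigen_mat m = 1\<^sub>m ?N"
    by (simp add: eigen_gram_mat eigen_form_facts)
  show "eigen_mat m * eigen_inv m = 1\<^sub>m ?N"
    using mat_mult_left_right_inverse[OF eigen_inv_carrier eigen_mat_carrier(1) *] .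
qed

text \<open>The congruence that \<open>conj_lie_iso\<close> asks for. The transpose of
  \<open>E * T^T * q\<close> is \<open>q * T * E\<close>; the two adjacent factors \<open>q\<close>
  cancel, then so do \<open>eigen_inv m\<close> and \<open>T\<close>, and \<open>E\<close>
  remains.\<close>

lemma eigen_inv_form: "eigen_inv m * antidiag (2 * m + 4) * transpose_mat (eigen_inv m) = eigen_form m"
proof -
  let ?N = "2 * m + 4"
  have t: "transpose_mat (eigen_inv m) = antidiag ?N * eigen_mat m * eigen_form m"
    unfolding eigen_inv_def
    by (simp add: transpose_mult[of _ ?N ?N _ ?N] mult_carrier_mat[of _ _ ?N] eigen_form_facts)
  have "eigen_inv m * antidiag ?N * (antidiag ?N * eigen_mat m * eigen_form m) =
      eigen_inv m * ((antidiag ?N * antidiag ?N) * eigen_mat m) * eigen_form m"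
    by (simp add: assoc_mult_mat[of _ ?N ?N _ ?N _ ?N] mult_carrier_mat[of _ _ ?N] del: antidiag_facts(3))
  also have "\<dots> = eigen_form m"
    by (simp add: eigen_inv_mult left_mult_one_mat[of _ "2 * m + 4" "2 * m + 4"])
  finally show ?thesis by (simp add: t)
qed

text \<open>Pairing with row \<open>i\<close> of \<open>eigen_inv m\<close>: the \<open>i\<close>-th
  coordinate in the eigenbasis is the value of \<open>q\<close> against the dual basis vector, and
  \<open>q\<close> acts by reversing the index.\<close>

definition eigen_cosum :: "nat \<Rightarrow> nat \<Rightarrow> (nat \<Rightarrow> complex) \<Rightarrow> complex"
  where "eigen_cosum m i f = eigen_sum m (eigen_dual m i) (\<lambda>a. f (2 * m + 3 - a))"

lemma eigen_cosum_simps: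
  "eigen_cosum m 0 f = (f 0 + f (Suc m) + f (m + 2) + f (2 * m + 3)) / 2"
  "k < m \<Longrightarrow> eigen_cosum m (Suc k) f = csqrt (1 / 2) * (f (Suc k) + f (m + 3 + k))"
  "eigen_cosum m (Suc m) f = (f 0 - f (Suc m) - f (m + 2) + f (2 * m + 3)) / 2"
  "k < m \<Longrightarrow> eigen_cosum m (m + 2 + k) f = \<i> * csqrt (1 / 2) * (f (m + 3 + k) - f (Suc k))"
  "eigen_cosum m (2 * m + 2) f = (\<i> * f (2 * m + 3) - f (m + 2) + f (Suc m) - \<i> * f 0) / 2"
  "eigen_cosum m (2 * m + 3) f = (\<i> * f (2 * m + 3) + f (m + 2) - f (Suc m) - \<i> * f 0) / 2"
proof -
  show "eigen_cosum m 0 f = (f 0 + f (Suc m) + f (m + 2) + f (2 * m + 3)) / 2"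
    "eigen_cosum m (Suc m) f = (f 0 - f (Suc m) - f (m + 2) + f (2 * m + 3)) / 2"
    "eigen_cosum m (2 * m + 2) f = (\<i> * f (2 * m + 3) - f (m + 2) + f (Suc m) - \<i> * f 0) / 2"
    "eigen_cosum m (2 * m + 3) f = (\<i> * f (2 * m + 3) + f (m + 2) - f (Suc m) - \<i> * f 0) / 2"
    unfolding eigen_cosum_def eigen_dual_simps eigen_sum_simps rev_index_simps by (simp_all only: algebra_simps)
  assume k: "k < m"
  define p where "p = m - Suc k"
  have p: "p < m" "m - Suc p = k" using k by (auto simp: p_def)
  show "eigen_cosum m (Suc k) f = csqrt (1 / 2) * (f (Suc k) + f (m + 3 + k))"
    "eigen_cosum m (m + 2 + k) f = \<i> * csqrt (1 / 2) * (f (m + 3 + k) - f (Suc k))"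
    unfolding eigen_cosum_def eigen_dual_simps(2,4)[OF k] p_def[symmetric] eigen_sum_simps(2,4)[OF p(1)]
      rev_index_simps(2,5)[OF p(1)] p(2) by (simp_all only: add.commute)
qed

section \<open>Matrices in the eigenbasis\<close>

definition to_eigen :: "nat \<Rightarrow> complex mat \<Rightarrow> complex mat"
  where "to_eigen m Z = eigen_inv m * Z * eigen_mat m"

lemma to_eigen_carrier [simp]: "to_eigen m Z \<in> carrier_mat (2 * m + 4) (2 * m + 4)"
  using carrier_matD(1)[OF eigen_inv_carrier] by (intro carrier_matI) (simp_all add: to_eigen_def)

lemma index_to_eigen:
  assumes Z: "Z \<in> carrier_mat (2 * m + 4) (2 * m + 4)" and ij: "i < 2 * m + 4" "j < 2 * m + 4"
  shows "to_eigen m Z $$ (i, j) = eigen_cosum m i (\<lambda>a. eigen_sum m j (\<lambda>b. Z $$ (a, b)))"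
proof -
  let ?N = "2 * m + 4"
  have d: "eigen_dual m i < ?N" using involution_belowD(1)[OF involution_eigen_dual ij(1)] .
  have inv: "eigen_inv m $$ (i, a) = eigen_mat m $$ (2 * m + 3 - a, eigen_dual m i)" if a: "a < ?N" for a
  proof -
    have "eigen_inv m $$ (i, a) = (transpose_mat (eigen_mat m) * antidiag ?N) $$ (eigen_dual m i, a)"
      unfolding eigen_inv_def eigen_form_def
      using ij(1) a d by (intro index_perm_mat_mult[where M = ?N] mult_carrier_mat[where n = ?N]) simp_all
    also have "\<dots> = transpose_mat (eigen_mat m) $$ (eigen_dual m i, ?N - 1 - a)"
      by (rule index_mult_antidiag[OF _ d a]) simp
    finally show ?thesis using a d unfolding rev_conv by simp
  qed
  have ZT: "(Z * eigen_mat m) $$ (a, j) = eigen_sum m j (\<lambda>b. Z $$ (a, b))" if a: "a < ?N" for a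
  proof -
    have "(Z * eigen_mat m) $$ (a, j) = (\<Sum>b = 0..<?N. Z $$ (a, b) * eigen_mat m $$ (b, j))"
      by (rule index_mult_mat_sum[OF Z eigen_mat_carrier(1) a ij(2)])
    also have "\<dots> = (\<Sum>b = 0..<?N. eigen_mat m $$ (b, j) * Z $$ (a, b))"
      by (simp only: mult.commute)
    finally show ?thesis unfolding sum_eigen_mat[OF ij(2)] .
  qed
  have ZTc: "Z * eigen_mat m \<in> carrier_mat ?N ?N" using Z by (intro mult_carrier_mat) auto
  have "to_eigen m Z = eigen_inv m * (Z * eigen_mat m)"
    unfolding to_eigen_def by (rule assoc_mult_mat[OF eigen_inv_carrier Z eigen_mat_carrier(1)])
  then have "to_eigen m Z $$ (i, j) = (\<Sum>a = 0..<?N. eigen_inv m $$ (i, a) * (Z * eigen_mat m) $$ (a, j))"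
    using index_mult_mat_sum[OF eigen_inv_carrier ZTc ij] by simp
  also have "\<dots> = (\<Sum>a = 0..<?N. eigen_mat m $$ (2 * m + 3 - a, eigen_dual m i) * eigen_sum m j (\<lambda>b. Z $$ (a, b)))"
    by (rule sum.cong[OF refl]) (simp only: inv ZT atLeastLessThan_iff)
  \<comment> \<open>Reversing the summation moves the reflection from the basis vector to the row
    index of \<open>Z\<close>, the shape of \<open>eigen_cosum\<close>.\<close>
  also have "\<dots> = (\<Sum>a = 0..<?N. eigen_mat m $$ (a, eigen_dual m i) * eigen_sum m j (\<lambda>b. Z $$ (2 * m + 3 - a, b)))"
    by (rule sum_rev_index[of "\<lambda>a' a. eigen_mat m $$ (a', eigen_dual m i) * eigen_sum m j (\<lambda>b. Z $$ (a, b))"])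
  also have "\<dots> = eigen_cosum m i (\<lambda>a. eigen_sum m j (\<lambda>b. Z $$ (a, b)))"
    unfolding eigen_cosum_def by (rule sum_eigen_mat[OF d])
  finally show ?thesis .
qed

lemma to_eigen_lie_iso: "to_eigen m \<in> lie_iso CC (\<gg> (m + 2)) (so_form (2 * m + 4) (eigen_form m))"
  using conj_lie_iso[OF eigen_inv_carrier eigen_mat_carrier(1) _ eigen_inv_mult eigen_inv_form]
  by (simp add: to_eigen_def[abs_def] \<gg>_conv)

lemma to_eigen_bracket:
  assumes "Z \<in> carrier_mat (2 * m + 4) (2 * m + 4)" "W \<in> carrier_mat (2 * m + 4) (2 * m + 4)"
  shows "to_eigen m (Z * W - W * Z) = to_eigen m Z * to_eigen m W - to_eigen m W * to_eigen m Z"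
  unfolding to_eigen_def conj_mult[OF eigen_inv_carrier eigen_mat_carrier(1) eigen_inv_mult(2) assms]
    conj_mult[OF eigen_inv_carrier eigen_mat_carrier(1) eigen_inv_mult(2) assms(2,1)]
  using assms by (simp add: minus_mult_distrib_mat[of _ "2 * m + 4" "2 * m + 4" _ _ "2 * m + 4"] mult_minus_distrib_mat[of _ "2 * m + 4" "2 * m + 4" _ "2 * m + 4"] mult_carrier_mat[of _ _ "2 * m + 4"])

lemma to_eigen_inj:
  assumes "Z \<in> carrier_mat (2 * m + 4) (2 * m + 4)" "W \<in> carrier_mat (2 * m + 4) (2 * m + 4)"
    "to_eigen m Z = to_eigen m W"
  shows "Z = W"
proof -
  have *: "eigen_mat m * to_eigen m X * eigen_inv m = X" if "X \<in> carrier_mat (2 * m + 4) (2 * m + 4)" for X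
    unfolding to_eigen_def
    by (rule conj_conj[OF eigen_inv_carrier eigen_mat_carrier(1) eigen_inv_mult(2) that])
  show ?thesis using *[OF assms(1)] *[OF assms(2)] assms(3) by metis
qed

text \<open>\<open>eigenvalue m j\<close> belongs to column \<open>j\<close> of \<open>eigen_mat m\<close>.\<close>

definition eigenvalue :: "nat \<Rightarrow> nat \<Rightarrow> complex"
  where "eigenvalue m j = (if j \<le> m then 1 else if j \<le> 2 * m + 1 then - 1 else if j = 2 * m + 2 then \<i> else - \<i>)"

lemma eigenvalue_simps:
  "eigenvalue m 0 = 1" "k < m \<Longrightarrow> eigenvalue m (Suc k) = 1" "eigenvalue m (Suc m) = - 1"
  "k < m \<Longrightarrow> eigenvalue m (m + 2 + k) = - 1" "eigenvalue m (2 * m + 2) = \<i>" "eigenvalue m (2 * m + 3) = - \<i>"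
  by (auto simp: eigenvalue_def)

text \<open>The eigenvector equation in dual form. Along the 4-cycle the coefficients are a
  geometric progression whose ratio is the inverse eigenvalue; on each transposition they are equal
  or opposite.\<close>

lemma eigen_sum_\<sigma>\<^sub>0:
  assumes "j < 2 * m + 4"
  shows "eigen_sum m j (\<lambda>b. f (\<sigma>\<^sub>0 m b)) = eigenvalue m j * eigen_sum m j f"
  using assms
  by (cases rule: index_cases)
    (simp_all only: eigen_sum_simps eigenvalue_simps \<sigma>\<^sub>0_simps, simp_all add: algebra_simps add_divide_distrib diff_divide_distrib)

lemma eigenvalue_dual:
  assumes "i < 2 * m + 4"
  shows "eigenvalue m (eigen_dual m i) * eigenvalue m i = 1"
  using assms by (cases rule: index_cases) (simp_all only: eigenvalue_simps eigen_dual_simps, simp_all add: eigenvalue_simps)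

lemma index_to_eigen_lam:
  assumes Z: "Z \<in> carrier_mat (2 * m + 4) (2 * m + 4)" and ij: "i < 2 * m + 4" "j < 2 * m + 4"
  shows "to_eigen m (lam (m + 2) Z) $$ (i, j) = eigenvalue m i / eigenvalue m j * to_eigen m Z $$ (i, j)"
proof -
  let ?N = "2 * m + 4"
  have L: "lam (m + 2) Z \<in> carrier_mat ?N ?N" by (intro carrier_matI) (simp_all add: lam_eq[OF Z])
  have d: "eigen_dual m i < ?N" using involution_belowD(1)[OF involution_eigen_dual ij(1)] .
  let ?L = "\<lambda>a b. lam (m + 2) Z $$ (a, b)"
  have "to_eigen m Z $$ (i, j) = eigen_sum m (eigen_dual m i) (\<lambda>a. eigen_sum m j (\<lambda>b. Z $$ (2 * m + 3 - a, b)))"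
    unfolding index_to_eigen[OF Z ij] eigen_cosum_def ..
  \<comment> \<open>Entries of \<open>Z\<close> are rewritten as entries of
    \<open>lam (m + 2) Z\<close> at permuted positions. Because \<sigma> commutes with the reversal,
    both arguments appear as functions of permuted indices, and the eigenvector equation applies to
    rows and columns.\<close>
  also have "\<dots> = eigen_sum m (eigen_dual m i) (\<lambda>a. eigen_sum m j (\<lambda>b. ?L (2 * m + 3 - \<sigma>\<^sub>0 m a) (\<sigma>\<^sub>0 m b)))"
  proof (intro eigen_sum_cong d ij)
    fix a b assume ab: "a < ?N" "b < ?N"
    then have "2 * m + 3 - a < ?N" by simp
    then show "Z $$ (2 * m + 3 - a, b) = ?L (2 * m + 3 - \<sigma>\<^sub>0 m a) (\<sigma>\<^sub>0 m b)"
      unfolding \<sigma>\<^sub>0_rev[OF ab(1), symmetric] using index_lam[OF Z _ ab(2)] by simp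
  qed
  also have "\<dots> = eigenvalue m (eigen_dual m i) * eigen_sum m (eigen_dual m i) (\<lambda>a. eigen_sum m j (\<lambda>b. ?L (2 * m + 3 - a) (\<sigma>\<^sub>0 m b)))"
    by (rule eigen_sum_\<sigma>\<^sub>0[OF d])
  also have "\<dots> = eigenvalue m (eigen_dual m i) * (eigen_sum m (eigen_dual m i) (\<lambda>a. eigen_sum m j (\<lambda>b. ?L (2 * m + 3 - a) b)) * eigenvalue m j)"
  proof -
    have "eigen_sum m j (\<lambda>b. ?L c (\<sigma>\<^sub>0 m b)) = eigen_sum m j (\<lambda>b. ?L c b) * eigenvalue m j" for c
      using eigen_sum_\<sigma>\<^sub>0[OF ij(2), of "?L c"] by (simp only: mult.commute)
    then show ?thesis by (simp only: eigen_sum_mult_right)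
  qed
  also have "\<dots> = eigenvalue m (eigen_dual m i) * (to_eigen m (lam (m + 2) Z) $$ (i, j) * eigenvalue m j)"
    unfolding index_to_eigen[OF L ij] eigen_cosum_def ..
  finally have *: "to_eigen m Z $$ (i, j) = eigenvalue m (eigen_dual m i) * (to_eigen m (lam (m + 2) Z) $$ (i, j) * eigenvalue m j)" .
  have "eigenvalue m j \<noteq> 0" using eigenvalue_dual[OF ij(2)] by auto
  \<comment> \<open>The row factor found above belongs to the dual index and is the inverse of
    \<open>eigenvalue m i\<close>, so it changes sides.\<close>
  then have "eigenvalue m i / eigenvalue m j * to_eigen m Z $$ (i, j) =
      (eigenvalue m (eigen_dual m i) * eigenvalue m i) * to_eigen m (lam (m + 2) Z) $$ (i, j)"
    unfolding * by (simp add: field_simps)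
  then show ?thesis using eigenvalue_dual[OF ij(1)] by simp
qed

section \<open>The grading\<close>

abbreviation eigen_skew :: "nat \<Rightarrow> (nat \<times> nat) set \<Rightarrow> complex mat set"
  where "eigen_skew m \<equiv> skew_on (2 * m + 4) (eigen_dual m)"

lemma eigen_skew_mono: "R \<subseteq> R' \<Longrightarrow> eigen_skew m R \<subseteq> eigen_skew m R'"
  unfolding skew_on_def by blast

lemma so_form_eigen_carrier: "carrier (so_form (2 * m + 4) (eigen_form m)) = eigen_skew m UNIV"
  unfolding eigen_form_def by (rule so_form_perm_mat_carrier[OF involution_eigen_dual])

text \<open>A nonzero entry of a product needs an intermediate index, so supports compose as
  relations. Closure under brackets thereby becomes an inclusion between sets of positions.\<close>

lemma eigen_skew_bracket:
  assumes A: "A \<in> eigen_skew m R" and B: "B \<in> eigen_skew m S"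
  shows "A * B - B * A \<in> eigen_skew m (R O S \<union> S O R)"
proof -
  let ?N = "2 * m + 4"
  have c: "A \<in> carrier_mat ?N ?N" "B \<in> carrier_mat ?N ?N" using A B by (auto dest: skew_onD(1))
  have prod: "(X * Y) $$ (i, j) = 0"
    if X: "X \<in> eigen_skew m P" and Y: "Y \<in> eigen_skew m Q" and ij: "i < ?N" "j < ?N" "(i, j) \<notin> P O Q" for X Y P Q i j
  proof -
    have "X $$ (i, a) * Y $$ (a, j) = 0" if "a < ?N" for a
    proof (cases "(i, a) \<in> P")
      case True
      then have "(a, j) \<notin> Q" using ij by blast
      then show ?thesis using skew_onD(3)[OF Y that ij(2)] by simp
    next
      case False
      then show ?thesis using skew_onD(3)[OF X ij(1) that] by simp
    qed
    then have "(\<Sum>a = 0..<?N. X $$ (i, a) * Y $$ (a, j)) = 0" by (intro sum.neutral) simp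
    then show ?thesis
      using index_mult_mat_sum[OF skew_onD(1)[OF X] skew_onD(1)[OF Y] ij(1,2)] by (simp only:)
  qed
  have "A * B - B * A \<in> eigen_skew m UNIV"
    using so_form_bracket[of "eigen_form m" ?N A B] A B eigen_skew_mono[of R UNIV m] eigen_skew_mono[of S UNIV m]
    unfolding so_form_eigen_carrier by auto
  moreover have "(A * B - B * A) $$ (i, j) = 0" if "i < ?N" "j < ?N" "(i, j) \<notin> R O S \<union> S O R" for i j
  proof -
    have "(A * B) $$ (i, j) = 0" "(B * A) $$ (i, j) = 0" using prod[OF A B] prod[OF B A] that by auto
    then show ?thesis using that c by (simp del: index_mult_mat(1))
  qed
  ultimately show ?thesis unfolding skew_on_def by blast
qed

definition eigen_pre :: "nat \<Rightarrow> complex mat set \<Rightarrow> complex mat set"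
  where "eigen_pre m W = {Z \<in> carrier (\<gg> (m + 2)). to_eigen m Z \<in> W}"

lemma \<gg>_carrierD: "Z \<in> carrier (\<gg> (m + 2)) \<Longrightarrow> Z \<in> carrier_mat (2 * m + 4) (2 * m + 4)"
  unfolding \<gg>_carrier_conv by (rule skew_onD(1))

lemma \<gg>_update: "\<gg> (m + 2)\<lparr>carrier := C\<rparr> = gl_on (2 * m + 4) C"
  by (simp add: \<gg>_conv so_form_def)

lemma \<gg>_update_self: "\<gg> (m + 2) = gl_on (2 * m + 4) (carrier (\<gg> (m + 2)))"
  by (simp add: \<gg>_conv so_form_def)

lemma \<gg>_bracket: "lie_bracket (\<gg> (m + 2)) = lie_bracket (gl (2 * m + 4))"
  by (simp add: \<gg>_conv so_form_def)

lemma \<gg>_submodule: "submodule CC (carrier (\<gg> (m + 2))) (gl (2 * m + 4))"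
  unfolding \<gg>_conv by (rule so_form_submodule) simp

lemma to_eigen_bij: "bij_betw (to_eigen m) (carrier (\<gg> (m + 2))) (eigen_skew m UNIV)"
  using to_eigen_lie_iso unfolding lie_iso_def so_form_eigen_carrier by blast

lemma to_eigen_add:
  assumes "Z \<in> carrier (\<gg> (m + 2))" "W \<in> carrier (\<gg> (m + 2))"
  shows "to_eigen m (Z + W) = to_eigen m Z + to_eigen m W"
  using to_eigen_lie_iso[of m] assms unfolding lie_iso_def LinearCombinations.module_hom_def
  by (simp add: \<gg>_conv so_form_def gl_simps)

lemma to_eigen_smult:
  assumes "Z \<in> carrier (\<gg> (m + 2))"
  shows "to_eigen m (c \<cdot>\<^sub>m Z) = c \<cdot>\<^sub>m to_eigen m Z"
  using to_eigen_lie_iso[of m] assms unfolding lie_iso_def LinearCombinations.module_hom_def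
  by (simp add: \<gg>_conv so_form_def gl_simps)

lemma eigen_pre_bij:
  assumes "W \<subseteq> eigen_skew m UNIV"
  shows "bij_betw (to_eigen m) (eigen_pre m W) W"
proof -
  have "to_eigen m ` eigen_pre m W = W"
  proof (intro equalityI subsetI)
    fix w assume w: "w \<in> W"
    then have "w \<in> to_eigen m ` carrier (\<gg> (m + 2))"
      using assms to_eigen_bij[of m] unfolding bij_betw_def by blast
    then show "w \<in> to_eigen m ` eigen_pre m W" using w unfolding eigen_pre_def by blast
  qed (auto simp: eigen_pre_def)
  moreover have "inj_on (to_eigen m) (eigen_pre m W)"
    using to_eigen_bij[of m] unfolding bij_betw_def eigen_pre_def by (auto intro: inj_on_subset)
  ultimately show ?thesis unfolding bij_betw_def by blast
qed

lemma eigen_pre_submodule: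
  assumes "submodule CC W (gl (2 * m + 4))"
  shows "submodule CC (eigen_pre m W) (gl (2 * m + 4))"
proof -
  note W = gl_submoduleD[OF assms] and G = gl_submoduleD[OF \<gg>_submodule[of m]]
  have "to_eigen m (0\<^sub>m (2 * m + 4) (2 * m + 4)) = to_eigen m (0 \<cdot>\<^sub>m 0\<^sub>m (2 * m + 4) (2 * m + 4))" by simp
  also have "\<dots> = 0 \<cdot>\<^sub>m to_eigen m (0\<^sub>m (2 * m + 4) (2 * m + 4))" by (rule to_eigen_smult[OF G(2)])
  also have "\<dots> = 0\<^sub>m (2 * m + 4) (2 * m + 4)"
    using carrier_matD[OF to_eigen_carrier[of m "0\<^sub>m (2 * m + 4) (2 * m + 4)"]] by (intro eq_matI) simp_all
  finally have "to_eigen m (0\<^sub>m (2 * m + 4) (2 * m + 4)) = 0\<^sub>m (2 * m + 4) (2 * m + 4)" .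
  then show ?thesis
    using W(2-4) G by (intro gl_submoduleI) (auto simp: eigen_pre_def to_eigen_add to_eigen_smult)
qed

lemma eigen_pre_hom:
  "to_eigen m \<in> lin_hom CC (gl_on (2 * m + 4) (eigen_pre m W)) (gl_on (2 * m + 4) W)"
  unfolding gl_sub_hom_iff by (simp add: eigen_pre_def to_eigen_add to_eigen_smult)

lemma eigen_pre_bracket:
  assumes "\<And>A B. A \<in> U \<Longrightarrow> B \<in> V \<Longrightarrow> A * B - B * A \<in> W" "A \<in> eigen_pre m U" "B \<in> eigen_pre m V"
  shows "A * B - B * A \<in> eigen_pre m W"
proof -
  have AB: "A \<in> carrier (\<gg> (m + 2))" "B \<in> carrier (\<gg> (m + 2))" "to_eigen m A \<in> U" "to_eigen m B \<in> V"
    using assms(2,3) by (auto simp: eigen_pre_def)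
  have "A * B - B * A \<in> carrier (\<gg> (m + 2))"
    using so_form_bracket[OF antidiag_facts(1)] AB(1,2) unfolding \<gg>_conv by blast
  then show ?thesis
    using assms(1)[OF AB(3,4)] to_eigen_bracket[OF \<gg>_carrierD[OF AB(1)] \<gg>_carrierD[OF AB(2)]]
    by (simp add: eigen_pre_def)
qed

lemma eigenvalue_cases:
  assumes "i < 2 * m + 4"
  obtains "i < m + 1" "eigenvalue m i = 1" | "m + 1 \<le> i" "i < 2 * m + 2" "eigenvalue m i = - 1"
    | "i = 2 * m + 2" "eigenvalue m i = \<i>" | "i = 2 * m + 3" "eigenvalue m i = - \<i>"
proof (cases "i < m + 1")
  case True
  then show ?thesis using that(1) by (simp add: eigenvalue_def)
next
  case F: False
  show ?thesis
  proof (cases "i < 2 * m + 2")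
    case True
    then show ?thesis using that(2) F by (simp add: eigenvalue_def)
  next
    case False
    then have "i = 2 * m + 2 \<or> i = 2 * m + 3" using assms by arith
    then show ?thesis using that(3,4) by (auto simp: eigenvalue_simps)
  qed
qed

lemma eigenvalue_nonzero: "eigenvalue m i \<noteq> 0"
  by (simp add: eigenvalue_def)

lemma eigenvalue_power4: "eigenvalue m i ^ 4 = 1"
  by (simp add: eigenvalue_def)

text \<open>The positions at which the factor \<open>eigenvalue m i / eigenvalue m j\<close> of
  \<open>index_to_eigen_lam\<close> is \<open>\<i> ^ k\<close>, stated without division.\<close>

definition grade_support :: "nat \<Rightarrow> nat \<Rightarrow> (nat \<times> nat) set"
  where "grade_support m k = {(i, j). eigenvalue m i = \<i> ^ k * eigenvalue m j}"

text \<open>Dual indices have inverse eigenvalues, and transposing the position inverts the quotient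
  once more.\<close>

lemma grade_support_dual:
  assumes "i < 2 * m + 4" "j < 2 * m + 4"
  shows "(eigen_dual m j, eigen_dual m i) \<in> grade_support m k \<longleftrightarrow> (i, j) \<in> grade_support m k"
proof -
  have "eigenvalue m (eigen_dual m l) = inverse (eigenvalue m l)" if "l < 2 * m + 4" for l
    using eigenvalue_dual[OF that] inverse_unique[of "eigenvalue m l" "eigenvalue m (eigen_dual m l)"] by (simp add: mult.commute)
  then show ?thesis
    using assms eigenvalue_nonzero[of m i] eigenvalue_nonzero[of m j]
    by (auto simp: grade_support_def field_simps)
qed

lemma grade_conv: "grade (m + 2) k = eigen_pre m (eigen_skew m (grade_support m k))"
proof -
  let ?N = "2 * m + 4"
  have "lam (m + 2) Z = \<i> ^ k \<cdot>\<^sub>m Z \<longleftrightarrow> to_eigen m Z \<in> eigen_skew m (grade_support m k)"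
    if Z: "Z \<in> carrier (\<gg> (m + 2))" for Z
  proof -
    let ?W = "to_eigen m Z"
    have Zc: "Z \<in> carrier_mat ?N ?N" by (rule \<gg>_carrierD[OF Z])
    have L: "lam (m + 2) Z \<in> carrier_mat ?N ?N" by (intro carrier_matI) (simp_all add: lam_eq[OF Zc])
    have W: "?W \<in> eigen_skew m UNIV" using to_eigen_bij[of m] Z unfolding bij_betw_def by blast
    have "lam (m + 2) Z = \<i> ^ k \<cdot>\<^sub>m Z \<longleftrightarrow> to_eigen m (lam (m + 2) Z) = to_eigen m (\<i> ^ k \<cdot>\<^sub>m Z)"
      using to_eigen_inj[OF L, of "\<i> ^ k \<cdot>\<^sub>m Z"] Zc by auto
    also have "\<dots> \<longleftrightarrow> to_eigen m (lam (m + 2) Z) = \<i> ^ k \<cdot>\<^sub>m ?W"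
      by (simp only: to_eigen_smult[OF Z])
    also have "\<dots> \<longleftrightarrow> (\<forall>i<?N. \<forall>j<?N. eigenvalue m i / eigenvalue m j * ?W $$ (i, j) = \<i> ^ k * ?W $$ (i, j))"
      using carrier_matD[OF to_eigen_carrier[of m Z]] carrier_matD[OF to_eigen_carrier[of m "lam (m + 2) Z"]]
      by (simp add: mat_eq_iff index_to_eigen_lam[OF Zc])
    also have "\<dots> \<longleftrightarrow> (\<forall>i<?N. \<forall>j<?N. (i, j) \<notin> grade_support m k \<longrightarrow> ?W $$ (i, j) = 0)"
      using eigenvalue_nonzero[of m] by (auto simp: grade_support_def field_simps)
    also have "\<dots> \<longleftrightarrow> ?W \<in> eigen_skew m (grade_support m k)"
      using W unfolding skew_on_def by blast
    finally show ?thesis .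
  qed
  then show ?thesis by (auto simp: grade_def eigen_pre_def)
qed

lemma grade_submodule: "submodule CC (grade (m + 2) k) (gl (2 * m + 4))"
  unfolding grade_conv by (intro eigen_pre_submodule skew_on_submodule involution_eigen_dual)

lemma \<i>_powers: "\<i> ^ 0 = 1" "\<i> ^ 1 = \<i>" "\<i> ^ 2 = - 1" "\<i> ^ 3 = - \<i>"
  by (simp_all add: eval_nat_numeral)

section \<open>The order of the automorphism\<close>

lemma lam_has_order: "has_order_on (lam (m + 2)) (carrier (\<gg> (m + 2))) 4"
proof -
  let ?N = "2 * m + 4"
  have lamc: "lam (m + 2) Z \<in> carrier (\<gg> (m + 2))" if "Z \<in> carrier (\<gg> (m + 2))" for Z
    using lam_lie_iso[of m] that unfolding lie_iso_def bij_betw_def by blast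
  have pow: "(lam (m + 2) ^^ p) Z \<in> carrier (\<gg> (m + 2)) \<and>
      (\<forall>i<?N. \<forall>j<?N. to_eigen m ((lam (m + 2) ^^ p) Z) $$ (i, j) = (eigenvalue m i / eigenvalue m j) ^ p * to_eigen m Z $$ (i, j))"
    if "Z \<in> carrier (\<gg> (m + 2))" for Z p
  proof (induction p)
    case (Suc p)
    then show ?case
      using lamc index_to_eigen_lam[OF \<gg>_carrierD[of "(lam (m + 2) ^^ p) Z" m]] by (simp add: mult.assoc)
  qed (use that in simp)
  have "(lam (m + 2) ^^ 4) Z = Z" if Z: "Z \<in> carrier (\<gg> (m + 2))" for Z
  proof (rule to_eigen_inj)
    show "(lam (m + 2) ^^ 4) Z \<in> carrier_mat ?N ?N" using pow[OF Z, of 4] \<gg>_carrierD by blast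
    show "to_eigen m ((lam (m + 2) ^^ 4) Z) = to_eigen m Z"
      using carrier_matD[OF to_eigen_carrier[of m Z]] carrier_matD[OF to_eigen_carrier[of m "(lam (m + 2) ^^ 4) Z"]] pow[OF Z, of 4]
      by (intro eq_matI) (auto simp: power_divide eigenvalue_power4)
  qed (rule \<gg>_carrierD[OF Z])
  moreover have "\<exists>Z\<in>carrier (\<gg> (m + 2)). (lam (m + 2) ^^ p) Z \<noteq> Z" if p: "0 < p" "p < 4" for p
  proof -
    \<comment> \<open>An entry between the eigenvalues 1 and \<i> is scaled by
      \<open>1 / \<i>\<close>, which has exact order 4, so one matrix refutes all smaller exponents.
      The second entry, at \<open>(2 * m + 3, 0)\<close>, is forced by skewness.\<close>
    define W :: "complex mat" where "W = mat ?N ?N (\<lambda>(i, j). if i = 0 \<and> j = 2 * m + 2 then 1 else if i = 2 * m + 3 \<and> j = 0 then - 1 else 0)"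
    have d: "eigen_dual m i = 0 \<longleftrightarrow> i = 0" "eigen_dual m i = 2 * m + 2 \<longleftrightarrow> i = 2 * m + 3"
      "eigen_dual m i = 2 * m + 3 \<longleftrightarrow> i = 2 * m + 2" if "i < ?N" for i
      by (rule index_cases[OF that]; simp only: eigen_dual_simps; arith)+
    have w: "W $$ (i, j) = (if i = 0 \<and> j = 2 * m + 2 then 1 else if i = 2 * m + 3 \<and> j = 0 then - 1 else 0)"
      if "i < ?N" "j < ?N" for i j
      unfolding W_def using that by simp
    have "W $$ (i, j) = - W $$ (eigen_dual m j, eigen_dual m i)" if ij: "i < ?N" "j < ?N" for i j
      unfolding w[OF ij] w[OF involution_belowD(1)[OF involution_eigen_dual ij(2)] involution_belowD(1)[OF involution_eigen_dual ij(1)]]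
        d[OF ij(1)] d[OF ij(2)]
      by (cases "i = 0"; cases "j = 0"; cases "i = 2 * m + 3"; cases "j = 2 * m + 2") simp_all
    moreover have "W \<in> carrier_mat ?N ?N" by (simp add: W_def)
    ultimately have "W \<in> eigen_skew m UNIV" unfolding skew_on_def by blast
    then have "W \<in> to_eigen m ` carrier (\<gg> (m + 2))"
      using bij_betw_imp_surj_on[OF to_eigen_bij[of m]] by (simp only:)
    then obtain Z where Z: "Z \<in> carrier (\<gg> (m + 2))" "to_eigen m Z = W"
      by (elim imageE) simp
    have p': "p = 1 \<or> p = 2 \<or> p = 3" using p by arith
    have w0: "W $$ (0, 2 * m + 2) = 1" by (subst w) simp_all
    have "to_eigen m ((lam (m + 2) ^^ p) Z) $$ (0, 2 * m + 2) = (eigenvalue m 0 / eigenvalue m (2 * m + 2)) ^ p * W $$ (0, 2 * m + 2)"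
      using pow[OF Z(1), of p, THEN conjunct2, rule_format, of 0 "2 * m + 2"] unfolding Z(2) by simp
    also have "\<dots> = (1 / \<i>) ^ p" unfolding w0 eigenvalue_simps by simp
    also have "\<dots> \<noteq> W $$ (0, 2 * m + 2)"
      unfolding w0 using p' by (auto simp: complex_eq_iff eval_nat_numeral)
    finally have "(lam (m + 2) ^^ p) Z \<noteq> Z" using Z(2) by auto
    then show ?thesis using Z(1) by blast
  qed
  ultimately show ?thesis by (simp add: has_order_on_def)
qed

section \<open>The direct sum of the grades\<close>

definition mask :: "nat \<Rightarrow> (nat \<times> nat) set \<Rightarrow> complex mat \<Rightarrow> complex mat"
  where "mask N R v = mat N N (\<lambda>(i, j). if (i, j) \<in> R then v $$ (i, j) else 0)"

lemma mask_skew_on: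
  assumes \<pi>: "involution_below N \<pi>" and v: "v \<in> skew_on N \<pi> S"
    and R: "\<And>i j. i < N \<Longrightarrow> j < N \<Longrightarrow> (\<pi> j, \<pi> i) \<in> R \<longleftrightarrow> (i, j) \<in> R"
  shows "mask N R v \<in> skew_on N \<pi> R"
proof -
  have "mask N R v $$ (i, j) = - mask N R v $$ (\<pi> j, \<pi> i)" if ij: "i < N" "j < N" for i j
    using ij R[OF ij] skew_onD(2)[OF v ij] involution_belowD(1)[OF \<pi>] by (simp add: mask_def)
  moreover have "mask N R v $$ (i, j) = 0" if "i < N" "j < N" "(i, j) \<notin> R" for i j
    using that by (simp add: mask_def)
  moreover have "mask N R v \<in> carrier_mat N N" by (simp add: mask_def)
  ultimately show ?thesis unfolding skew_on_def by blast
qed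

lemma mask_add:
  assumes "v \<in> carrier_mat N N" "w \<in> carrier_mat N N"
  shows "mask N R (v + w) = mask N R v + mask N R w"
  using assms by (intro eq_matI) (auto simp: mask_def)

lemma mask_self:
  assumes "v \<in> skew_on N \<pi> R"
  shows "mask N R v = v"
  using skew_onD(1,3)[OF assms] by (intro eq_matI) (auto simp: mask_def)

lemma mask_disjoint:
  assumes "v \<in> skew_on N \<pi> R" "\<And>i j. i < N \<Longrightarrow> j < N \<Longrightarrow> (i, j) \<in> R \<Longrightarrow> (i, j) \<notin> S"
  shows "mask N S v = 0\<^sub>m N N"
  using skew_onD(1,3)[OF assms(1)] assms(2) by (intro eq_matI) (auto simp: mask_def)

text \<open>All eigenvalues, hence all their quotients, are fourth roots of unity, so each position
  lies in exactly one of the four supports.\<close>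

lemma grade_support_partition:
  assumes "i < 2 * m + 4" "j < 2 * m + 4"
  shows "(\<Sum>k\<in>{0, 1, 2, 3}. if (i, j) \<in> grade_support m k then c else 0) = (c :: complex)"
  by (rule eigenvalue_cases[OF assms(1)]; rule eigenvalue_cases[OF assms(2)];
    simp add: grade_support_def \<i>_powers complex_eq_iff)

lemma grade_support_disjoint:
  assumes "k \<in> {0, 1, 2, 3}" "l \<in> {0, 1, 2, 3}" "k \<noteq> l" "(i, j) \<in> grade_support m k"
  shows "(i, j) \<notin> grade_support m l"
proof
  assume "(i, j) \<in> grade_support m l"
  then have "\<i> ^ k * eigenvalue m j = \<i> ^ l * eigenvalue m j"
    using assms(4) unfolding grade_support_def mem_Collect_eq prod.case by metis
  then have "\<i> ^ k = \<i> ^ l" using eigenvalue_nonzero[of m j] by (metis mult_right_cancel)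
  then show False using assms(1-3) by (auto simp: \<i>_powers complex_eq_iff)
qed

lemma grade_internal_direct_sum: "internal_direct_sum CC (\<gg> (m + 2)) {0, 1, 2, 3} (grade (m + 2))"
proof -
  let ?N = "2 * m + 4"
  let ?W = "\<lambda>k. eigen_skew m (grade_support m k)"
  have sub: "submodule CC (eigen_skew m R) (gl ?N)" for R
    by (rule skew_on_submodule[OF involution_eigen_dual])
  have model: "internal_direct_sum CC (gl_on ?N (eigen_skew m UNIV)) {0, 1, 2, 3} ?W"
  proof (rule gl_sub_internal_direct_sumI[where p = "\<lambda>k. mask ?N (grade_support m k)"], goal_cases)
    case (5 k v)
    show ?case by (rule mask_skew_on[OF involution_eigen_dual 5(2) grade_support_dual])
  next
    case (6 k v w)
    then show ?case using skew_onD(1) by (intro mask_add) blast+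
  next
    case (7 k v)
    then show ?case by (intro mask_self)
  next
    case (8 k l v)
    show ?case by (rule mask_disjoint[OF 8(4)]) (rule grade_support_disjoint[OF 8(1-3)])
  next
    case (9 v a b)
    then have "(\<Sum>k\<in>{0, 1, 2, 3}. mask ?N (grade_support m k) v $$ (a, b)) =
        (\<Sum>k\<in>{0, 1, 2, 3}. if (a, b) \<in> grade_support m k then v $$ (a, b) else 0)"
      by (intro sum.cong refl) (simp add: mask_def)
    then show ?case using grade_support_partition[OF 9(2,3)] by simp
  next
    case (4 k)
    show ?case by (rule eigen_skew_mono) simp
  qed (simp_all add: sub)
  have "internal_direct_sum CC (gl_on ?N (carrier (\<gg> (m + 2)))) {0, 1, 2, 3} (grade (m + 2))"
  proof (rule gl_sub_internal_direct_sum_transport[OF \<gg>_submodule sub _ _ _ _ model])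
    show "to_eigen m \<in> lin_hom CC (gl_on ?N (carrier (\<gg> (m + 2)))) (gl_on ?N (eigen_skew m UNIV))"
      unfolding gl_sub_hom_iff using to_eigen_bij[of m] by (auto simp: to_eigen_add to_eigen_smult bij_betw_def)
    show "submodule CC (grade (m + 2) k) (gl ?N)" for k by (rule grade_submodule)
    show "bij_betw (to_eigen m) (carrier (\<gg> (m + 2))) (eigen_skew m UNIV)" by (rule to_eigen_bij)
    show "grade (m + 2) k = {Z \<in> carrier (\<gg> (m + 2)). to_eigen m Z \<in> ?W k}" for k
      by (simp only: grade_conv eigen_pre_def)
  qed
  then show ?thesis using \<gg>_update_self by simp
qed

section \<open>Dimensions of the grades\<close>

lemma \<gg>_grade_conv: "\<gg>_grade (m + 2) k = gl_on (2 * m + 4) (eigen_pre m (eigen_skew m (grade_support m k)))"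
  unfolding \<gg>_grade_def grade_conv \<gg>_update ..

lemma eigen_pre_has_dim:
  assumes R: "\<And>i j. i < 2 * m + 4 \<Longrightarrow> j < 2 * m + 4 \<Longrightarrow> (i, j) \<in> R \<Longrightarrow> (eigen_dual m j, eigen_dual m i) \<in> R"
    and d: "card {(i, k). i < k \<and> k < 2 * m + 4 \<and> (i, eigen_dual m k) \<in> R} = d"
  shows "has_dim CC (gl_on (2 * m + 4) (eigen_pre m (eigen_skew m R))) d"
proof -
  let ?N = "2 * m + 4" and ?V = "eigen_pre m (eigen_skew m R)"
  obtain f where f: "f \<in> lin_hom CC (gl_on ?N (eigen_skew m R)) (module_vec TYPE(complex) d)"
    "bij_betw f (eigen_skew m R) (carrier_vec d)"
    by (rule skew_on_has_coords[OF involution_eigen_dual R d])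
  have bij: "bij_betw (to_eigen m) ?V (eigen_skew m R)"
    by (rule eigen_pre_bij) (simp add: eigen_skew_mono)
  show ?thesis
  proof (rule has_dim_vec)
    show "vectorspace CC (gl_on ?N ?V)"
      by (intro gl_sub_vectorspace eigen_pre_submodule skew_on_submodule involution_eigen_dual)
    have "f \<circ> to_eigen m \<in> lin_hom CC (gl_on ?N ?V) (module_vec TYPE(complex) d)"
      by (rule module_hom_comp[OF eigen_pre_hom f(1)])
    then show "f \<circ> to_eigen m \<in> lin_hom CC (gl_on ?N ?V) (module_vec TYPE(complex) d)" .
    show "bij_betw (f \<circ> to_eigen m) (carrier (gl_on ?N ?V)) (carrier_vec d)"
      using bij_betw_trans[OF bij f(2)] by simp
  qed
qed

text \<open>The position that belongs to the pair \<open>i < k\<close> is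
  \<open>(i, eigen_dual m k)\<close>, and dualising inverts the eigenvalue. The quotient thus
  becomes a product, as for the weight of a wedge of two eigenvectors.\<close>

lemma grade_has_dim:
  assumes "card {(i, k). i < k \<and> k < 2 * m + 4 \<and> eigenvalue m i * eigenvalue m k = \<i> ^ l} = d"
  shows "has_dim CC (\<gg>_grade (m + 2) l) d"
  unfolding \<gg>_grade_conv
proof (rule eigen_pre_has_dim)
  have "(i, eigen_dual m k) \<in> grade_support m l \<longleftrightarrow> eigenvalue m i * eigenvalue m k = \<i> ^ l" if "k < 2 * m + 4" for i k
    using eigenvalue_dual[OF that] eigenvalue_nonzero[of m k] unfolding grade_support_def mem_Collect_eq prod.case
    by (metis mult.assoc mult.commute mult.right_neutral)
  then show "card {(i, k). i < k \<and> k < 2 * m + 4 \<and> (i, eigen_dual m k) \<in> grade_support m l} = d"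
    using assms by (simp cong: conj_cong)
qed (simp add: grade_support_dual)

lemma card_Un_two_columns:
  assumes "finite A" "finite B" "a \<noteq> b"
  shows "card (A \<times> {a} \<union> B \<times> {b}) = card A + card B"
  using assms by (subst card_Un_disjoint) (auto simp: card_cartesian_product)

text \<open>The product \<i> arises as 1 times \<i> and as -1 times -\<i>: one full eigenspace of
  dimension \<open>m + 1\<close> for each of the two lines.\<close>

lemma grade_1_dim: "has_dim CC (\<gg>_grade (m + 2) 1) (2 * m + 2)"
proof (rule grade_has_dim)
  have "i < k \<and> k < 2 * m + 4 \<and> eigenvalue m i * eigenvalue m k = \<i> ^ 1 \<longleftrightarrow>
      (i, k) \<in> {..<m + 1} \<times> {2 * m + 2} \<union> {m + 1..<2 * m + 2} \<times> {2 * m + 3}" for i k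
  proof (cases "i < 2 * m + 4 \<and> k < 2 * m + 4")
    case True
    then have i: "i < 2 * m + 4" and k: "k < 2 * m + 4" by auto
    show ?thesis
      by (rule eigenvalue_cases[OF i]; rule eigenvalue_cases[OF k]; simp add: \<i>_powers[simplified] complex_eq_iff)
  qed auto
  then have "{(i, k). i < k \<and> k < 2 * m + 4 \<and> eigenvalue m i * eigenvalue m k = \<i> ^ 1} =
      {..<m + 1} \<times> {2 * m + 2} \<union> {m + 1..<2 * m + 2} \<times> {2 * m + 3}" by blast
  then show "card {(i, k). i < k \<and> k < 2 * m + 4 \<and> eigenvalue m i * eigenvalue m k = \<i> ^ 1} = 2 * m + 2"
    using card_Un_two_columns[of "{..<m + 1}" "{m + 1..<2 * m + 2}" "2 * m + 2" "2 * m + 3"] by simp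
qed

text \<open>As for the first grade with the two lines exchanged: -\<i> is 1 times -\<i> and -1 times
  \<i>.\<close>

lemma grade_3_dim: "has_dim CC (\<gg>_grade (m + 2) 3) (2 * m + 2)"
proof (rule grade_has_dim)
  have "i < k \<and> k < 2 * m + 4 \<and> eigenvalue m i * eigenvalue m k = \<i> ^ 3 \<longleftrightarrow>
      (i, k) \<in> {..<m + 1} \<times> {2 * m + 3} \<union> {m + 1..<2 * m + 2} \<times> {2 * m + 2}" for i k
  proof (cases "i < 2 * m + 4 \<and> k < 2 * m + 4")
    case True
    then have i: "i < 2 * m + 4" and k: "k < 2 * m + 4" by auto
    show ?thesis
      by (rule eigenvalue_cases[OF i]; rule eigenvalue_cases[OF k]; simp add: \<i>_powers[simplified] complex_eq_iff)
  qed auto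
  then have "{(i, k). i < k \<and> k < 2 * m + 4 \<and> eigenvalue m i * eigenvalue m k = \<i> ^ 3} =
      {..<m + 1} \<times> {2 * m + 3} \<union> {m + 1..<2 * m + 2} \<times> {2 * m + 2}" by blast
  then show "card {(i, k). i < k \<and> k < 2 * m + 4 \<and> eigenvalue m i * eigenvalue m k = \<i> ^ 3} = 2 * m + 2"
    using card_Un_two_columns[of "{..<m + 1}" "{m + 1..<2 * m + 2}" "2 * m + 3" "2 * m + 2"] by simp
qed

text \<open>The product -1 is also the square of \<i> and of -\<i>, but these eigenspaces are lines
  and \<open>i < k\<close> excludes a repeated index. Only the pairs from the two big eigenspaces
  remain.\<close>

lemma grade_2_dim: "has_dim CC (\<gg>_grade (m + 2) 2) ((m + 1) ^ 2)"
proof (rule grade_has_dim)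
  have "i < k \<and> k < 2 * m + 4 \<and> eigenvalue m i * eigenvalue m k = \<i> ^ 2 \<longleftrightarrow>
      (i, k) \<in> {..<m + 1} \<times> {m + 1..<2 * m + 2}" for i k
  proof (cases "i < 2 * m + 4 \<and> k < 2 * m + 4")
    case True
    then have i: "i < 2 * m + 4" and k: "k < 2 * m + 4" by auto
    show ?thesis
      by (rule eigenvalue_cases[OF i]; rule eigenvalue_cases[OF k]; simp add: \<i>_powers[simplified] complex_eq_iff)
  qed auto
  then have "{(i, k). i < k \<and> k < 2 * m + 4 \<and> eigenvalue m i * eigenvalue m k = \<i> ^ 2} =
      {..<m + 1} \<times> {m + 1..<2 * m + 2}" by blast
  then show "card {(i, k). i < k \<and> k < 2 * m + 4 \<and> eigenvalue m i * eigenvalue m k = \<i> ^ 2} = (m + 1) ^ 2"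
    by (simp only:) (simp add: card_cartesian_product power2_eq_square)
qed

text \<open>The product 1 comes from two vectors of the same big eigenspace, or from the pair of
  lines for \<i> and -\<i>.\<close>

lemma grade_0_dim: "has_dim CC (\<gg>_grade (m + 2) 0) (m * (m + 1) + 1)"
proof (rule grade_has_dim)
  let ?A = "{(i, j). i \<in> {..<m + 1} \<and> j \<in> {..<m + 1} \<and> i < j}"
  let ?B = "{(i, j). i \<in> {m + 1..<2 * m + 2} \<and> j \<in> {m + 1..<2 * m + 2} \<and> i < j}"
  have "i < k \<and> k < 2 * m + 4 \<and> eigenvalue m i * eigenvalue m k = \<i> ^ 0 \<longleftrightarrow>
      (i, k) \<in> (?A \<union> ?B) \<union> {(2 * m + 2, 2 * m + 3)}" for i k
  proof (cases "i < 2 * m + 4 \<and> k < 2 * m + 4")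
    case True
    then have i: "i < 2 * m + 4" and k: "k < 2 * m + 4" by auto
    show ?thesis
      by (rule eigenvalue_cases[OF i]; rule eigenvalue_cases[OF k]; simp add: \<i>_powers[simplified] complex_eq_iff)
  qed auto
  then have *: "{(i, k). i < k \<and> k < 2 * m + 4 \<and> eigenvalue m i * eigenvalue m k = \<i> ^ 0} =
      (?A \<union> ?B) \<union> {(2 * m + 2, 2 * m + 3)}" by blast
  have fin: "finite ?A" "finite ?B"
    by (auto intro: finite_subset[of _ "{..<2 * m + 2} \<times> {..<2 * m + 2}"])
  have "card ((?A \<union> ?B) \<union> {(2 * m + 2, 2 * m + 3)}) = card (?A \<union> ?B) + card {(2 * m + 2, 2 * m + 3)}"
    using fin by (intro card_Un_disjoint) auto
  also have "card (?A \<union> ?B) = card ?A + card ?B" using fin by (intro card_Un_disjoint) auto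
  also have "card ?A = (m + 1) * m div 2" using card_pairs_less[of "{..<m + 1}"] by simp
  also have "card ?B = (m + 1) * m div 2" using card_pairs_less[of "{m + 1..<2 * m + 2}"] by simp
  \<comment> \<open>The halves are exact, since a product of consecutive numbers is even.\<close>
  also have "(m + 1) * m div 2 + (m + 1) * m div 2 = m * (m + 1)"
    by (cases "even m") (auto elim!: evenE oddE)
  finally show "card {(i, k). i < k \<and> k < 2 * m + 4 \<and> eigenvalue m i * eigenvalue m k = \<i> ^ 0} = m * (m + 1) + 1"
    unfolding * by simp
qed

section \<open>Diagonal blocks\<close>

definition in_block :: "nat \<Rightarrow> nat \<Rightarrow> nat \<Rightarrow> bool"
  where "in_block k c i \<longleftrightarrow> c \<le> i \<and> i < c + k"

definition block :: "nat \<Rightarrow> nat \<Rightarrow> (nat \<times> nat) set"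
  where "block k c = {(i, j). in_block k c i \<and> in_block k c j}"

definition get_block :: "nat \<Rightarrow> nat \<Rightarrow> complex mat \<Rightarrow> complex mat"
  where "get_block k c W = mat k k (\<lambda>(i, j). W $$ (c + i, c + j))"

definition put_block :: "nat \<Rightarrow> nat \<Rightarrow> nat \<Rightarrow> complex mat \<Rightarrow> complex mat"
  where "put_block N k c X = mat N N (\<lambda>(i, j). if (i, j) \<in> block k c then X $$ (i - c, j - c) else 0)"

lemma in_blockE:
  assumes "in_block k c i"
  obtains a where "i = c + a" "a < k"
  using assms by (metis in_block_def add_less_cancel_left le_iff_add)

lemma in_block_add [simp]: "in_block k c (c + a) \<longleftrightarrow> a < k"
  by (simp add: in_block_def)

lemma get_block_carrier [simp]: "get_block k c W \<in> carrier_mat k k"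
  "dim_row (get_block k c W) = k" "dim_col (get_block k c W) = k"
  by (simp_all add: get_block_def)

lemma put_block_carrier [simp]: "put_block N k c X \<in> carrier_mat N N"
  "dim_row (put_block N k c X) = N" "dim_col (put_block N k c X) = N"
  by (simp_all add: put_block_def)

lemma index_get_block [simp]: "i < k \<Longrightarrow> j < k \<Longrightarrow> get_block k c W $$ (i, j) = W $$ (c + i, c + j)"
  by (simp add: get_block_def)

lemma index_put_block: "i < N \<Longrightarrow> j < N \<Longrightarrow>
  put_block N k c X $$ (i, j) = (if (i, j) \<in> block k c then X $$ (i - c, j - c) else 0)"
  by (simp add: put_block_def)

lemma get_block_add:
  assumes "A \<in> carrier_mat N N" "B \<in> carrier_mat N N" "c + k \<le> N"
  shows "get_block k c (A + B) = get_block k c A + get_block k c B"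
  using assms by (intro eq_matI) auto

lemma get_block_minus:
  assumes "A \<in> carrier_mat N N" "B \<in> carrier_mat N N" "c + k \<le> N"
  shows "get_block k c (A - B) = get_block k c A - get_block k c B"
  using assms by (intro eq_matI) auto

lemma get_block_smult:
  assumes "A \<in> carrier_mat N N" "c + k \<le> N"
  shows "get_block k c (r \<cdot>\<^sub>m A) = r \<cdot>\<^sub>m get_block k c A"
  using assms by (intro eq_matI) auto

lemma put_block_add:
  assumes "X \<in> carrier_mat k k" "Y \<in> carrier_mat k k"
  shows "put_block N k c (X + Y) = put_block N k c X + put_block N k c Y"
proof (rule eq_matI)
  fix i j assume "i < dim_row (put_block N k c X + put_block N k c Y)" "j < dim_col (put_block N k c X + put_block N k c Y)"
  then have ij: "i < N" "j < N" by auto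
  show "put_block N k c (X + Y) $$ (i, j) = (put_block N k c X + put_block N k c Y) $$ (i, j)"
    using ij assms by (auto simp: index_put_block block_def elim!: in_blockE)
qed auto

lemma get_put_block:
  assumes "X \<in> carrier_mat k k" "c + k \<le> N"
  shows "get_block k c (put_block N k c X) = X"
  using assms by (intro eq_matI) (auto simp: index_put_block block_def)

lemma get_block_disjoint:
  assumes W: "W \<in> skew_on N \<pi> R" and c: "c + k \<le> N" and disj: "R \<inter> block k c = {}"
  shows "get_block k c W = 0\<^sub>m k k"
proof (rule eq_matI)
  fix i j assume "i < dim_row (0\<^sub>m k k :: complex mat)" "j < dim_col (0\<^sub>m k k :: complex mat)"
  then have ij: "i < k" "j < k" by auto
  then have "(c + i, c + j) \<in> block k c" by (simp add: block_def)
  then have "(c + i, c + j) \<notin> R" using disj by blast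
  then show "get_block k c W $$ (i, j) = 0\<^sub>m k k $$ (i, j)"
    using skew_onD(3)[OF W, of "c + i" "c + j"] ij c by simp
qed auto

lemma put_get_block:
  assumes W: "W \<in> skew_on N \<pi> (block k c)"
  shows "put_block N k c (get_block k c W) = W"
proof (rule eq_matI)
  fix i j assume "i < dim_row W" "j < dim_col W"
  then have ij: "i < N" "j < N" using skew_onD(1)[OF W] by auto
  show "put_block N k c (get_block k c W) $$ (i, j) = W $$ (i, j)"
  proof (cases "(i, j) \<in> block k c")
    case True
    then show ?thesis using ij by (auto simp: index_put_block block_def elim!: in_blockE)
  next
    case False
    then show ?thesis using ij skew_onD(3)[OF W ij] by (simp add: index_put_block)
  qed
qed (use skew_onD(1)[OF W] in auto)

lemma sum_in_block:
  fixes f :: "nat \<Rightarrow> complex"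
  assumes "c + k \<le> N" "\<And>a. a < N \<Longrightarrow> \<not> in_block k c a \<Longrightarrow> f a = 0"
  shows "(\<Sum>a = 0..<N. f a) = (\<Sum>a = 0..<k. f (c + a))"
proof -
  have "(\<Sum>a = 0..<N. f a) = (\<Sum>a = c..<c + k. f a)"
    using assms by (intro sum.mono_neutral_right) (auto simp: in_block_def)
  also have "\<dots> = (\<Sum>a = 0..<k. f (c + a))"
    using sum.shift_bounds_nat_ivl[of f 0 c k] by (simp add: add.commute)
  finally show ?thesis .
qed

text \<open>The summation index is confined to the block, because the block rows of the left factor
  vanish elsewhere. A bracket has each matrix once on the left, so \<open>get_block_bracket\<close>
  asks this of both.\<close>

lemma get_block_mult:
  assumes A: "A \<in> carrier_mat N N" and B: "B \<in> carrier_mat N N" and c: "c + k \<le> N"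
    and zero: "\<And>i a. in_block k c i \<Longrightarrow> a < N \<Longrightarrow> \<not> in_block k c a \<Longrightarrow> A $$ (i, a) = 0"
  shows "get_block k c (A * B) = get_block k c A * get_block k c B"
proof (rule eq_matI)
  fix i j assume "i < dim_row (get_block k c A * get_block k c B)" "j < dim_col (get_block k c A * get_block k c B)"
  then have ij: "i < k" "j < k" by auto
  then have ij': "c + i < N" "c + j < N" using c by auto
  have "get_block k c (A * B) $$ (i, j) = (\<Sum>a = 0..<N. A $$ (c + i, a) * B $$ (a, c + j))"
    unfolding index_get_block[OF ij] by (rule index_mult_mat_sum[OF A B ij'])
  also have "\<dots> = (\<Sum>a = 0..<k. A $$ (c + i, c + a) * B $$ (c + a, c + j))"
    using ij zero[of "c + i"] by (intro sum_in_block[OF c]) simp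
  also have "\<dots> = (\<Sum>a = 0..<k. get_block k c A $$ (i, a) * get_block k c B $$ (a, j))"
    using ij by (intro sum.cong) auto
  also have "\<dots> = (get_block k c A * get_block k c B) $$ (i, j)"
    by (rule index_mult_mat_sum[OF get_block_carrier(1) get_block_carrier(1) ij, symmetric])
  finally show "get_block k c (A * B) $$ (i, j) = (get_block k c A * get_block k c B) $$ (i, j)" .
qed auto

lemma get_block_bracket:
  assumes A: "A \<in> carrier_mat N N" and B: "B \<in> carrier_mat N N" and c: "c + k \<le> N"
    and zero: "\<And>i a. in_block k c i \<Longrightarrow> a < N \<Longrightarrow> \<not> in_block k c a \<Longrightarrow> A $$ (i, a) = 0 \<and> B $$ (i, a) = 0"
  shows "get_block k c (A * B - B * A) =
    get_block k c A * get_block k c B - get_block k c B * get_block k c A"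
proof -
  have "get_block k c (A * B - B * A) = get_block k c (A * B) - get_block k c (B * A)"
    using A B c by (intro get_block_minus mult_carrier_mat) auto
  then show ?thesis
    using get_block_mult[OF A B c] get_block_mult[OF B A c] zero by simp
qed

text \<open>\<open>\<rho>\<close> is the involution that \<pi> induces on the block, shifted to
  start at 0.\<close>

lemma get_block_skew_on:
  assumes W: "W \<in> skew_on N \<pi> R" and c: "c + k \<le> N"
    and \<rho>: "\<And>i. i < k \<Longrightarrow> \<rho> i < k \<and> \<pi> (c + i) = c + \<rho> i"
  shows "get_block k c W \<in> skew_on k \<rho> UNIV"
proof -
  have "get_block k c W $$ (i, j) = - get_block k c W $$ (\<rho> j, \<rho> i)" if ij: "i < k" "j < k" for i j
  proof -
    have "c + i < N" "c + j < N" using ij c by auto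
    then show ?thesis using skew_onD(2)[OF W, of "c + i" "c + j"] \<rho>[OF ij(1)] \<rho>[OF ij(2)] ij by simp
  qed
  then show ?thesis unfolding skew_on_def using get_block_carrier(1) by blast
qed

lemma put_block_skew_on:
  assumes \<pi>: "involution_below N \<pi>" and X: "X \<in> skew_on k \<rho> UNIV"
    and \<rho>: "\<And>i. i < k \<Longrightarrow> \<rho> i < k \<and> \<pi> (c + i) = c + \<rho> i"
  shows "put_block N k c X \<in> skew_on N \<pi> (block k c)"
proof -
  have blk: "in_block k c (\<pi> i)" if "in_block k c i" for i
    using that \<rho> by (auto elim!: in_blockE)
  have "put_block N k c X $$ (i, j) = - put_block N k c X $$ (\<pi> j, \<pi> i)" if ij: "i < N" "j < N" for i j
  proof (cases "(i, j) \<in> block k c")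
    case True
    then obtain a b where ab: "i = c + a" "a < k" "j = c + b" "b < k" by (auto simp: block_def elim!: in_blockE)
    then have "(\<pi> j, \<pi> i) \<in> block k c" using True blk by (auto simp: block_def)
    then show ?thesis
      using True ij involution_belowD(1)[OF \<pi> ij(1)] involution_belowD(1)[OF \<pi> ij(2)] ab \<rho>[OF ab(2)] \<rho>[OF ab(4)]
        skew_onD(2)[OF X ab(2,4)]
      by (simp add: index_put_block)
  next
    case False
    have "(\<pi> j, \<pi> i) \<notin> block k c"
    proof
      assume "(\<pi> j, \<pi> i) \<in> block k c"
      then have "in_block k c (\<pi> (\<pi> j))" "in_block k c (\<pi> (\<pi> i))" using blk by (auto simp: block_def)
      then show False using False involution_belowD(2)[OF \<pi> ij(1)] involution_belowD(2)[OF \<pi> ij(2)]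
        by (auto simp: block_def)
    qed
    then show ?thesis
      using False ij involution_belowD(1)[OF \<pi> ij(1)] involution_belowD(1)[OF \<pi> ij(2)] by (simp add: index_put_block)
  qed
  moreover have "put_block N k c X $$ (i, j) = 0" if "i < N" "j < N" "(i, j) \<notin> block k c" for i j
    using that by (simp add: index_put_block)
  ultimately show ?thesis unfolding skew_on_def using put_block_carrier(1) by blast
qed

text \<open>Both blocks of size \<open>m\<close> carry the same induced involution, the reversal. So
  each is a copy of the orthogonal algebra of \<open>antidiag m\<close>, and a common matrix
  \<open>X\<close> can be placed in both.\<close>

lemma eigen_dual_block:
  assumes "i < m"
  shows "m - 1 - i < m \<and> eigen_dual m (1 + i) = 1 + (m - 1 - i)"
    "m - 1 - i < m \<and> eigen_dual m (m + 2 + i) = m + 2 + (m - 1 - i)"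
  using assms eigen_dual_simps(2,4)[OF assms] by simp_all

section \<open>The block diagonal embedding in both bases\<close>

lemma diag_emb_carrier:
  assumes "X \<in> carrier_mat m m"
  shows "diag_emb X \<in> carrier_mat (2 * m + 4) (2 * m + 4)"
  using assms by (intro carrier_matI) (simp_all add: diag_emb_def dim_diag_block_mat)

lemma diag_emb_eq:
  assumes X: "X \<in> carrier_mat m m"
  shows "diag_emb X = put_block (2 * m + 4) m 1 X + put_block (2 * m + 4) m (m + 3) X"
proof (rule eq_matI)
  let ?N = "2 * m + 4"
  let ?R = "put_block (2 * m + 4) m 1 X + put_block (2 * m + 4) m (m + 3) X"
  fix i j assume "i < dim_row ?R" "j < dim_col ?R"
  then have i: "i < ?N" and j: "j < ?N" by auto
  have d: "dim_row X = m" "dim_col X = m" using X by auto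
  have "diag_emb X $$ (i, j) = (if in_block m 1 i \<and> in_block m 1 j then X $$ (i - 1, j - 1)
      else if in_block m (m + 3) i \<and> in_block m (m + 3) j then X $$ (i - (m + 3), j - (m + 3)) else 0)"
    by (rule \<sigma>\<^sub>0_cases[OF i]; rule \<sigma>\<^sub>0_cases[OF j]; simp add: diag_emb_def d Let_def in_block_def)
  moreover have "\<not> (in_block m 1 i \<and> in_block m (m + 3) i)" by (auto simp: in_block_def)
  ultimately show "diag_emb X $$ (i, j) = ?R $$ (i, j)"
    using i j by (simp add: index_put_block block_def)
qed (use diag_emb_carrier[OF X] in auto)

lemma mid_block_conv: "mid_block (m + 2) Z = get_block m 1 Z"
  by (simp add: mid_block_def get_block_def)

lemma mid_block_diag_emb:
  assumes X: "X \<in> carrier_mat m m"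
  shows "mid_block (m + 2) (diag_emb X) = X"
proof (rule eq_matI)
  fix i j assume "i < dim_row X" "j < dim_col X"
  then have "i < m" "j < m" using X by auto
  then show "mid_block (m + 2) (diag_emb X) $$ (i, j) = X $$ (i, j)"
    by (simp add: mid_block_conv diag_emb_eq[OF X] index_put_block block_def in_block_def)
qed (use X in \<open>auto simp: mid_block_conv\<close>)

lemma diag_emb_in_block:
  assumes X: "X \<in> carrier_mat m m" and "in_block m 1 i" "a < 2 * m + 4" "\<not> in_block m 1 a"
  shows "diag_emb X $$ (i, a) = 0"
proof -
  have "i < 2 * m + 4" "\<not> in_block m (m + 3) i" using assms(2) by (auto simp: in_block_def)
  then show ?thesis using assms by (simp add: diag_emb_eq[OF X] index_put_block block_def)
qed

lemma in_block_simps: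
  fixes m :: nat
  shows "in_block m (Suc 0) 0 = False" "k < m \<Longrightarrow> in_block m (Suc 0) (Suc k) = True" "in_block m (Suc 0) (Suc m) = False"
  "in_block m (Suc 0) (m + 2) = False" "in_block m (Suc 0) (m + 2 + k) = False" "in_block m (Suc 0) (m + 3 + k) = False"
  "in_block m (Suc 0) (2 * m + 2) = False" "in_block m (Suc 0) (2 * m + 3) = False"
  "in_block m (m + 2) 0 = False" "k < m \<Longrightarrow> in_block m (m + 2) (Suc k) = False" "in_block m (m + 2) (Suc m) = False"
  "k < m \<Longrightarrow> in_block m (m + 2) (m + 2 + k) = True" "in_block m (m + 2) (2 * m + 2) = False" "in_block m (m + 2) (2 * m + 3) = False"
  "in_block m (m + 3) 0 = False" "k < m \<Longrightarrow> in_block m (m + 3) (Suc k) = False" "in_block m (m + 3) (Suc m) = False"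
  "in_block m (m + 3) (m + 2) = False" "k < m \<Longrightarrow> in_block m (m + 3) (m + 3 + k) = True" "in_block m (m + 3) (2 * m + 3) = False"
  by (auto simp: in_block_def)

text \<open>The matrix commutes with the simultaneous exchange of the \<open>j\<close>-th and the
  \<open>(m + 2 + j)\<close>-th unit vectors for \<open>1 \<le> j \<le> m\<close>, hence acts as
  \<open>X\<close> on their sums and as \<open>X\<close> on their differences. The scalar factors of
  the basis vectors cancel.\<close>

lemma to_eigen_diag_emb:
  assumes X: "X \<in> carrier_mat m m"
  shows "to_eigen m (diag_emb X) = put_block (2 * m + 4) m 1 X + put_block (2 * m + 4) m (m + 2) X"
proof (rule eq_matI)
  let ?N = "2 * m + 4"
  let ?R = "put_block (2 * m + 4) m 1 X + put_block (2 * m + 4) m (m + 2) X"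
  fix i j assume "i < dim_row ?R" "j < dim_col ?R"
  then have i: "i < ?N" and j: "j < ?N" by auto
  define f where "f a b = (if in_block m (Suc 0) a \<and> in_block m (Suc 0) b then X $$ (a - 1, b - 1)
      else if in_block m (m + 3) a \<and> in_block m (m + 3) b then X $$ (a - (m + 3), b - (m + 3)) else 0)" for a b
  define s where "s = csqrt (1 / 2)"
  have r: "s * s = 1 / 2" "s * (s * x) = x / 2" for x
    using csqrt_half by (simp_all add: s_def mult.assoc[symmetric])
  have f: "diag_emb X $$ (a, b) = f a b" if "a < ?N" "b < ?N" for a b
  proof -
    have "\<not> (in_block m 1 a \<and> in_block m (m + 3) a)" by (auto simp: in_block_def)
    then show ?thesis using that by (simp add: diag_emb_eq[OF X] f_def index_put_block block_def)
  qed
  have d: "eigen_dual m i < ?N" using involution_belowD(1)[OF involution_eigen_dual i] .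
  have "to_eigen m (diag_emb X) $$ (i, j) = eigen_cosum m i (\<lambda>a. eigen_sum m j (\<lambda>b. diag_emb X $$ (a, b)))"
    by (rule index_to_eigen[OF diag_emb_carrier[OF X] i j])
  also have "\<dots> = eigen_cosum m i (\<lambda>a. eigen_sum m j (\<lambda>b. f a b))"
    unfolding eigen_cosum_def by (intro eigen_sum_cong d j f) simp_all
  also have "\<dots> = (if in_block m (Suc 0) i \<and> in_block m (Suc 0) j then X $$ (i - 1, j - 1)
      else if in_block m (m + 2) i \<and> in_block m (m + 2) j then X $$ (i - (m + 2), j - (m + 2)) else 0)"
    \<comment> \<open>In the mixed cases, one index from each block, the two copies of
      \<open>X\<close> enter with opposite signs and cancel.\<close>
    by (rule index_cases[OF i]; rule index_cases[OF j];
      simp only: eigen_sum_simps eigen_cosum_simps f_def in_block_simps if_True if_False simp_thms s_def[symmetric];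
      simp add: r algebra_simps)
  also have "\<dots> = ?R $$ (i, j)"
  proof -
    have "\<not> (in_block m 1 i \<and> in_block m (m + 2) i)" by (auto simp: in_block_def)
    then show ?thesis using i j by (simp add: index_put_block block_def)
  qed
  finally show "to_eigen m (diag_emb X) $$ (i, j) = ?R $$ (i, j)" .
qed (use carrier_matD[OF to_eigen_carrier[of m "diag_emb X"]] in auto)

section \<open>The subalgebra of block diagonal matrices\<close>

abbreviation mid_blocks :: "nat \<Rightarrow> (nat \<times> nat) set"
  where "mid_blocks m \<equiv> block m 1 \<union> block m (m + 2)"

text \<open>The image of \<open>\<gg>_tilde0\<close> in the eigenbasis
  (\<open>\<gg>_tilde0_conv\<close>): the diagonal of the two orthogonal algebras on the blocks of
  size \<open>m\<close>.\<close>

definition eigen_tilde0 :: "nat \<Rightarrow> complex mat set"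
  where "eigen_tilde0 m = {W \<in> eigen_skew m (mid_blocks m). get_block m 1 W = get_block m (m + 2) W}"

lemma eigen_skew_submodule: "submodule CC (eigen_skew m R) (gl (2 * m + 4))"
  by (rule skew_on_submodule[OF involution_eigen_dual])

lemma so_antidiag_carrier: "carrier (so_form m (antidiag m)) = skew_on m (\<lambda>i. m - 1 - i) UNIV"
  unfolding antidiag_conv by (rule so_form_perm_mat_carrier[OF involution_rev])

lemma eigen_tilde0_submodule: "submodule CC (eigen_tilde0 m) (gl (2 * m + 4))"
proof (rule gl_submoduleI)
  let ?N = "2 * m + 4"
  note S = gl_submoduleD[OF eigen_skew_submodule[of m "mid_blocks m"]]
  show "eigen_tilde0 m \<subseteq> carrier_mat ?N ?N" using S(1) by (auto simp: eigen_tilde0_def)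
  show "0\<^sub>m ?N ?N \<in> eigen_tilde0 m"
    using S(2) by (auto simp: eigen_tilde0_def get_block_def)
  show "A + B \<in> eigen_tilde0 m" if "A \<in> eigen_tilde0 m" "B \<in> eigen_tilde0 m" for A B
  proof -
    have c: "A \<in> carrier_mat ?N ?N" "B \<in> carrier_mat ?N ?N" using that S(1) by (auto simp: eigen_tilde0_def)
    then show ?thesis
      using that S(3) get_block_add[OF c, of 1 m] get_block_add[OF c, of "m + 2" m] by (simp add: eigen_tilde0_def)
  qed
  show "r \<cdot>\<^sub>m A \<in> eigen_tilde0 m" if "A \<in> eigen_tilde0 m" for r A
  proof -
    have c: "A \<in> carrier_mat ?N ?N" using that S(1) by (auto simp: eigen_tilde0_def)
    then show ?thesis
      using that S(4) get_block_smult[OF c, of 1 m] get_block_smult[OF c, of "m + 2" m] by (simp add: eigen_tilde0_def)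
  qed
qed

lemma eigen_tilde0I:
  assumes X: "X \<in> skew_on m (\<lambda>i. m - 1 - i) UNIV"
  shows "put_block (2 * m + 4) m 1 X + put_block (2 * m + 4) m (m + 2) X \<in> eigen_tilde0 m"
proof -
  let ?N = "2 * m + 4"
  have Xc: "X \<in> carrier_mat m m" using skew_onD(1)[OF X] .
  have p: "put_block ?N m 1 X \<in> eigen_skew m (block m 1)" "put_block ?N m (m + 2) X \<in> eigen_skew m (block m (m + 2))"
    by (rule put_block_skew_on[OF involution_eigen_dual X], rule eigen_dual_block, assumption)+
  have disj: "block m 1 \<inter> block m (m + 2) = {}" "block m (m + 2) \<inter> block m 1 = {}"
    by (auto simp: block_def in_block_def)
  have "put_block ?N m 1 X + put_block ?N m (m + 2) X \<in> eigen_skew m (mid_blocks m)"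
    using p eigen_skew_mono[of "block m 1" "mid_blocks m" m] eigen_skew_mono[of "block m (m + 2)" "mid_blocks m" m]
    by (intro gl_submoduleD(3)[OF eigen_skew_submodule]) auto
  moreover have "get_block m 1 (put_block ?N m 1 X + put_block ?N m (m + 2) X) = X"
    using get_block_add[OF put_block_carrier(1) put_block_carrier(1), of 1 m ?N m 1 X m "m + 2" X]
      get_put_block[OF Xc, of 1 ?N] get_block_disjoint[OF p(2) _ disj(2)] Xc by simp
  moreover have "get_block m (m + 2) (put_block ?N m 1 X + put_block ?N m (m + 2) X) = X"
    using get_block_add[OF put_block_carrier(1) put_block_carrier(1), of "m + 2" m ?N m 1 X m "m + 2" X]
      get_put_block[OF Xc, of "m + 2" ?N] get_block_disjoint[OF p(1) _ disj(1)] Xc by simp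
  ultimately show ?thesis by (simp add: eigen_tilde0_def)
qed

lemma eigen_tilde0_eq:
  assumes W: "W \<in> eigen_tilde0 m"
  shows "W = put_block (2 * m + 4) m 1 (get_block m 1 W) + put_block (2 * m + 4) m (m + 2) (get_block m 1 W)"
proof (rule eq_matI)
  let ?N = "2 * m + 4"
  let ?R = "put_block (2 * m + 4) m 1 (get_block m 1 W) + put_block (2 * m + 4) m (m + 2) (get_block m 1 W)"
  have sk: "W \<in> eigen_skew m (mid_blocks m)" and eq: "get_block m 1 W = get_block m (m + 2) W"
    using W by (auto simp: eigen_tilde0_def)
  show "dim_row W = dim_row ?R" "dim_col W = dim_col ?R" using skew_onD(1)[OF sk] by auto
  fix i j assume "i < dim_row ?R" "j < dim_col ?R"
  then have ij: "i < ?N" "j < ?N" by auto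
  consider "(i, j) \<in> block m 1" | "(i, j) \<in> block m (m + 2)" | "(i, j) \<notin> block m 1" "(i, j) \<notin> block m (m + 2)" by blast
  then show "W $$ (i, j) = ?R $$ (i, j)"
  proof cases
    case 1
    then have "(i, j) \<notin> block m (m + 2)" by (auto simp: block_def in_block_def)
    then show ?thesis using 1 ij
      by (auto simp: index_put_block block_def elim!: in_blockE)
  next
    case 2
    then have "(i, j) \<notin> block m 1" by (auto simp: block_def in_block_def)
    then have "?R $$ (i, j) = get_block m 1 W $$ (i - (m + 2), j - (m + 2))"
      using 2 ij by (simp add: index_put_block)
    also have "\<dots> = get_block m (m + 2) W $$ (i - (m + 2), j - (m + 2))" by (simp only: eq)
    also have "\<dots> = W $$ (i, j)" using 2 by (auto simp: block_def elim!: in_blockE)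
    finally show ?thesis by simp
  next
    case 3
    then show ?thesis using ij skew_onD(3)[OF sk ij] by (simp add: index_put_block)
  qed
qed

lemma get_block_eigen_tilde0:
  assumes "W \<in> eigen_tilde0 m"
  shows "get_block m 1 W \<in> skew_on m (\<lambda>i. m - 1 - i) UNIV"
  by (rule get_block_skew_on[where \<pi> = "eigen_dual m" and N = "2 * m + 4" and R = "mid_blocks m"])
    (use assms eigen_dual_block in \<open>auto simp: eigen_tilde0_def\<close>)

text \<open>Conjugating the transpose by \<open>J\<close> reflects a matrix in its
  antidiagonal.\<close>

lemma tilde_iff:
  assumes X: "X \<in> carrier_mat m m"
  shows "X = - tilde (m + 2) X \<longleftrightarrow> X \<in> skew_on m (\<lambda>i. m - 1 - i) UNIV"
proof -
  have t: "tilde (m + 2) X = antidiag m * transpose_mat X * antidiag m" by (simp add: tilde_def)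
  have tc: "tilde (m + 2) X \<in> carrier_mat m m" unfolding t using X by (intro mult_carrier_mat) auto
  have "tilde (m + 2) X $$ (i, j) = X $$ (m - 1 - j, m - 1 - i)" if ij: "i < m" "j < m" for i j
  proof -
    have "tilde (m + 2) X $$ (i, j) = (antidiag m * transpose_mat X) $$ (i, m - 1 - j)"
      unfolding t using ij X by (intro index_mult_antidiag[where M = m] mult_carrier_mat[where n = m]) auto
    also have "\<dots> = transpose_mat X $$ (m - 1 - i, m - 1 - j)"
      using ij X by (intro index_antidiag_mult[where M = m]) auto
    finally show ?thesis using ij X by simp
  qed
  then have "X = - tilde (m + 2) X \<longleftrightarrow> (\<forall>i<m. \<forall>j<m. X $$ (i, j) = - X $$ (m - 1 - j, m - 1 - i))"
    using X tc by (simp add: mat_eq_iff)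
  then show ?thesis using X by (simp add: skew_on_def)
qed

lemma \<gg>_tilde0_carrier: "carrier (\<gg>_tilde0 (m + 2)) = diag_emb ` skew_on m (\<lambda>i. m - 1 - i) UNIV"
proof -
  have "carrier (\<gg>_tilde0 (m + 2)) = {diag_emb X | X. X \<in> carrier_mat m m \<and> X = - tilde (m + 2) X}"
    by (simp add: \<gg>_tilde0_def)
  also have "\<dots> = diag_emb ` skew_on m (\<lambda>i. m - 1 - i) UNIV"
    using tilde_iff skew_onD(1)[of _ m "\<lambda>i. m - 1 - i" UNIV] by blast
  finally show ?thesis .
qed

lemma \<gg>_tilde0_conv: "carrier (\<gg>_tilde0 (m + 2)) = eigen_pre m (eigen_tilde0 m)"
proof (intro equalityI subsetI)
  fix Z assume "Z \<in> carrier (\<gg>_tilde0 (m + 2))"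
  then obtain X where X: "X \<in> skew_on m (\<lambda>i. m - 1 - i) UNIV" and Z: "Z = diag_emb X"
    unfolding \<gg>_tilde0_carrier by blast
  have t: "to_eigen m Z \<in> eigen_tilde0 m"
    unfolding Z to_eigen_diag_emb[OF skew_onD(1)[OF X]] by (rule eigen_tilde0I[OF X])
  then have "to_eigen m Z \<in> eigen_skew m UNIV"
    using eigen_skew_mono[of "mid_blocks m" UNIV m] by (auto simp: eigen_tilde0_def)
  \<comment> \<open>That \<open>diag_emb X\<close> lies in the Lie algebra is not computed in the
    original basis: its image is skew, hence the image of some element of the algebra, and
    injectivity of \<open>to_eigen\<close> on all matrices identifies the two.\<close>
  then have "to_eigen m Z \<in> to_eigen m ` carrier (\<gg> (m + 2))"
    using bij_betw_imp_surj_on[OF to_eigen_bij[of m]] by (simp only:)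
  then obtain Z' where Z': "Z' \<in> carrier (\<gg> (m + 2))" "to_eigen m Z = to_eigen m Z'" by (elim imageE)
  then have "Z = Z'"
    using to_eigen_inj diag_emb_carrier[OF skew_onD(1)[OF X]] \<gg>_carrierD unfolding Z by blast
  then show "Z \<in> eigen_pre m (eigen_tilde0 m)" using Z' t by (simp add: eigen_pre_def)
next
  fix Z assume "Z \<in> eigen_pre m (eigen_tilde0 m)"
  then have Z: "Z \<in> carrier (\<gg> (m + 2))" "to_eigen m Z \<in> eigen_tilde0 m" by (auto simp: eigen_pre_def)
  define X where "X = get_block m 1 (to_eigen m Z)"
  have X: "X \<in> skew_on m (\<lambda>i. m - 1 - i) UNIV" unfolding X_def by (rule get_block_eigen_tilde0[OF Z(2)])
  have "to_eigen m (diag_emb X) = to_eigen m Z"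
    unfolding to_eigen_diag_emb[OF skew_onD(1)[OF X]] using eigen_tilde0_eq[OF Z(2)] by (simp only: X_def)
  then have "diag_emb X = Z"
    using to_eigen_inj[OF diag_emb_carrier[OF skew_onD(1)[OF X]] \<gg>_carrierD[OF Z(1)]] by simp
  then show "Z \<in> carrier (\<gg>_tilde0 (m + 2))" unfolding \<gg>_tilde0_carrier using X by blast
qed

lemma \<gg>_tilde0_update: "\<gg>_tilde0 (m + 2) = gl_on (2 * m + 4) (eigen_pre m (eigen_tilde0 m))"
proof -
  have "\<gg>_tilde0 (m + 2) = \<gg> (m + 2)\<lparr>carrier := carrier (\<gg>_tilde0 (m + 2))\<rparr>" by (simp add: \<gg>_tilde0_def)
  then show ?thesis unfolding \<gg>_tilde0_conv \<gg>_update .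
qed

lemma to_eigen_mid_block:
  assumes "Z \<in> carrier (\<gg>_tilde0 (m + 2))"
  shows "get_block m 1 (to_eigen m Z) = mid_block (m + 2) Z" "get_block m (m + 2) (to_eigen m Z) = mid_block (m + 2) Z"
    "Z = diag_emb (mid_block (m + 2) Z)" "mid_block (m + 2) Z \<in> skew_on m (\<lambda>i. m - 1 - i) UNIV"
proof -
  obtain X where X: "X \<in> skew_on m (\<lambda>i. m - 1 - i) UNIV" and Z: "Z = diag_emb X"
    using assms unfolding \<gg>_tilde0_carrier by blast
  have Xc: "X \<in> carrier_mat m m" by (rule skew_onD(1)[OF X])
  have m: "mid_block (m + 2) Z = X" unfolding Z by (rule mid_block_diag_emb[OF Xc])
  show "Z = diag_emb (mid_block (m + 2) Z)" "mid_block (m + 2) Z \<in> skew_on m (\<lambda>i. m - 1 - i) UNIV"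
    using X by (simp_all add: m, simp add: Z)
  have T: "to_eigen m Z \<in> eigen_tilde0 m"
    using assms unfolding \<gg>_tilde0_conv eigen_pre_def by blast
  have "to_eigen m Z = put_block (2 * m + 4) m 1 X + put_block (2 * m + 4) m (m + 2) X"
    unfolding Z by (rule to_eigen_diag_emb[OF Xc])
  then have "get_block m 1 (to_eigen m Z) = X"
  proof -
    have "(1 + i, 1 + j) \<in> block m 1" "(1 + i, 1 + j) \<notin> block m (m + 2)" if "i < m" "j < m" for i j
      using that by (auto simp: block_def in_block_def)
    then show ?thesis unfolding \<open>to_eigen m Z = _\<close>
      using Xc by (intro eq_matI) (simp_all add: index_put_block)
  qed
  then show "get_block m 1 (to_eigen m Z) = mid_block (m + 2) Z" "get_block m (m + 2) (to_eigen m Z) = mid_block (m + 2) Z"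
    using T m by (simp_all add: eigen_tilde0_def)
qed

lemma \<gg>_tilde0_subset: "carrier (\<gg>_tilde0 (m + 2)) \<subseteq> carrier (\<gg> (m + 2))"
  unfolding \<gg>_tilde0_conv eigen_pre_def by blast

lemma eigen_tilde0_mult_zero:
  assumes "W \<in> eigen_tilde0 m" "in_block m c i" "c = 1 \<or> c = m + 2" "a < 2 * m + 4" "\<not> in_block m c a"
  shows "W $$ (i, a) = 0"
proof -
  have "(i, a) \<notin> mid_blocks m" "i < 2 * m + 4" using assms(2,3,5) by (auto simp: block_def in_block_def)
  then show ?thesis using assms(1,4) skew_onD(3)[of W "2 * m + 4" "eigen_dual m" "mid_blocks m" i a] by (simp add: eigen_tilde0_def)
qed

lemma eigen_tilde0_bracket:
  assumes A: "A \<in> eigen_tilde0 m" and B: "B \<in> eigen_tilde0 m"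
  shows "A * B - B * A \<in> eigen_tilde0 m"
proof -
  let ?N = "2 * m + 4"
  have c: "A \<in> carrier_mat ?N ?N" "B \<in> carrier_mat ?N ?N"
    using A B skew_onD(1) by (auto simp: eigen_tilde0_def)
  have "mid_blocks m O mid_blocks m \<subseteq> mid_blocks m" by (auto simp: block_def in_block_def)
  then have "A * B - B * A \<in> eigen_skew m (mid_blocks m)"
    using eigen_skew_bracket[of A m "mid_blocks m" B "mid_blocks m"] A B
      eigen_skew_mono[of "mid_blocks m O mid_blocks m \<union> mid_blocks m O mid_blocks m" "mid_blocks m" m]
    by (auto simp: eigen_tilde0_def)
  moreover have "get_block m 1 (A * B - B * A) = get_block m (m + 2) (A * B - B * A)"
    using get_block_bracket[OF c, of 1 m] get_block_bracket[OF c, of "m + 2" m]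
      eigen_tilde0_mult_zero[OF A] eigen_tilde0_mult_zero[OF B] A B
    by (simp add: eigen_tilde0_def)
  ultimately show ?thesis by (simp add: eigen_tilde0_def)
qed

lemma \<gg>_tilde0_lie_algebra: "lie_algebra CC (\<gg>_tilde0 (m + 2))"
  unfolding \<gg>_tilde0_update
  by (intro gl_sub_lie_algebra eigen_pre_submodule eigen_tilde0_submodule)
    (rule eigen_pre_bracket[OF eigen_tilde0_bracket])

lemma mid_block_bracket:
  assumes "Z \<in> carrier (\<gg>_tilde0 (m + 2))" "W \<in> carrier (\<gg>_tilde0 (m + 2))"
  shows "mid_block (m + 2) (Z * W - W * Z) =
    mid_block (m + 2) Z * mid_block (m + 2) W - mid_block (m + 2) W * mid_block (m + 2) Z"
proof -
  have c: "Z \<in> carrier_mat (2 * m + 4) (2 * m + 4)" "W \<in> carrier_mat (2 * m + 4) (2 * m + 4)"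
    using assms \<gg>_tilde0_subset \<gg>_carrierD by blast+
  have z: "V $$ (i, a) = 0"
    if V: "V \<in> carrier (\<gg>_tilde0 (m + 2))" and ia: "in_block m 1 i" "a < 2 * m + 4" "\<not> in_block m 1 a" for V i a
    using diag_emb_in_block[OF skew_onD(1)[OF to_eigen_mid_block(4)[OF V]] ia] to_eigen_mid_block(3)[OF V] by simp
  show ?thesis
    unfolding mid_block_conv using z[OF assms(1)] z[OF assms(2)] by (intro get_block_bracket[OF c]) auto
qed

lemma mid_block_bij: "bij_betw (mid_block (m + 2)) (carrier (\<gg>_tilde0 (m + 2))) (skew_on m (\<lambda>i. m - 1 - i) UNIV)"
proof (rule bij_betwI[where g = diag_emb])
  show "diag_emb \<in> skew_on m (\<lambda>i. m - 1 - i) UNIV \<rightarrow> carrier (\<gg>_tilde0 (m + 2))"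
    unfolding \<gg>_tilde0_carrier by blast
  show "mid_block (m + 2) \<in> carrier (\<gg>_tilde0 (m + 2)) \<rightarrow> skew_on m (\<lambda>i. m - 1 - i) UNIV"
    using to_eigen_mid_block(4) by blast
  show "diag_emb (mid_block (m + 2) Z) = Z" if "Z \<in> carrier (\<gg>_tilde0 (m + 2))" for Z
    using to_eigen_mid_block(3)[OF that] by simp
  show "mid_block (m + 2) (diag_emb X) = X" if "X \<in> skew_on m (\<lambda>i. m - 1 - i) UNIV" for X
    using mid_block_diag_emb[OF skew_onD(1)[OF that]] .
qed

lemma mid_block_lie_iso: "mid_block (m + 2) \<in> lie_iso CC (\<gg>_tilde0 (m + 2)) (so_form m (antidiag m))"
proof (rule lie_isoI)
  have c: "Z \<in> carrier_mat (2 * m + 4) (2 * m + 4)" if "Z \<in> carrier (\<gg>_tilde0 (m + 2))" for Z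
    using that \<gg>_tilde0_subset \<gg>_carrierD by blast
  have mem: "mid_block (m + 2) Z \<in> carrier (so_form m (antidiag m))" if "Z \<in> carrier (\<gg>_tilde0 (m + 2))" for Z
    unfolding so_antidiag_carrier using to_eigen_mid_block(4)[OF that] .
  show "mid_block (m + 2) \<in> lin_hom CC (\<gg>_tilde0 (m + 2)) (so_form m (antidiag m))"
    unfolding \<gg>_tilde0_update so_form_eq gl_sub_hom_iff
    using mem c get_block_add[of _ "2 * m + 4" _ 1 m] get_block_smult[of _ "2 * m + 4" 1 m]
    unfolding \<gg>_tilde0_conv so_form_eq mid_block_conv by simp
  show "bij_betw (mid_block (m + 2)) (carrier (\<gg>_tilde0 (m + 2))) (carrier (so_form m (antidiag m)))"
    unfolding so_antidiag_carrier by (rule mid_block_bij)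
  fix x y assume "x \<in> carrier (\<gg>_tilde0 (m + 2))" "y \<in> carrier (\<gg>_tilde0 (m + 2))"
  then show "mid_block (m + 2) (lie_bracket (\<gg>_tilde0 (m + 2)) x y) =
      lie_bracket (so_form m (antidiag m)) (mid_block (m + 2) x) (mid_block (m + 2) y)"
    using mid_block_bracket by (simp add: \<gg>_tilde0_update so_form_eq gl_simps)
qed

lemma \<gg>_tilde0_iso_so: "lie_isomorphic CC (\<gg>_tilde0 (m + 2)) (so m)"
proof -
  have i: "lie_isomorphic CC (so_form m (antidiag m)) (so m)" by (rule so_form_iso_so) simp_all
  then obtain f where "f \<in> lie_iso CC (so_form m (antidiag m)) (so m)" by (auto simp: lie_isomorphic_def)
  then have "f \<circ> mid_block (m + 2) \<in> lie_iso CC (\<gg>_tilde0 (m + 2)) (so m)"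
    by (rule lie_iso_comp[OF mid_block_lie_iso])
  then show ?thesis using \<gg>_tilde0_lie_algebra i by (intro lie_isomorphicI) (auto simp: lie_isomorphic_def)
qed

section \<open>Decomposition of the fixed point algebra\<close>

text \<open>The part of a block of size \<open>k + 1\<close> that mixes the single vector
  \<open>r\<close> with the other \<open>k\<close>. Over the orthogonal algebra of these
  \<open>k\<close> vectors it is the vector representation.\<close>

definition cross :: "nat \<Rightarrow> nat \<Rightarrow> nat \<Rightarrow> (nat \<times> nat) set"
  where "cross k c r = {(i, j). i = r \<and> in_block k c j \<or> in_block k c i \<and> j = r}"

text \<open>Skew matrices with this support scale the lines for \<i> and -\<i> by opposite
  factors.\<close>

definition corner :: "nat \<Rightarrow> (nat \<times> nat) set"
  where "corner m = {(2 * m + 2, 2 * m + 2), (2 * m + 3, 2 * m + 3)}"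

lemma in_block_dual:
  assumes "i < 2 * m + 4"
  shows "in_block m (Suc 0) (eigen_dual m i) = in_block m (Suc 0) i" "in_block m (m + 2) (eigen_dual m i) = in_block m (m + 2) i"
    "eigen_dual m i = 0 \<longleftrightarrow> i = 0" "eigen_dual m i = Suc m \<longleftrightarrow> i = Suc m"
    "eigen_dual m i = 2 * m + 2 \<longleftrightarrow> i = 2 * m + 3" "eigen_dual m i = 2 * m + 3 \<longleftrightarrow> i = 2 * m + 2"
  unfolding in_block_def
  by (rule index_cases[OF assms]; simp only: eigen_dual_simps; arith)+

lemma support_dual:
  assumes "i < 2 * m + 4" "j < 2 * m + 4"
  shows "(eigen_dual m j, eigen_dual m i) \<in> cross m 1 0 \<longleftrightarrow> (i, j) \<in> cross m 1 0"
    "(eigen_dual m j, eigen_dual m i) \<in> cross m (m + 2) (m + 1) \<longleftrightarrow> (i, j) \<in> cross m (m + 2) (m + 1)"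
    "(eigen_dual m j, eigen_dual m i) \<in> corner m \<longleftrightarrow> (i, j) \<in> corner m"
    "(eigen_dual m j, eigen_dual m i) \<in> block m (m + 2) \<longleftrightarrow> (i, j) \<in> block m (m + 2)"
  by (simp_all only: cross_def corner_def block_def mem_Collect_eq prod.case insert_iff prod.inject empty_iff
      One_nat_def add_0_right add_Suc_right in_block_dual[OF assms(1)] in_block_dual[OF assms(2)]) blast+

lemma eigenvalue_in_block:
  "in_block m 1 i \<Longrightarrow> eigenvalue m i = 1" "in_block m (m + 2) i \<Longrightarrow> eigenvalue m i = - 1"
  by (auto simp: in_block_def eigenvalue_def)

lemma support_grade_0:
  "block m 1 \<subseteq> grade_support m 0" "block m (m + 2) \<subseteq> grade_support m 0" "cross m 1 0 \<subseteq> grade_support m 0"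
  "cross m (m + 2) (m + 1) \<subseteq> grade_support m 0" "corner m \<subseteq> grade_support m 0"
  by (auto simp: block_def cross_def corner_def grade_support_def eigenvalue_in_block eigenvalue_simps)

lemma support_disjoint:
  "block m 1 \<inter> block m (m + 2) = {}" "block m 1 \<inter> cross m 1 0 = {}" "block m 1 \<inter> cross m (m + 2) (m + 1) = {}"
  "block m 1 \<inter> corner m = {}" "block m (m + 2) \<inter> cross m 1 0 = {}" "block m (m + 2) \<inter> cross m (m + 2) (m + 1) = {}"
  "block m (m + 2) \<inter> corner m = {}" "cross m 1 0 \<inter> cross m (m + 2) (m + 1) = {}" "cross m 1 0 \<inter> corner m = {}"
  "cross m (m + 2) (m + 1) \<inter> corner m = {}"
  by (auto simp: block_def cross_def corner_def in_block_def)

text \<open>Via \<open>eigen_skew_bracket\<close> these inclusions state that each summand is stable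
  under \<open>\<gg>_tilde0\<close>; the empty composition in the third makes the action on the
  corner trivial.\<close>

lemma support_action:
  "mid_blocks m O cross m 1 0 \<union> cross m 1 0 O mid_blocks m \<subseteq> cross m 1 0"
  "mid_blocks m O cross m (m + 2) (m + 1) \<union> cross m (m + 2) (m + 1) O mid_blocks m \<subseteq> cross m (m + 2) (m + 1)"
  "mid_blocks m O corner m \<union> corner m O mid_blocks m = {}"
  "mid_blocks m O block m (m + 2) \<union> block m (m + 2) O mid_blocks m \<subseteq> block m (m + 2)"
  by (auto simp: block_def cross_def corner_def in_block_def)

lemma grade_support_0_comp: "grade_support m 0 O grade_support m 0 \<subseteq> grade_support m 0"
  by (auto simp: grade_support_def)

text \<open>Outside the five supports, equal eigenvalues leave only the diagonal positions 0 and
  \<open>m + 1\<close>. These indices are self-dual, so the entry is its own negative.\<close>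

lemma grade_0_zero:
  assumes v: "v \<in> eigen_skew m (grade_support m 0)" and ij: "i < 2 * m + 4" "j < 2 * m + 4"
    and n: "(i, j) \<notin> block m 1" "(i, j) \<notin> block m (m + 2)" "(i, j) \<notin> cross m 1 0" "(i, j) \<notin> cross m (m + 2) (m + 1)" "(i, j) \<notin> corner m"
  shows "v $$ (i, j) = 0"
proof (cases "(i, j) \<in> grade_support m 0")
  case True
  have diag: "v $$ (i, i) = 0" if "eigen_dual m i = i"
    using skew_onD(2)[OF v ij(1) ij(1)] unfolding that by (auto simp: complex_eq_iff)
  have e: "eigenvalue m i = eigenvalue m j" using True by (simp add: grade_support_def)
  have blk: "a = 0 \<or> in_block m 1 a" if "a < m + 1" for a using that by (auto simp: in_block_def)
  have blk': "a = m + 1 \<or> in_block m (m + 2) a" if "m + 1 \<le> a" "a < 2 * m + 2" for a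
    using that by (auto simp: in_block_def)
  have "i = j \<and> (i = 0 \<or> i = m + 1)"
  proof (rule eigenvalue_cases[OF ij(1)])
    assume i: "i < m + 1" "eigenvalue m i = 1"
    have "j < m + 1" by (rule eigenvalue_cases[OF ij(2)]) (use i e in \<open>simp_all add: complex_eq_iff\<close>)
    then show ?thesis using blk[of i] blk[of j] i n(1,3) unfolding block_def cross_def by blast
  next
    assume i: "m + 1 \<le> i" "i < 2 * m + 2" "eigenvalue m i = - 1"
    have "m + 1 \<le> j \<and> j < 2 * m + 2"
      by (rule eigenvalue_cases[OF ij(2)]) (use i e in \<open>simp_all add: complex_eq_iff\<close>)
    then show ?thesis using blk'[of i] blk'[of j] i n(2,4) unfolding block_def cross_def by blast
  next
    assume i: "i = 2 * m + 2" "eigenvalue m i = \<i>"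
    have "j = 2 * m + 2" by (rule eigenvalue_cases[OF ij(2)]) (use i e in \<open>simp_all add: complex_eq_iff\<close>)
    then show ?thesis using i n(5) unfolding corner_def by blast
  next
    assume i: "i = 2 * m + 3" "eigenvalue m i = - \<i>"
    have "j = 2 * m + 3" by (rule eigenvalue_cases[OF ij(2)]) (use i e in \<open>simp_all add: complex_eq_iff\<close>)
    then show ?thesis using i n(5) unfolding corner_def by blast
  qed
  then have "i = j" "eigen_dual m i = i" by (auto simp: eigen_dual_simps)
  then show ?thesis using diag by simp
qed (rule skew_onD(3)[OF v ij])

text \<open>All summands but \<open>eigen_tilde0 m\<close> are given by supports and split off by
  masks. The diagonal shares its support with the last summand, so these two need a projection that
  is not a mask.\<close>

lemma fixed_point_internal_direct_sum_model:
  "internal_direct_sum CC (gl_on (2 * m + 4) (eigen_skew m (grade_support m 0))) {0..<5}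
    (\<lambda>i. [eigen_tilde0 m, eigen_skew m (cross m 1 0), eigen_skew m (cross m (m + 2) (m + 1)),
      eigen_skew m (corner m), eigen_skew m (block m (m + 2))] ! i)"
proof -
  let ?N = "2 * m + 4" and ?V = "eigen_skew m (grade_support m 0)"
  let ?W = "\<lambda>i. [eigen_tilde0 m, eigen_skew m (cross m 1 0), eigen_skew m (cross m (m + 2) (m + 1)),
      eigen_skew m (corner m), eigen_skew m (block m (m + 2))] ! i"
  \<comment> \<open>Projection onto the diagonal along the second block: a pair of blocks
    \<open>(A, B)\<close> is sent to \<open>(A, A)\<close>, with remainder
    \<open>(0, B - A)\<close>. Accordingly the last component below masks \<open>v - p0 v\<close>
    instead of \<open>v\<close>.\<close>
  define p0 where "p0 v = put_block ?N m 1 (get_block m 1 v) + put_block ?N m (m + 2) (get_block m 1 v)" for v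
  define p where "p i v = [p0 v, mask ?N (cross m 1 0) v, mask ?N (cross m (m + 2) (m + 1)) v, mask ?N (corner m) v,
      mask ?N (block m (m + 2)) (v - p0 v)] ! i" for i :: nat and v
  have five: "i \<in> {0..<5} \<longleftrightarrow> i = 0 \<or> i = 1 \<or> i = 2 \<or> i = 3 \<or> i = 4" for i :: nat by auto
  have W_simps: "?W 0 = eigen_tilde0 m" "?W 1 = eigen_skew m (cross m 1 0)" "?W 2 = eigen_skew m (cross m (m + 2) (m + 1))"
    "?W 3 = eigen_skew m (corner m)" "?W 4 = eigen_skew m (block m (m + 2))"
    by (simp_all add: eval_nat_numeral)
  have p_simps: "p 0 v = p0 v" "p 1 v = mask ?N (cross m 1 0) v" "p 2 v = mask ?N (cross m (m + 2) (m + 1)) v"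
    "p 3 v = mask ?N (corner m) v" "p 4 v = mask ?N (block m (m + 2)) (v - p0 v)" for v
    by (simp_all add: p_def eval_nat_numeral)
  have Vc: "v \<in> carrier_mat ?N ?N" if "v \<in> eigen_skew m R" for v R using skew_onD(1)[OF that] .
  have p0c: "p0 v \<in> carrier_mat ?N ?N" for v unfolding p0_def by simp
  have p0T: "p0 v \<in> eigen_tilde0 m" if v: "v \<in> eigen_skew m R" for v R
    unfolding p0_def using eigen_dual_block(1) by (intro eigen_tilde0I get_block_skew_on[OF v]) auto
  have p0_self: "p0 v = v" if "v \<in> eigen_tilde0 m" for v unfolding p0_def using eigen_tilde0_eq[OF that] by simp
  have p0_0: "p0 v = 0\<^sub>m ?N ?N" if v: "v \<in> eigen_skew m R" and R: "R \<inter> block m 1 = {}" for v R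
  proof -
    have "get_block m 1 v = 0\<^sub>m m m" using get_block_disjoint[OF v _ R] by simp
    moreover have "put_block ?N m c (0\<^sub>m m m) = 0\<^sub>m ?N ?N" for c
      by (intro eq_matI) (auto simp: index_put_block block_def elim!: in_blockE)
    ultimately show ?thesis unfolding p0_def by simp
  qed
  have p0_add: "p0 (v + w) = p0 v + p0 w" if "v \<in> eigen_skew m R" "w \<in> eigen_skew m S" for v w R S
  proof -
    have "get_block m 1 (v + w) = get_block m 1 v + get_block m 1 w"
      using get_block_add[OF Vc[OF that(1)] Vc[OF that(2)], of 1 m] by simp
    then have "p0 (v + w) = (put_block ?N m 1 (get_block m 1 v) + put_block ?N m 1 (get_block m 1 w)) +
        (put_block ?N m (m + 2) (get_block m 1 v) + put_block ?N m (m + 2) (get_block m 1 w))"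
      unfolding p0_def by (simp only: put_block_add[OF get_block_carrier(1) get_block_carrier(1)])
    also have "\<dots> = p0 v + p0 w" unfolding p0_def by (intro eq_matI) auto
    finally show ?thesis .
  qed
  have tilde_skew: "v \<in> eigen_skew m (mid_blocks m)" if "v \<in> eigen_tilde0 m" for v
    using that by (simp add: eigen_tilde0_def)
  have W_sub: "submodule CC (?W i) (gl ?N)" if "i \<in> {0..<5}" for i
    using that unfolding five by (elim disjE) (simp_all only: W_simps eigen_tilde0_submodule eigen_skew_submodule)
  have W_V: "?W i \<subseteq> ?V" if "i \<in> {0..<5}" for i
    using that unfolding five
  proof (elim disjE)
    assume "i = 0"
    then show ?thesis unfolding \<open>i = 0\<close> W_simps
      using tilde_skew eigen_skew_mono[of "mid_blocks m" "grade_support m 0" m] support_grade_0(1,2)[of m] by blast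
  qed (simp_all only: W_simps, (intro eigen_skew_mono support_grade_0)+)
  have W_supp: "\<exists>R. v \<in> eigen_skew m R \<and>
      R = (if i = 0 then mid_blocks m else if i = 1 then cross m 1 0 else if i = 2 then cross m (m + 2) (m + 1)
        else if i = 3 then corner m else block m (m + 2))" if "i \<in> {0..<5}" "v \<in> ?W i" for i v
    using that(1) that(2) unfolding five
    by (elim disjE) (simp_all only: W_simps, use tilde_skew in auto)
  show ?thesis
  proof (rule gl_sub_internal_direct_sumI[where p = p])
    show "submodule CC ?V (gl ?N)" by (rule eigen_skew_submodule)
    show "finite {0..<5::nat}" by simp
    fix i :: nat assume i: "i \<in> {0..<5}"
    show "submodule CC (?W i) (gl ?N)" by (rule W_sub[OF i])
    show "?W i \<subseteq> ?V" by (rule W_V[OF i])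
    show "p i v \<in> ?W i" if v: "v \<in> ?V" for v
    proof -
      have "v \<in> eigen_skew m UNIV" using v eigen_skew_mono[of "grade_support m 0" UNIV m] by auto
      moreover have "p0 v \<in> eigen_skew m UNIV"
        using tilde_skew[OF p0T[OF v]] eigen_skew_mono[of "mid_blocks m" UNIV m] by auto
      ultimately have d: "v - p0 v \<in> eigen_skew m UNIV" by (rule gl_submoduleD(5)[OF eigen_skew_submodule])
      show ?thesis
        using i unfolding five
      proof (elim disjE)
        assume e: "i = 0"
        show ?thesis unfolding e W_simps p_simps by (rule p0T[OF v])
      next
        assume e: "i = 1"
        show ?thesis unfolding e W_simps p_simps by (rule mask_skew_on[OF involution_eigen_dual v support_dual(1)])
      next
        assume e: "i = 2"
        show ?thesis unfolding e W_simps p_simps by (rule mask_skew_on[OF involution_eigen_dual v support_dual(2)])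
      next
        assume e: "i = 3"
        show ?thesis unfolding e W_simps p_simps by (rule mask_skew_on[OF involution_eigen_dual v support_dual(3)])
      next
        assume e: "i = 4"
        show ?thesis unfolding e W_simps p_simps by (rule mask_skew_on[OF involution_eigen_dual d support_dual(4)])
      qed
    qed
    show "p i (v + w) = p i v + p i w" if v: "v \<in> ?V" and w: "w \<in> ?V" for v w
    proof -
      have "v + w - p0 (v + w) = (v - p0 v) + (w - p0 w)"
        unfolding p0_add[OF v w] using Vc[OF v] Vc[OF w] p0c[of v] p0c[of w] by (intro eq_matI) auto
      moreover have "v - p0 v \<in> carrier_mat ?N ?N" "w - p0 w \<in> carrier_mat ?N ?N"
        using p0c by (auto intro: minus_carrier_mat)
      ultimately show ?thesis
        using i p0_add[OF v w] mask_add[OF Vc[OF v] Vc[OF w]] mask_add[of "v - p0 v" ?N "w - p0 w"]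
        unfolding five by (elim disjE) (simp_all only: p_simps)
    qed
    show "p i v = v" if v: "v \<in> ?W i" for v
      using i unfolding five
    proof (elim disjE)
      assume e: "i = 4"
      then have v4: "v \<in> eigen_skew m (block m (m + 2))" using v by (simp only: W_simps)
      have "p0 v = 0\<^sub>m ?N ?N" using support_disjoint(1)[of m] by (intro p0_0[OF v4]) blast
      moreover have "v - 0\<^sub>m ?N ?N = v" using Vc[OF v4] by (intro eq_matI) auto
      ultimately show ?thesis unfolding e p_simps by (simp add: mask_self[OF v4])
    qed (use v p0_self mask_self[where \<pi> = "eigen_dual m" and N = ?N] in \<open>simp_all only: p_simps W_simps\<close>)
    fix j :: nat assume j: "j \<in> {0..<5}" and ij: "i \<noteq> j"
    show "p j v = 0\<^sub>m ?N ?N" if v: "v \<in> ?W i" for v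
    proof -
      obtain R where R: "v \<in> eigen_skew m R"
        "R = (if i = 0 then mid_blocks m else if i = 1 then cross m 1 0 else if i = 2 then cross m (m + 2) (m + 1)
          else if i = 3 then corner m else block m (m + 2))"
        using W_supp[OF i v] by blast
      have p0v: "p0 v = 0\<^sub>m ?N ?N" if "i \<noteq> 0"
        using that support_disjoint[of m] i unfolding five by (intro p0_0[OF R(1)]) (auto simp: R(2))
      have msk: "mask ?N S v = 0\<^sub>m ?N ?N" if "R \<inter> S = {}" for S
        using that by (intro mask_disjoint[OF R(1)]) blast
      have m0: "mask ?N S (0\<^sub>m ?N ?N) = 0\<^sub>m ?N ?N" for S by (intro eq_matI) (auto simp: mask_def)
      have v0: "v - 0\<^sub>m ?N ?N = v" "v - v = 0\<^sub>m ?N ?N" using Vc[OF R(1)] by (auto intro!: eq_matI)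
      have v4: "v - p0 v = (if i = 0 then 0\<^sub>m ?N ?N else v)"
        using v0 p0v p0_self[of v] v W_simps(1) by (cases "i = 0") simp_all
      show ?thesis
        using j unfolding five
      proof (elim disjE)
        assume "j = 4"
        show ?thesis
        proof (cases "i = 0")
          case False
          then have "R \<inter> block m (m + 2) = {}" using support_disjoint[of m] i ij \<open>j = 4\<close> unfolding five R(2) by auto
          then show ?thesis using False msk by (simp add: \<open>j = 4\<close> p_simps v4)
        qed (simp add: \<open>j = 4\<close> p_simps v4 m0)
      next
        assume "j = 0"
        then show ?thesis using p0v ij by (simp add: p_simps)
      next
        assume e: "j = 1"
        have "R \<inter> cross m 1 0 = {}" using support_disjoint[of m] i ij e unfolding five R(2) by auto
        then show ?thesis unfolding e p_simps by (rule msk)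
      next
        assume e: "j = 2"
        have "R \<inter> cross m (m + 2) (m + 1) = {}" using support_disjoint[of m] i ij e unfolding five R(2) by auto
        then show ?thesis unfolding e p_simps by (rule msk)
      next
        assume e: "j = 3"
        have "R \<inter> corner m = {}" using support_disjoint[of m] i ij e unfolding five R(2) by auto
        then show ?thesis unfolding e p_simps by (rule msk)
      qed
    qed
  next
    fix v a b assume v: "v \<in> ?V" and ab: "a < ?N" "b < ?N"
    have s5: "(\<Sum>i\<in>{0..<5}. p i v $$ (a, b)) = p 0 v $$ (a, b) + p 1 v $$ (a, b) + p 2 v $$ (a, b) + p 3 v $$ (a, b) + p 4 v $$ (a, b)"
      by (simp add: eval_nat_numeral)
    have idx: "v - p0 v \<in> carrier_mat ?N ?N" "(v - p0 v) $$ (a, b) = v $$ (a, b) - p0 v $$ (a, b)"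
      using ab p0c[of v] by (auto intro: minus_carrier_mat)
    have msk: "mask ?N S w $$ (a, b) = (if (a, b) \<in> S then w $$ (a, b) else 0)" for S w
      using ab by (simp add: mask_def)
    consider "(a, b) \<in> block m 1" | "(a, b) \<in> block m (m + 2)" | "(a, b) \<notin> block m 1" "(a, b) \<notin> block m (m + 2)" by blast
    then show "(\<Sum>i\<in>{0..<5}. p i v $$ (a, b)) = v $$ (a, b)"
    proof cases
      case 1
      then have "(a, b) \<notin> block m (m + 2)" "(a, b) \<notin> cross m 1 0" "(a, b) \<notin> cross m (m + 2) (m + 1)" "(a, b) \<notin> corner m"
        using support_disjoint[of m] by blast+
      moreover have "p0 v $$ (a, b) = v $$ (a, b)"
        unfolding p0_def using ab 1 \<open>(a, b) \<notin> block m (m + 2)\<close>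
        by (simp add: index_put_block) (auto simp: block_def elim!: in_blockE)
      ultimately show ?thesis unfolding s5 p_simps msk by simp
    next
      \<comment> \<open>On the second block \<open>p0 v\<close> and the masked remainder add up to
        \<open>v\<close>.\<close>
      case 2
      then have "(a, b) \<notin> cross m 1 0" "(a, b) \<notin> cross m (m + 2) (m + 1)" "(a, b) \<notin> corner m"
        using support_disjoint[of m] by blast+
      then show ?thesis using 2 unfolding s5 p_simps msk idx(2) by simp
    next
      case 3
      then have p00: "p0 v $$ (a, b) = 0" unfolding p0_def using ab by (simp add: index_put_block)
      have d: "\<not> ((a, b) \<in> cross m 1 0 \<and> (a, b) \<in> cross m (m + 2) (m + 1))"
        "\<not> ((a, b) \<in> cross m 1 0 \<and> (a, b) \<in> corner m)" "\<not> ((a, b) \<in> cross m (m + 2) (m + 1) \<and> (a, b) \<in> corner m)"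
        using support_disjoint[of m] by blast+
      show ?thesis
        unfolding s5 p_simps msk p00 using d 3(2) grade_0_zero[OF v ab 3]
        by (cases "(a, b) \<in> cross m 1 0"; cases "(a, b) \<in> cross m (m + 2) (m + 1)"; cases "(a, b) \<in> corner m") simp_all
    qed
  qed
qed

lemma fixed_point_internal_direct_sum:
  "internal_direct_sum CC (\<gg>_grade (m + 2) 0) {0..<5}
    (\<lambda>i. [carrier (\<gg>_tilde0 (m + 2)), eigen_pre m (eigen_skew m (cross m 1 0)),
      eigen_pre m (eigen_skew m (cross m (m + 2) (m + 1))), eigen_pre m (eigen_skew m (corner m)),
      eigen_pre m (eigen_skew m (block m (m + 2)))] ! i)"
    (is "internal_direct_sum CC _ _ (\<lambda>i. ?L ! i)")
proof -
  let ?N = "2 * m + 4" and ?V = "eigen_skew m (grade_support m 0)"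
  let ?M = "[eigen_tilde0 m, eigen_skew m (cross m 1 0), eigen_skew m (cross m (m + 2) (m + 1)),
      eigen_skew m (corner m), eigen_skew m (block m (m + 2))]"
  have L: "?L ! i = eigen_pre m (?M ! i)" if "i \<in> {0..<5}" for i
  proof -
    have "?L = map (eigen_pre m) ?M" by (simp add: \<gg>_tilde0_conv)
    then show ?thesis using that by (simp only:) (rule nth_map, simp)
  qed
  have M: "submodule CC (?M ! i) (gl ?N)" "?M ! i \<subseteq> ?V" if "i \<in> {0..<5}" for i
  proof -
    have "subspace CC (?M ! i) (gl_on ?N ?V)"
      using fixed_point_internal_direct_sum_model[of m] that unfolding internal_direct_sum_def by blast
    then show "submodule CC (?M ! i) (gl ?N)" "?M ! i \<subseteq> ?V"
      by (rule gl_subspaceD[OF eigen_skew_submodule])+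
  qed
  have pre: "eigen_pre m X = {v \<in> eigen_pre m ?V. to_eigen m v \<in> X}" if "X \<subseteq> ?V" for X
    using that unfolding eigen_pre_def by blast
  show ?thesis
    unfolding \<gg>_grade_conv
  proof (rule gl_sub_internal_direct_sum_transport[OF _ _ eigen_pre_hom _ _ _ fixed_point_internal_direct_sum_model])
    show "submodule CC (eigen_pre m ?V) (gl ?N)" by (intro eigen_pre_submodule eigen_skew_submodule)
    show "bij_betw (to_eigen m) (eigen_pre m ?V) ?V" by (intro eigen_pre_bij eigen_skew_mono) simp
    fix i :: nat assume i: "i \<in> {0..<5}"
    show "submodule CC (?L ! i) (gl ?N)" unfolding L[OF i] by (rule eigen_pre_submodule[OF M(1)[OF i]])
    show "?L ! i = {v \<in> eigen_pre m ?V. to_eigen m v \<in> ?M ! i}"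
      unfolding L[OF i] by (rule pre[OF M(2)[OF i]])
  qed (rule eigen_skew_submodule)
qed

section \<open>The summands as modules\<close>

lemma \<gg>_tilde0_module:
  assumes W: "submodule CC W (gl (2 * m + 4))"
    and act: "\<And>A B. A \<in> eigen_tilde0 m \<Longrightarrow> B \<in> W \<Longrightarrow> A * B - B * A \<in> W"
  shows "lie_module CC (\<gg>_tilde0 (m + 2)) (gl_on (2 * m + 4) (eigen_pre m W)) (lie_bracket (\<gg> (m + 2)))"
  unfolding \<gg>_tilde0_update \<gg>_bracket
proof (rule gl_sub_lie_module)
  show "A * B - B * A \<in> eigen_pre m (eigen_tilde0 m)" if "A \<in> eigen_pre m (eigen_tilde0 m)" "B \<in> eigen_pre m (eigen_tilde0 m)" for A B
    by (rule eigen_pre_bracket[OF eigen_tilde0_bracket that])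
  show "A * B - B * A \<in> eigen_pre m W" if "A \<in> eigen_pre m (eigen_tilde0 m)" "B \<in> eigen_pre m W" for A B
    by (rule eigen_pre_bracket[OF act that])
qed (intro eigen_pre_submodule eigen_tilde0_submodule W)+

lemma eigen_tilde0_action:
  assumes A: "A \<in> eigen_tilde0 m" and B: "B \<in> eigen_skew m R"
    and R: "mid_blocks m O R \<union> R O mid_blocks m \<subseteq> S"
  shows "A * B - B * A \<in> eigen_skew m S"
proof -
  have "A \<in> eigen_skew m (mid_blocks m)" using A by (simp add: eigen_tilde0_def)
  then show ?thesis using eigen_skew_bracket[OF _ B] eigen_skew_mono[OF R] by blast
qed

lemma \<gg>_grade_0_module: "lie_module CC (\<gg>_tilde0 (m + 2)) (\<gg>_grade (m + 2) 0) (lie_bracket (\<gg> (m + 2)))"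
  unfolding \<gg>_grade_conv
proof (intro \<gg>_tilde0_module eigen_skew_submodule eigen_tilde0_action)
  have "mid_blocks m \<subseteq> grade_support m 0" using support_grade_0(1,2)[of m] by blast
  then show "mid_blocks m O grade_support m 0 \<union> grade_support m 0 O mid_blocks m \<subseteq> grade_support m 0"
    using grade_support_0_comp[of m] by blast
qed

text \<open>The column \<open>r\<close> along the block serves as coordinates; as \<open>r\<close>
  is self-dual, skewness turns this column into the row \<open>r\<close>, which carries no further
  freedom.\<close>

lemma cross_coords:
  assumes c: "c + m \<le> 2 * m + 4" "r < 2 * m + 4" "\<not> in_block m c r" "eigen_dual m r = r"
    and \<rho>: "\<And>i. i < m \<Longrightarrow> m - 1 - i < m \<and> eigen_dual m (c + i) = c + (m - 1 - i)"
  shows "bij_betw (\<lambda>W. vec m (\<lambda>k. W $$ (c + k, r))) (eigen_skew m (cross m c r)) (carrier_vec m)"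
proof (rule skew_on_coords[OF involution_eigen_dual, where e = "\<lambda>k. (c + k, r)" and F = "{(i, j). in_block m c i \<and> j = r}"])
  show "bij_betw (\<lambda>k. (c + k, r)) {..<m} {(i, j). in_block m c i \<and> j = r}"
    unfolding bij_betw_def by (auto simp: inj_on_def image_iff elim!: in_blockE)
  have d: "in_block m c (eigen_dual m i)" if "in_block m c i" for i
  proof -
    from that obtain a where a: "i = c + a" "a < m" by (rule in_blockE)
    show ?thesis unfolding a(1) using \<rho>[OF a(2)] by (simp only: in_block_add)
  qed
  fix i j
  show "i < 2 * m + 4 \<and> j < 2 * m + 4 \<and> (i, j) \<in> cross m c r \<and> (eigen_dual m j, eigen_dual m i) \<in> cross m c r \<and>
      (eigen_dual m j, eigen_dual m i) \<notin> {(i, j). in_block m c i \<and> j = r}" if "(i, j) \<in> {(i, j). in_block m c i \<and> j = r}"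
    using that c d[of i] by (auto simp: cross_def in_block_def)
  show "(i, j) \<in> {(i, j). in_block m c i \<and> j = r} \<or> (eigen_dual m j, eigen_dual m i) \<in> {(i, j). in_block m c i \<and> j = r}"
    if "(i, j) \<in> cross m c r"
    using that c(4) d[of j] by (auto simp: cross_def)
qed

lemma cross_module:
  assumes c: "c = 1 \<and> r = 0 \<or> c = m + 2 \<and> r = m + 1"
  shows "lie_module_isomorphic CC (\<gg>_tilde0 (m + 2)) (gl_on (2 * m + 4) (eigen_pre m (eigen_skew m (cross m c r))))
      (lie_bracket (\<gg> (m + 2))) (module_vec TYPE(complex) m) (vector_act (m + 2))"
    and "has_dim CC (gl_on (2 * m + 4) (eigen_pre m (eigen_skew m (cross m c r)))) m"
proof -
  let ?N = "2 * m + 4" and ?W = "eigen_skew m (cross m c r)"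
  define g where "g W = vec m (\<lambda>k. W $$ (c + k, r))" for W :: "complex mat"
  have c1: "c + m \<le> ?N" "r < ?N" "\<not> in_block m c r" "eigen_dual m r = r" "c = 1 \<or> c = m + 2"
    using c by (auto simp: in_block_def eigen_dual_def)
  have \<rho>: "m - 1 - i < m \<and> eigen_dual m (c + i) = c + (m - 1 - i)" if "i < m" for i
    using c1(5) eigen_dual_block[OF that] by auto
  have bij: "bij_betw g ?W (carrier_vec m)"
    unfolding g_def by (rule cross_coords[OF c1(1-4) \<rho>])
  have hom: "g \<in> lin_hom CC (gl_on ?N ?W) (module_vec TYPE(complex) m)"
    unfolding g_def using skew_on_coords_hom[of m "\<lambda>k. (c + k, r)" ?N "eigen_dual m" "cross m c r"] c1 by simp
  have fh: "g \<circ> to_eigen m \<in> lin_hom CC (gl_on ?N (eigen_pre m ?W)) (module_vec TYPE(complex) m)"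
    by (rule module_hom_comp[OF eigen_pre_hom hom])
  have fb: "bij_betw (g \<circ> to_eigen m) (eigen_pre m ?W) (carrier_vec m)"
    by (intro bij_betw_trans[OF eigen_pre_bij bij] eigen_skew_mono) simp
  show "has_dim CC (gl_on ?N (eigen_pre m ?W)) m"
    by (rule has_dim_vec[OF _ fh]) (use fb in \<open>simp_all add: gl_sub_vectorspace eigen_pre_submodule eigen_skew_submodule\<close>)
  show "lie_module_isomorphic CC (\<gg>_tilde0 (m + 2)) (gl_on ?N (eigen_pre m ?W))
      (lie_bracket (\<gg> (m + 2))) (module_vec TYPE(complex) m) (vector_act (m + 2))"
  proof (rule lie_module_isomorphicI[OF _ vec_vs fh])
    show "lie_module CC (\<gg>_tilde0 (m + 2)) (gl_on ?N (eigen_pre m ?W)) (lie_bracket (\<gg> (m + 2)))"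
    proof (rule \<gg>_tilde0_module[OF eigen_skew_submodule])
      have "mid_blocks m O cross m c r \<union> cross m c r O mid_blocks m \<subseteq> cross m c r"
        using c support_action(1,2)[of m] by blast
      then show "A * B - B * A \<in> ?W" if "A \<in> eigen_tilde0 m" "B \<in> ?W" for A B
        using eigen_tilde0_action[OF that] by blast
    qed
    show "bij_betw (g \<circ> to_eigen m) (carrier (gl_on ?N (eigen_pre m ?W))) (carrier (module_vec TYPE(complex) m))"
      using fb by (simp add: module_vec_simps)
    fix x v assume x: "x \<in> carrier (\<gg>_tilde0 (m + 2))" and "v \<in> carrier (gl_on ?N (eigen_pre m ?W))"
    then have v: "v \<in> carrier (\<gg> (m + 2))" "to_eigen m v \<in> ?W" by (auto simp: eigen_pre_def)
    have xg: "x \<in> carrier (\<gg> (m + 2))" and xT: "to_eigen m x \<in> eigen_tilde0 m"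
      using x unfolding \<gg>_tilde0_conv eigen_pre_def by auto
    let ?x = "to_eigen m x" and ?v = "to_eigen m v"
    have xs: "?x \<in> eigen_skew m (mid_blocks m)" using xT by (simp add: eigen_tilde0_def)
    have mb: "get_block m c ?x = mid_block (m + 2) x" using to_eigen_mid_block(1,2)[OF x] c1(5) by blast
    have "g (?x * ?v - ?v * ?x) = mid_block (m + 2) x *\<^sub>v g ?v"
    proof (rule eq_vecI)
      fix i assume "i < dim_vec (mid_block (m + 2) x *\<^sub>v g ?v)"
      then have i: "i < m" by (simp add: mid_block_conv)
      then have ci: "c + i < ?N" using c1 by simp
      \<comment> \<open>The index \<open>r\<close> lies in neither block, so \<open>?x\<close> has a
        zero column there. On the coordinate column the bracket reduces to left multiplication by
        the block of \<open>?x\<close>, the vector representation.\<close>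
      have "(?v * ?x) $$ (c + i, r) = (\<Sum>a = 0..<?N. ?v $$ (c + i, a) * ?x $$ (a, r))"
        by (rule index_mult_mat_sum[OF to_eigen_carrier to_eigen_carrier ci c1(2)])
      also have "\<dots> = 0"
      proof (intro sum.neutral ballI)
        fix a assume "a \<in> {0..<?N}"
        moreover have "(a, r) \<notin> mid_blocks m" using c by (auto simp: block_def in_block_def)
        ultimately have "?x $$ (a, r) = 0" using skew_onD(3)[OF xs _ c1(2)] by simp
        then show "?v $$ (c + i, a) * ?x $$ (a, r) = 0" by simp
      qed
      finally have vx: "(?v * ?x) $$ (c + i, r) = 0" .
      have "(?x * ?v) $$ (c + i, r) = (\<Sum>a = 0..<?N. ?x $$ (c + i, a) * ?v $$ (a, r))"
        by (rule index_mult_mat_sum[OF to_eigen_carrier to_eigen_carrier ci c1(2)])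
      also have "\<dots> = (\<Sum>a = 0..<m. ?x $$ (c + i, c + a) * ?v $$ (c + a, r))"
        using eigen_tilde0_mult_zero[OF xT _ c1(5), of "c + i"] i by (intro sum_in_block[OF c1(1)]) simp
      also have "\<dots> = (\<Sum>a = 0..<m. mid_block (m + 2) x $$ (i, a) * g ?v $ a)"
        using i by (intro sum.cong) (auto simp: mb[symmetric] g_def)
      also have "\<dots> = (mid_block (m + 2) x *\<^sub>v g ?v) $ i"
        using i by (simp add: mid_block_conv scalar_prod_def g_def)
      finally have xv: "(?x * ?v) $$ (c + i, r) = (mid_block (m + 2) x *\<^sub>v g ?v) $ i" .
      have "(?x * ?v - ?v * ?x) $$ (c + i, r) = (?x * ?v) $$ (c + i, r) - (?v * ?x) $$ (c + i, r)"
        using ci c1(2) carrier_matD[OF to_eigen_carrier[of m x]] carrier_matD[OF to_eigen_carrier[of m v]]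
        by (simp del: index_mult_mat(1))
      then show "g (?x * ?v - ?v * ?x) $ i = (mid_block (m + 2) x *\<^sub>v g ?v) $ i"
        using i xv vx by (simp add: g_def)
    qed (simp add: g_def mid_block_conv)
    then show "(g \<circ> to_eigen m) (lie_bracket (\<gg> (m + 2)) x v) = vector_act (m + 2) x ((g \<circ> to_eigen m) v)"
      using to_eigen_bracket[OF \<gg>_carrierD[OF xg] \<gg>_carrierD[OF v(1)]]
      by (simp add: \<gg>_bracket gl_simps vector_act_def)
  qed
qed

lemma corner_module:
  shows "lie_module_isomorphic CC (\<gg>_tilde0 (m + 2)) (gl_on (2 * m + 4) (eigen_pre m (eigen_skew m (corner m))))
      (lie_bracket (\<gg> (m + 2))) abelian_C (\<lambda>x v. 0)"
    and "has_dim CC (gl_on (2 * m + 4) (eigen_pre m (eigen_skew m (corner m)))) 1"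
proof -
  let ?N = "2 * m + 4" and ?W = "eigen_skew m (corner m)"
  define g where "g W = vec 1 (\<lambda>k. W $$ (2 * m + 2, 2 * m + 2))" for W :: "complex mat"
  have bij: "bij_betw g ?W (carrier_vec 1)"
    unfolding g_def
  proof (rule skew_on_coords[OF involution_eigen_dual, where e = "\<lambda>k. (2 * m + 2, 2 * m + 2)" and F = "{(2 * m + 2, 2 * m + 2)}"])
    show "bij_betw (\<lambda>k. (2 * m + 2, 2 * m + 2)) {..<1 :: nat} {(2 * m + 2, 2 * m + 2)}"
      by (rule bij_betwI[where g = "\<lambda>_. 0"]) auto
  qed (auto simp: corner_def eigen_dual_simps)
  have hom: "g \<in> lin_hom CC (gl_on ?N ?W) (module_vec TYPE(complex) 1)"
    unfolding g_def using skew_on_coords_hom[of 1 "\<lambda>k. (2 * m + 2, 2 * m + 2)" ?N "eigen_dual m" "corner m"] by simp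
  have fh: "g \<circ> to_eigen m \<in> lin_hom CC (gl_on ?N (eigen_pre m ?W)) (module_vec TYPE(complex) 1)"
    by (rule module_hom_comp[OF eigen_pre_hom hom])
  have fb: "bij_betw (g \<circ> to_eigen m) (eigen_pre m ?W) (carrier_vec 1)"
    by (intro bij_betw_trans[OF eigen_pre_bij bij] eigen_skew_mono) simp
  show "has_dim CC (gl_on ?N (eigen_pre m ?W)) 1"
    by (rule has_dim_vec[OF _ fh]) (use fb in \<open>simp_all add: gl_sub_vectorspace eigen_pre_submodule eigen_skew_submodule\<close>)
  have vb: "bij_betw (\<lambda>v. v $ 0) (carrier_vec 1) (UNIV :: complex set)"
    by (rule bij_betwI[where g = "\<lambda>c. vec 1 (\<lambda>k. c)"]) (auto intro!: eq_vecI)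
  have vh: "(\<lambda>v. v $ 0) \<in> lin_hom CC (module_vec TYPE(complex) 1) abelian_C"
    by (auto simp: LinearCombinations.module_hom_def module_vec_simps abelian_C_def)
  show "lie_module_isomorphic CC (\<gg>_tilde0 (m + 2)) (gl_on ?N (eigen_pre m ?W))
      (lie_bracket (\<gg> (m + 2))) abelian_C (\<lambda>x v. 0)"
  proof (rule lie_module_isomorphicI[OF _ _ module_hom_comp[OF fh vh]])
    \<comment> \<open>Empty support means that the bracket vanishes, hence the action is
      trivial.\<close>
    have act: "A * B - B * A \<in> eigen_skew m {}" if "A \<in> eigen_tilde0 m" "B \<in> ?W" for A B
      using eigen_tilde0_action[OF that, of "{}"] support_action(3)[of m] by simp
    show "lie_module CC (\<gg>_tilde0 (m + 2)) (gl_on ?N (eigen_pre m ?W)) (lie_bracket (\<gg> (m + 2)))"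
    proof (rule \<gg>_tilde0_module[OF eigen_skew_submodule])
      show "A * B - B * A \<in> ?W" if "A \<in> eigen_tilde0 m" "B \<in> ?W" for A B
        using act[OF that] eigen_skew_mono[of "{}" "corner m" m] by auto
    qed
    show "vectorspace CC abelian_C" using lie_algebra_abelian_C by (rule lie_algebra.axioms)
    show "bij_betw ((\<lambda>v. v $ 0) \<circ> (g \<circ> to_eigen m)) (carrier (gl_on ?N (eigen_pre m ?W))) (carrier abelian_C)"
      using bij_betw_trans[OF fb vb] by (simp add: abelian_C_def)
    fix x v assume "x \<in> carrier (\<gg>_tilde0 (m + 2))" "v \<in> carrier (gl_on ?N (eigen_pre m ?W))"
    then have x: "x \<in> carrier (\<gg> (m + 2))" "to_eigen m x \<in> eigen_tilde0 m" and v: "v \<in> carrier (\<gg> (m + 2))" "to_eigen m v \<in> ?W"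
      unfolding \<gg>_tilde0_conv by (auto simp: eigen_pre_def)
    have "to_eigen m (x * v - v * x) \<in> eigen_skew m {}"
      unfolding to_eigen_bracket[OF \<gg>_carrierD[OF x(1)] \<gg>_carrierD[OF v(1)]] by (rule act[OF x(2) v(2)])
    then have "to_eigen m (x * v - v * x) $$ (2 * m + 2, 2 * m + 2) = 0"
      by (rule skew_onD(3)) simp_all
    then show "((\<lambda>v. v $ 0) \<circ> (g \<circ> to_eigen m)) (lie_bracket (\<gg> (m + 2)) x v) = 0"
      by (simp add: g_def \<gg>_bracket gl_simps)
  qed
qed

lemma diag_emb_lie_iso: "diag_emb \<in> lie_iso CC (so_form m (antidiag m)) (\<gg>_tilde0 (m + 2))"
proof (rule lie_iso_inverse[OF \<gg>_tilde0_lie_algebra mid_block_lie_iso])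
  fix X assume "X \<in> carrier (so_form m (antidiag m))"
  then have X: "X \<in> skew_on m (\<lambda>i. m - 1 - i) UNIV" by (simp only: so_antidiag_carrier)
  then show "diag_emb X \<in> carrier (\<gg>_tilde0 (m + 2)) \<and> mid_block (m + 2) (diag_emb X) = X"
    using mid_block_diag_emb[OF skew_onD(1)[OF X]] unfolding \<gg>_tilde0_carrier by blast
qed

lemma eigen_block_zero:
  assumes W: "W \<in> eigen_skew m (block m (m + 2))" and "in_block m (m + 2) i" "a < 2 * m + 4" "\<not> in_block m (m + 2) a"
  shows "W $$ (i, a) = 0"
proof -
  have "i < 2 * m + 4" "(i, a) \<notin> block m (m + 2)" using assms(2,4) by (auto simp: in_block_def block_def)
  then show ?thesis using skew_onD(3)[OF W] assms(3) by blast
qed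

lemma adjoint_module:
  shows "lie_module_isomorphic CC (\<gg>_tilde0 (m + 2)) (gl_on (2 * m + 4) (eigen_pre m (eigen_skew m (block m (m + 2)))))
      (lie_bracket (\<gg> (m + 2))) (\<gg>_tilde0 (m + 2)) (lie_bracket (\<gg> (m + 2)))"
    and "has_dim CC (gl_on (2 * m + 4) (eigen_pre m (eigen_skew m (block m (m + 2))))) (m * (m - 1) div 2)"
proof -
  let ?N = "2 * m + 4" and ?W = "eigen_skew m (block m (m + 2))" and ?X = "skew_on m (\<lambda>i. m - 1 - i) UNIV"
  let ?g = "get_block m (m + 2)"
  have wc: "W \<in> carrier_mat ?N ?N" if "W \<in> ?W" for W using skew_onD(1)[OF that] .
  have gX: "?g W \<in> ?X" if "W \<in> ?W" for W
    by (rule get_block_skew_on[OF that _ eigen_dual_block(2)]) simp_all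
  have gbij: "bij_betw ?g ?W ?X"
  proof (rule bij_betwI[where g = "put_block ?N m (m + 2)"])
    show "?g \<in> ?W \<rightarrow> ?X" using gX by blast
    show "put_block ?N m (m + 2) \<in> ?X \<rightarrow> ?W"
      by (rule funcsetI, rule put_block_skew_on[OF involution_eigen_dual _ eigen_dual_block(2)])
    show "put_block ?N m (m + 2) (?g W) = W" if "W \<in> ?W" for W using put_get_block[OF that] .
    show "?g (put_block ?N m (m + 2) X) = X" if "X \<in> ?X" for X
      using get_put_block[OF skew_onD(1)[OF that], of "m + 2" ?N] by simp
  qed
  have ghom: "?g \<in> lin_hom CC (gl_on ?N ?W) (so_form m (antidiag m))"
  proof -
    have "?g \<in> lin_hom CC (gl_on ?N ?W) (gl_on m ?X)"
      unfolding gl_sub_hom_iff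
    proof (intro conjI ballI allI)
      fix A B r assume A: "A \<in> ?W" and B: "B \<in> ?W"
      show "?g A \<in> ?X" by (rule gX[OF A])
      show "?g (A + B) = ?g A + ?g B" by (rule get_block_add[OF wc[OF A] wc[OF B]]) simp
      show "?g (r \<cdot>\<^sub>m A) = r \<cdot>\<^sub>m ?g A" by (rule get_block_smult[OF wc[OF A]]) simp
    qed
    moreover have "so_form m (antidiag m) = gl_on m ?X"
      unfolding so_antidiag_carrier[symmetric] by (simp add: so_form_def)
    ultimately show ?thesis by simp
  qed
  note d = diag_emb_lie_iso[of m, unfolded lie_iso_def mem_Collect_eq so_antidiag_carrier]
  have dhom: "diag_emb \<in> lin_hom CC (so_form m (antidiag m)) (\<gg>_tilde0 (m + 2))"
    and dbij: "bij_betw diag_emb ?X (carrier (\<gg>_tilde0 (m + 2)))"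
    by (rule d[THEN conjunct1], rule d[THEN conjunct2, THEN conjunct1])
  have dbr: "diag_emb (X * Y - Y * X) = diag_emb X * diag_emb Y - diag_emb Y * diag_emb X" if "X \<in> ?X" "Y \<in> ?X" for X Y
  proof -
    have "diag_emb (lie_bracket (so_form m (antidiag m)) X Y) = lie_bracket (\<gg>_tilde0 (m + 2)) (diag_emb X) (diag_emb Y)"
      by (rule d[THEN conjunct2, THEN conjunct2, rule_format, OF that])
    then show ?thesis by (simp add: so_form_eq \<gg>_tilde0_update gl_simps)
  qed
  \<comment> \<open>Reads off the second block and embeds it diagonally. An element of
    \<open>\<gg>_tilde0\<close> acts on that block by the commutator with its own \<open>X\<close>,
    which \<open>diag_emb\<close> turns into the adjoint action.\<close>
  define f where "f = diag_emb \<circ> (?g \<circ> to_eigen m)"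
  have fh: "f \<in> lin_hom CC (gl_on ?N (eigen_pre m ?W)) (\<gg>_tilde0 (m + 2))"
    unfolding f_def by (intro module_hom_comp[OF module_hom_comp[OF eigen_pre_hom ghom] dhom])
  have "bij_betw (to_eigen m) (eigen_pre m ?W) ?W" by (intro eigen_pre_bij eigen_skew_mono) simp
  then have fb: "bij_betw f (eigen_pre m ?W) (carrier (\<gg>_tilde0 (m + 2)))"
    unfolding f_def by (intro bij_betw_trans[OF bij_betw_trans[OF _ gbij] dbij])
  show "lie_module_isomorphic CC (\<gg>_tilde0 (m + 2)) (gl_on ?N (eigen_pre m ?W))
      (lie_bracket (\<gg> (m + 2))) (\<gg>_tilde0 (m + 2)) (lie_bracket (\<gg> (m + 2)))"
  proof (rule lie_module_isomorphicI[OF _ _ fh])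
    show "lie_module CC (\<gg>_tilde0 (m + 2)) (gl_on ?N (eigen_pre m ?W)) (lie_bracket (\<gg> (m + 2)))"
      by (intro \<gg>_tilde0_module eigen_skew_submodule) (rule eigen_tilde0_action[OF _ _ support_action(4)])
    show "vectorspace CC (\<gg>_tilde0 (m + 2))" using \<gg>_tilde0_lie_algebra by (rule lie_algebra.axioms)
    show "bij_betw f (carrier (gl_on ?N (eigen_pre m ?W))) (carrier (\<gg>_tilde0 (m + 2)))" using fb by simp
    fix x v assume x: "x \<in> carrier (\<gg>_tilde0 (m + 2))" and "v \<in> carrier (gl_on ?N (eigen_pre m ?W))"
    then have v: "v \<in> carrier (\<gg> (m + 2))" "to_eigen m v \<in> ?W" by (auto simp: eigen_pre_def)
    have xg: "x \<in> carrier (\<gg> (m + 2))" and xT: "to_eigen m x \<in> eigen_tilde0 m"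
      using x unfolding \<gg>_tilde0_conv eigen_pre_def by auto
    note X = to_eigen_mid_block[OF x]
    have "?g (to_eigen m (x * v - v * x)) = ?g (to_eigen m x) * ?g (to_eigen m v) - ?g (to_eigen m v) * ?g (to_eigen m x)"
      unfolding to_eigen_bracket[OF \<gg>_carrierD[OF xg] \<gg>_carrierD[OF v(1)]]
      using eigen_tilde0_mult_zero[OF xT] eigen_block_zero[OF v(2)]
      by (intro get_block_bracket[OF to_eigen_carrier to_eigen_carrier]) simp_all
    then have "f (x * v - v * x) = diag_emb (mid_block (m + 2) x) * f v - f v * diag_emb (mid_block (m + 2) x)"
      using dbr[OF X(4) gX[OF v(2)]] by (simp add: f_def X(2))
    then show "f (lie_bracket (\<gg> (m + 2)) x v) = lie_bracket (\<gg> (m + 2)) x (f v)"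
      unfolding X(3)[symmetric] by (simp add: \<gg>_bracket gl_simps)
  qed
  show "has_dim CC (gl_on ?N (eigen_pre m ?W)) (m * (m - 1) div 2)"
  proof (rule eigen_pre_has_dim)
    have "i < k \<and> k < ?N \<and> (i, eigen_dual m k) \<in> block m (m + 2) \<longleftrightarrow>
        i \<in> {m + 2..<m + 2 + m} \<and> k \<in> {m + 2..<m + 2 + m} \<and> i < k" for i k
    proof (cases "k < ?N")
      case True
      have "(i, eigen_dual m k) \<in> block m (m + 2) \<longleftrightarrow> in_block m (m + 2) i \<and> in_block m (m + 2) k"
        by (simp only: block_def mem_Collect_eq prod.case in_block_dual(2)[OF True])
      then show ?thesis using True unfolding in_block_def by auto
    qed auto
    then have "{(i, k). i < k \<and> k < ?N \<and> (i, eigen_dual m k) \<in> block m (m + 2)} =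
        {(i, j). i \<in> {m + 2..<m + 2 + m} \<and> j \<in> {m + 2..<m + 2 + m} \<and> i < j}" by (simp only:)
    then show "card {(i, k). i < k \<and> k < ?N \<and> (i, eigen_dual m k) \<in> block m (m + 2)} = m * (m - 1) div 2"
      using card_pairs_less[of "{m + 2..<m + 2 + m}"] by simp
  qed (simp add: support_dual)
qed

section \<open>The isomorphism type of the fixed point algebra\<close>

text \<open>The involution that \<open>eigen_dual m\<close> induces on each of the two eigenspaces
  of dimension \<open>m + 1\<close>: a self-dual vector followed by a reversed range of length
  \<open>m\<close>.\<close>

definition half_dual :: "nat \<Rightarrow> nat \<Rightarrow> nat"
  where "half_dual m i = (if i = 0 then 0 else m + 1 - i)"

lemma involution_half_dual: "involution_below (m + 1) (half_dual m)"
  by (auto simp: involution_below_def half_dual_def)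

lemma eigen_dual_half:
  assumes "i < m + 1"
  shows "half_dual m i < m + 1 \<and> eigen_dual m (0 + i) = 0 + half_dual m i"
    "half_dual m i < m + 1 \<and> eigen_dual m (m + 1 + i) = m + 1 + half_dual m i"
proof -
  have "i = 0 \<or> (\<exists>k<m. i = Suc k)" using assms by (cases i) auto
  then show "half_dual m i < m + 1 \<and> eigen_dual m (0 + i) = 0 + half_dual m i"
    "half_dual m i < m + 1 \<and> eigen_dual m (m + 1 + i) = m + 1 + half_dual m i"
    using eigen_dual_simps(2,4)[of _ m] by (auto simp: half_dual_def eigen_dual_simps add_2_eq_Suc')
qed

lemma grade_0_block_zero:
  assumes W: "W \<in> eigen_skew m (grade_support m 0)" and c: "c = 0 \<or> c = m + 1"
    and i: "in_block (m + 1) c i" and a: "a < 2 * m + 4" "\<not> in_block (m + 1) c a"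
  shows "W $$ (i, a) = 0"
proof -
  have i': "i < 2 * m + 4" using c i by (auto simp: in_block_def)
  have "eigenvalue m i \<noteq> eigenvalue m a"
    using c
  proof
    assume "c = 0"
    then have "eigenvalue m i = 1" "m + 1 \<le> a" using i a by (auto simp: in_block_def eigenvalue_def)
    then show ?thesis by - (rule eigenvalue_cases[OF a(1)]; simp add: complex_eq_iff)
  next
    assume "c = m + 1"
    then have "eigenvalue m i = - 1" "a < m + 1 \<or> 2 * m + 2 \<le> a" using i a by (auto simp: in_block_def eigenvalue_def)
    then show ?thesis by - (rule eigenvalue_cases[OF a(1)]; auto simp: complex_eq_iff)
  qed
  then have "(i, a) \<notin> grade_support m 0" by (simp add: grade_support_def)
  then show ?thesis using skew_onD(3)[OF W i' a(1)] by blast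
qed

lemma grade_0_corner_zero:
  assumes W: "W \<in> eigen_skew m (grade_support m 0)" and i: "in_block 1 (2 * m + 2) i" and a: "a < 2 * m + 4" "\<not> in_block 1 (2 * m + 2) a"
  shows "W $$ (i, a) = 0"
proof -
  have i': "i = 2 * m + 2" and a': "a \<noteq> 2 * m + 2" using i a by (auto simp: in_block_def)
  have "eigenvalue m a \<noteq> \<i>" using a' by - (rule eigenvalue_cases[OF a(1)]; simp add: complex_eq_iff)
  then have "(i, a) \<notin> grade_support m 0" unfolding i' by (simp add: grade_support_def eigenvalue_simps)
  then show ?thesis using skew_onD(3)[OF W _ a(1)] i' by simp
qed

text \<open>Equality of eigenvalues cuts matrices of grade 0 into blocks of sizes
  \<open>m + 1\<close>, \<open>m + 1\<close>, 1 and 1. Skewness couples the last two, so one of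
  their entries is enough as the abelian component.\<close>

lemma grade_0_blocks_lie_iso:
  fixes m :: nat
  defines "Q \<equiv> so_form (m + 1) (perm_mat (m + 1) (half_dual m))"
  shows "(\<lambda>W. ((get_block (m + 1) 0 W, get_block (m + 1) (m + 1) W), W $$ (2 * m + 2, 2 * m + 2))) \<in>
    lie_iso CC (gl_on (2 * m + 4) (eigen_skew m (grade_support m 0))) (lie_direct_sum (lie_direct_sum Q Q) abelian_C)"
    (is "?h \<in> lie_iso CC (gl_on ?N ?V) ?M")
proof (rule lie_isoI)
  let ?X = "skew_on (m + 1) (half_dual m) UNIV"
  have Qc: "carrier Q = ?X"
    unfolding Q_def by (rule so_form_perm_mat_carrier[OF involution_half_dual])
  have Mc: "carrier ?M = (?X \<times> ?X) \<times> UNIV" by (simp add: lie_direct_sum_simps Qc abelian_C_def)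
  have Vc: "W \<in> carrier_mat ?N ?N" if "W \<in> ?V" for W using skew_onD(1)[OF that] .
  have gX: "get_block (m + 1) 0 W \<in> ?X" "get_block (m + 1) (m + 1) W \<in> ?X" if "W \<in> ?V" for W
    using eigen_dual_half[of _ m] by (intro get_block_skew_on[OF that]; simp)+
  show "?h \<in> lin_hom CC (gl_on ?N ?V) ?M"
  proof -
    have "?h (A + B) = ?h A \<oplus>\<^bsub>?M\<^esub> ?h B" if "A \<in> ?V" "B \<in> ?V" for A B
      using Vc[OF that(1)] Vc[OF that(2)] get_block_add[OF Vc[OF that(1)] Vc[OF that(2)], of 0 "m + 1"]
        get_block_add[OF Vc[OF that(1)] Vc[OF that(2)], of "m + 1" "m + 1"]
      by (simp add: lie_direct_sum_simps Q_def so_form_eq gl_simps abelian_C_def)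
    moreover have "?h (r \<cdot>\<^sub>m A) = r \<odot>\<^bsub>?M\<^esub> ?h A" if "A \<in> ?V" for r A
      using Vc[OF that] get_block_smult[OF Vc[OF that], of 0 "m + 1"] get_block_smult[OF Vc[OF that], of "m + 1" "m + 1"]
      by (simp add: lie_direct_sum_simps Q_def so_form_eq gl_simps abelian_C_def)
    moreover have "?h A \<in> carrier ?M" if "A \<in> ?V" for A
      unfolding Mc using gX[OF that] by simp
    ultimately show ?thesis
      unfolding LinearCombinations.module_hom_def by (simp add: gl_simps)
  qed
  show "?h (lie_bracket (gl_on ?N ?V) A B) = lie_bracket ?M (?h A) (?h B)"
    if "A \<in> carrier (gl_on ?N ?V)" "B \<in> carrier (gl_on ?N ?V)" for A B
  proof -
    have A: "A \<in> ?V" and B: "B \<in> ?V" using that by auto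
    have "get_block (m + 1) c (A * B - B * A) = get_block (m + 1) c A * get_block (m + 1) c B - get_block (m + 1) c B * get_block (m + 1) c A"
      if "c = 0 \<or> c = m + 1" for c
      using grade_0_block_zero[OF A that] grade_0_block_zero[OF B that] that
      by (intro get_block_bracket[OF Vc[OF A] Vc[OF B]]) auto
    \<comment> \<open>Restricted to the block of size 1, the bracket is a commutator of
      scalars.\<close>
    moreover have "(A * B - B * A) $$ (2 * m + 2, 2 * m + 2) = 0"
    proof -
      have "get_block 1 (2 * m + 2) (A * B - B * A) =
          get_block 1 (2 * m + 2) A * get_block 1 (2 * m + 2) B - get_block 1 (2 * m + 2) B * get_block 1 (2 * m + 2) A"
        using grade_0_corner_zero[OF A] grade_0_corner_zero[OF B]
        by (intro get_block_bracket[OF Vc[OF A] Vc[OF B]]) auto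
      then have "get_block 1 (2 * m + 2) (A * B - B * A) $$ (0, 0) =
          (get_block 1 (2 * m + 2) A * get_block 1 (2 * m + 2) B - get_block 1 (2 * m + 2) B * get_block 1 (2 * m + 2) A) $$ (0, 0)"
        by (rule arg_cong)
      then show ?thesis by (simp add: get_block_def scalar_prod_def)
    qed
    ultimately show ?thesis by (simp add: lie_direct_sum_simps Q_def so_form_eq gl_simps abelian_C_def)
  qed
  have inj: "inj_on ?h ?V"
  proof (rule inj_onI)
    fix A B assume A: "A \<in> ?V" and B: "B \<in> ?V" and eq: "?h A = ?h B"
    have b: "A $$ (c + i, c + j) = B $$ (c + i, c + j)" if "c = 0 \<or> c = m + 1" "i < m + 1" "j < m + 1" for c i j
    proof -
      have "get_block (m + 1) c A $$ (i, j) = get_block (m + 1) c B $$ (i, j)" using eq that(1) by auto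
      then show ?thesis using that(2,3) by simp
    qed
    have c2: "A $$ (2 * m + 2, 2 * m + 2) = B $$ (2 * m + 2, 2 * m + 2)" using eq by simp
    \<comment> \<open>This position is dual to the previous one, so its entry is the
      negative.\<close>
    have c3: "A $$ (2 * m + 3, 2 * m + 3) = B $$ (2 * m + 3, 2 * m + 3)"
      using c2 skew_onD(2)[OF A, of "2 * m + 3" "2 * m + 3"] skew_onD(2)[OF B, of "2 * m + 3" "2 * m + 3"]
      by (simp add: eigen_dual_simps)
    show "A = B"
    proof (rule eq_matI)
      fix i j assume "i < dim_row B" "j < dim_col B"
      then have ij: "i < ?N" "j < ?N" using Vc[OF B] by auto
      show "A $$ (i, j) = B $$ (i, j)"
      proof (cases "(i, j) \<in> grade_support m 0")
        case False
        then show ?thesis using skew_onD(3)[OF A ij] skew_onD(3)[OF B ij] by simp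
      next
        case True
        then have e: "eigenvalue m i = eigenvalue m j" by (simp add: grade_support_def)
        show ?thesis
        proof (rule eigenvalue_cases[OF ij(1)])
          assume i: "i < m + 1" "eigenvalue m i = 1"
          have "j < m + 1" by (rule eigenvalue_cases[OF ij(2)]) (use i e in \<open>simp_all add: complex_eq_iff\<close>)
          then show ?thesis using b[of 0 i j] i by simp
        next
          assume i: "m + 1 \<le> i" "i < 2 * m + 2" "eigenvalue m i = - 1"
          have "m + 1 \<le> j \<and> j < 2 * m + 2"
            by (rule eigenvalue_cases[OF ij(2)]) (use i e in \<open>simp_all add: complex_eq_iff\<close>)
          then have "i - (m + 1) < m + 1" "j - (m + 1) < m + 1" "m + 1 + (i - (m + 1)) = i" "m + 1 + (j - (m + 1)) = j"
            using i by auto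
          then show ?thesis using b[of "m + 1" "i - (m + 1)" "j - (m + 1)"] by simp
        next
          assume i: "i = 2 * m + 2" "eigenvalue m i = \<i>"
          have "j = 2 * m + 2" by (rule eigenvalue_cases[OF ij(2)]) (use i e in \<open>simp_all add: complex_eq_iff\<close>)
          then show ?thesis using c2 i by simp
        next
          assume i: "i = 2 * m + 3" "eigenvalue m i = - \<i>"
          have "j = 2 * m + 3" by (rule eigenvalue_cases[OF ij(2)]) (use i e in \<open>simp_all add: complex_eq_iff\<close>)
          then show ?thesis using c3 i by simp
        qed
      qed
    qed (use Vc[OF A] Vc[OF B] in auto)
  qed
  have surj: "carrier ?M \<subseteq> ?h ` ?V"
  proof
    fix y assume "y \<in> carrier ?M"
    then obtain A B z where y: "y = ((A, B), z)" and A: "A \<in> ?X" and B: "B \<in> ?X" unfolding Mc by auto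
    \<comment> \<open>The preimage of the scalar \<open>z\<close>: skewness forces
      \<open>- z\<close> on the other line.\<close>
    define C where "C = mat ?N ?N (\<lambda>(i, j). if i = 2 * m + 2 \<and> j = 2 * m + 2 then z else if i = 2 * m + 3 \<and> j = 2 * m + 3 then - z else 0)"
    have C: "C \<in> eigen_skew m (corner m)"
    proof -
      have w: "C $$ (i, j) = (if i = 2 * m + 2 \<and> j = 2 * m + 2 then z else if i = 2 * m + 3 \<and> j = 2 * m + 3 then - z else 0)"
        if "i < ?N" "j < ?N" for i j
        unfolding C_def using that by simp
      have "C $$ (i, j) = - C $$ (eigen_dual m j, eigen_dual m i)" if ij: "i < ?N" "j < ?N" for i j
        unfolding w[OF ij] w[OF involution_belowD(1)[OF involution_eigen_dual ij(2)] involution_belowD(1)[OF involution_eigen_dual ij(1)]]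
          in_block_dual(5,6)[OF ij(1)] in_block_dual(5,6)[OF ij(2)]
        by simp
      moreover have "C $$ (i, j) = 0" if "i < ?N" "j < ?N" "(i, j) \<notin> corner m" for i j
        using that(3) unfolding w[OF that(1,2)] corner_def by auto
      moreover have "C \<in> carrier_mat ?N ?N" by (simp add: C_def)
      ultimately show ?thesis unfolding skew_on_def by blast
    qed
    have A': "put_block ?N (m + 1) 0 A \<in> eigen_skew m (block (m + 1) 0)"
      by (rule put_block_skew_on[OF involution_eigen_dual A eigen_dual_half(1)])
    have B': "put_block ?N (m + 1) (m + 1) B \<in> eigen_skew m (block (m + 1) (m + 1))"
      by (rule put_block_skew_on[OF involution_eigen_dual B eigen_dual_half(2)])
    have sub: "block (m + 1) 0 \<subseteq> grade_support m 0" "block (m + 1) (m + 1) \<subseteq> grade_support m 0"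
      by (auto simp: block_def in_block_def grade_support_def eigenvalue_def)
    define W where "W = put_block ?N (m + 1) 0 A + put_block ?N (m + 1) (m + 1) B + C"
    have W: "W \<in> ?V"
      unfolding W_def using A' B' C eigen_skew_mono[OF sub(1)] eigen_skew_mono[OF sub(2)] eigen_skew_mono[OF support_grade_0(5)]
      by (intro gl_submoduleD(3)[OF eigen_skew_submodule]) blast+
    have disj: "block (m + 1) 0 \<inter> block (m + 1) (m + 1) = {}" "block (m + 1) (m + 1) \<inter> block (m + 1) 0 = {}"
      "corner m \<inter> block (m + 1) 0 = {}" "corner m \<inter> block (m + 1) (m + 1) = {}"
      by (auto simp: block_def in_block_def corner_def)
    have Ac: "A \<in> carrier_mat (m + 1) (m + 1)" and Bc: "B \<in> carrier_mat (m + 1) (m + 1)" and Cc: "C \<in> carrier_mat ?N ?N"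
      using skew_onD(1)[OF A] skew_onD(1)[OF B] skew_onD(1)[OF C] by auto
    have s: "put_block ?N (m + 1) 0 A + put_block ?N (m + 1) (m + 1) B \<in> carrier_mat ?N ?N" by simp
    have n: "0 + (m + 1) \<le> ?N" "m + 1 + (m + 1) \<le> ?N" by simp_all
    have "get_block (m + 1) 0 W = A"
      unfolding W_def get_block_add[OF s Cc n(1)] get_block_add[OF put_block_carrier(1) put_block_carrier(1) n(1)]
        get_put_block[OF Ac n(1)] get_block_disjoint[OF B' n(1) disj(2)] get_block_disjoint[OF C n(1) disj(3)]
      using Ac by simp
    moreover have "get_block (m + 1) (m + 1) W = B"
      unfolding W_def get_block_add[OF s Cc n(2)] get_block_add[OF put_block_carrier(1) put_block_carrier(1) n(2)]
        get_put_block[OF Bc n(2)] get_block_disjoint[OF A' n(2) disj(1)] get_block_disjoint[OF C n(2) disj(4)]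
      using Bc by simp
    moreover have "W $$ (2 * m + 2, 2 * m + 2) = z"
      unfolding W_def by (simp add: index_put_block block_def in_block_def C_def)
    ultimately have "?h W = y" by (simp add: y)
    then show "y \<in> ?h ` ?V" using W by blast
  qed
  have "?h ` ?V \<subseteq> carrier ?M" unfolding Mc using gX by auto
  then show "bij_betw ?h (carrier (gl_on ?N ?V)) (carrier ?M)"
    using inj surj by (auto simp: bij_betw_def)
qed

lemma \<gg>_grade_0_lie_algebra: "lie_algebra CC (\<gg>_grade (m + 2) 0)"
  unfolding \<gg>_grade_conv
proof (intro gl_sub_lie_algebra eigen_pre_submodule eigen_skew_submodule)
  have br: "A * B - B * A \<in> eigen_skew m (grade_support m 0)"
    if "A \<in> eigen_skew m (grade_support m 0)" "B \<in> eigen_skew m (grade_support m 0)" for A B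
    using eigen_skew_bracket[OF that] eigen_skew_mono[OF grade_support_0_comp[of m]] by auto
  show "A * B - B * A \<in> eigen_pre m (eigen_skew m (grade_support m 0))"
    if "A \<in> eigen_pre m (eigen_skew m (grade_support m 0))" "B \<in> eigen_pre m (eigen_skew m (grade_support m 0))" for A B
    by (rule eigen_pre_bracket[OF br that])
qed

lemma \<gg>_grade_0_iso:
  "lie_isomorphic CC (\<gg>_grade (m + 2) 0) (lie_direct_sum (lie_direct_sum (so (m + 1)) (so (m + 1))) abelian_C)"
proof -
  let ?N = "2 * m + 4" and ?V = "eigen_skew m (grade_support m 0)"
  define Q where "Q = so_form (m + 1) (perm_mat (m + 1) (half_dual m))"
  have Q: "lie_isomorphic CC Q (so (m + 1))"
    unfolding Q_def
    by (rule so_form_iso_so) (simp_all add: perm_mat_transpose[OF involution_half_dual, simplified] perm_mat_square[OF involution_half_dual, simplified])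
  then obtain k where k: "k \<in> lie_iso CC Q (so (m + 1))" and so: "lie_algebra CC (so (m + 1))"
    by (auto simp: lie_isomorphic_def)
  have 1: "to_eigen m \<in> lie_iso CC (\<gg>_grade (m + 2) 0) (gl_on ?N ?V)"
    unfolding \<gg>_grade_conv
  proof (rule lie_isoI[OF eigen_pre_hom])
    show "bij_betw (to_eigen m) (carrier (gl_on ?N (eigen_pre m ?V))) (carrier (gl_on ?N ?V))"
      using eigen_pre_bij[of ?V m] by (simp add: eigen_skew_mono)
    fix x y assume "x \<in> carrier (gl_on ?N (eigen_pre m ?V))" "y \<in> carrier (gl_on ?N (eigen_pre m ?V))"
    then have "x \<in> carrier (\<gg> (m + 2))" "y \<in> carrier (\<gg> (m + 2))" by (auto simp: eigen_pre_def)
    then show "to_eigen m (lie_bracket (gl_on ?N (eigen_pre m ?V)) x y) =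
        lie_bracket (gl_on ?N ?V) (to_eigen m x) (to_eigen m y)"
      using to_eigen_bracket[OF \<gg>_carrierD \<gg>_carrierD] by (simp add: gl_simps)
  qed
  have 2: "map_prod (map_prod k k) id \<in> lie_iso CC (lie_direct_sum (lie_direct_sum Q Q) abelian_C)
      (lie_direct_sum (lie_direct_sum (so (m + 1)) (so (m + 1))) abelian_C)"
    by (intro lie_iso_direct_sum k lie_iso_id)
  show ?thesis
    by (rule lie_isomorphicI[OF \<gg>_grade_0_lie_algebra _ lie_iso_comp[OF lie_iso_comp[OF 1 grade_0_blocks_lie_iso] 2[unfolded Q_def]]])
      (intro lie_algebra_direct_sum so lie_algebra_abelian_C)
qed

theorem mainTheorem5:
  fixes n :: nat
  assumes "5 \<le> n" and "odd n"
  shows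
    "\<sigma> n permutes {1..2 * n}
     \<and> lie_isomorphic CC (\<gg> n) (so (2 * n))
     \<and> lam n \<in> lie_iso CC (\<gg> n) (\<gg> n)
     \<and> has_order_on (lam n) (carrier (\<gg> n)) 4
     \<and> internal_direct_sum CC (\<gg> n) {0, 1, 2, 3} (grade n)
     \<and> carrier (\<gg>_tilde0 n) \<subseteq> carrier (\<gg>_grade n 0)
     \<and> mid_block n \<in> lie_iso CC (\<gg>_tilde0 n) (so_form (n - 2) (antidiag (n - 2)))
     \<and> lie_isomorphic CC (\<gg>_tilde0 n) (so (n - 2))
     \<and> type_B ((n - 3) div 2) (\<gg>_tilde0 n)
     \<comment> \<open>(1)\<close>
     \<and> lie_module CC (\<gg>_tilde0 n) (\<gg>_grade n 0) (lie_bracket (\<gg> n))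
     \<and> (\<exists>V1 V2 T A.
          internal_direct_sum CC (\<gg>_grade n 0) {0..<5}
            (\<lambda>i. [carrier (\<gg>_tilde0 n), V1, V2, T, A] ! i)
          \<and> (\<forall>V \<in> {V1, V2}.
               lie_module_isomorphic CC (\<gg>_tilde0 n)
                 ((\<gg> n)\<lparr>carrier := V\<rparr>) (lie_bracket (\<gg> n))
                 (module_vec TYPE(complex) (n - 2)) (vector_act n)
               \<and> has_dim CC ((\<gg> n)\<lparr>carrier := V\<rparr>) (n - 2))
          \<and> lie_module_isomorphic CC (\<gg>_tilde0 n)
               ((\<gg> n)\<lparr>carrier := T\<rparr>) (lie_bracket (\<gg> n))
               abelian_C (\<lambda>x v. 0)
          \<and> has_dim CC ((\<gg> n)\<lparr>carrier := T\<rparr>) 1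
          \<and> lie_module_isomorphic CC (\<gg>_tilde0 n)
               ((\<gg> n)\<lparr>carrier := A\<rparr>) (lie_bracket (\<gg> n))
               (\<gg>_tilde0 n) (lie_bracket (\<gg> n))
          \<and> has_dim CC ((\<gg> n)\<lparr>carrier := A\<rparr>) ((n - 2) * (n - 3) div 2))
     \<comment> \<open>(2)\<close>
     \<and> lie_isomorphic CC (\<gg>_grade n 0)
         (lie_direct_sum (lie_direct_sum (so (n - 1)) (so (n - 1))) abelian_C)
     \<and> has_dim CC (\<gg>_grade n 0) (n ^ 2 - 3 * n + 3)
     \<comment> \<open>(3)\<close>
     \<and> has_dim CC (\<gg>_grade n 1) (2 * n - 2)
     \<and> has_dim CC (\<gg>_grade n 3) (2 * n - 2)
     \<and> has_dim CC (\<gg>_grade n 2) (n ^ 2 - 2 * n + 1)"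
proof -
  have "n = (n - 2) + 2" using assms(1) by simp
  then obtain m where n: "n = m + 2" by blast
  have m: "3 \<le> m" "odd m" using assms unfolding n by auto
  have m1: "m + 2 - 2 = m" "m + 2 - 3 = m - 1" "m + 2 - 1 = m + 1" by simp_all
  have N: "2 * (m + 2) = 2 * m + 4" by simp
  have B: "type_B ((m - 1) div 2) (\<gg>_tilde0 (m + 2))"
  proof -
    \<comment> \<open>Oddness of \<open>n\<close>, hence of \<open>m\<close>, makes the halving
      exact, and \<open>n \<ge> 5\<close> gives rank at least 1.\<close>
    have "2 * ((m - 1) div 2) + 1 = m" using m by (auto elim!: oddE)
    moreover have "1 \<le> (m - 1) div 2" using m by linarith
    ultimately show ?thesis unfolding type_B_def using \<gg>_tilde0_iso_so[of m] by simp
  qed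
  have sq: "(m + 2) ^ 2 = m * m + 4 * m + 4" by (simp add: power2_eq_square algebra_simps)
  have mm: "m \<le> m * m" by simp
  \<comment> \<open>Subtraction of naturals: \<open>m \<ge> 3\<close> ensures that
    \<open>3 * (m + 2)\<close> does not exceed the square, so nothing is truncated.\<close>
  have d0: "(m + 2) ^ 2 - 3 * (m + 2) + 3 = m * (m + 1) + 1"
    unfolding sq using m(1) mm by (simp add: algebra_simps)
  have d1: "2 * m + 4 - 2 = 2 * m + 2" by simp
  have d2: "(m + 2) ^ 2 - (2 * m + 4) + 1 = (m + 1) ^ 2"
    unfolding sq by (simp add: power2_eq_square algebra_simps)
  have iso: "lie_isomorphic CC (\<gg> (m + 2)) (so (2 * m + 4))"
    unfolding \<gg>_conv by (rule so_form_iso_so) simp_all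
  have sub0: "carrier (\<gg>_tilde0 (m + 2)) \<subseteq> carrier (\<gg>_grade (m + 2) 0)"
  proof -
    have "eigen_tilde0 m \<subseteq> eigen_skew m (grade_support m 0)"
      using eigen_skew_mono[of "mid_blocks m" "grade_support m 0" m] support_grade_0(1,2)[of m]
      unfolding eigen_tilde0_def by blast
    then show ?thesis unfolding \<gg>_tilde0_conv \<gg>_grade_conv by (auto simp: eigen_pre_def)
  qed
  have "\<exists>V1 V2 T A.
      internal_direct_sum CC (\<gg>_grade (m + 2) 0) {0..<5} (\<lambda>i. [carrier (\<gg>_tilde0 (m + 2)), V1, V2, T, A] ! i)
      \<and> (\<forall>V \<in> {V1, V2}.
           lie_module_isomorphic CC (\<gg>_tilde0 (m + 2)) (\<gg> (m + 2)\<lparr>carrier := V\<rparr>) (lie_bracket (\<gg> (m + 2)))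
             (module_vec TYPE(complex) m) (vector_act (m + 2))
           \<and> has_dim CC (\<gg> (m + 2)\<lparr>carrier := V\<rparr>) m)
      \<and> lie_module_isomorphic CC (\<gg>_tilde0 (m + 2)) (\<gg> (m + 2)\<lparr>carrier := T\<rparr>) (lie_bracket (\<gg> (m + 2)))
           abelian_C (\<lambda>x v. 0)
      \<and> has_dim CC (\<gg> (m + 2)\<lparr>carrier := T\<rparr>) 1
      \<and> lie_module_isomorphic CC (\<gg>_tilde0 (m + 2)) (\<gg> (m + 2)\<lparr>carrier := A\<rparr>) (lie_bracket (\<gg> (m + 2)))
           (\<gg>_tilde0 (m + 2)) (lie_bracket (\<gg> (m + 2)))
      \<and> has_dim CC (\<gg> (m + 2)\<lparr>carrier := A\<rparr>) (m * (m - 1) div 2)"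
    unfolding \<gg>_update
    by (rule exI[of _ "eigen_pre m (eigen_skew m (cross m 1 0))"],
        rule exI[of _ "eigen_pre m (eigen_skew m (cross m (m + 2) (m + 1)))"],
        rule exI[of _ "eigen_pre m (eigen_skew m (corner m))"],
        rule exI[of _ "eigen_pre m (eigen_skew m (block m (m + 2)))"])
      (intro conjI ballI fixed_point_internal_direct_sum corner_module adjoint_module;
        elim insertE emptyE; hypsubst; rule cross_module; simp)
  then show ?thesis
    unfolding n m1 N d0 d1 d2
    using \<sigma>_permutes[of m, unfolded N] iso lam_lie_iso lam_has_order grade_internal_direct_sum sub0 mid_block_lie_iso
      \<gg>_tilde0_iso_so B \<gg>_grade_0_module \<gg>_grade_0_iso grade_0_dim grade_1_dim grade_3_dim grade_2_dim
    by (intro conjI) assumption+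
qed

end
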